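(* Let $k$ be a field, $H$ a dual quasi-Hopf algebra over $k$ with reassociator $\phi$, and $A$ an associative unital $k$-algebra on which $H$ acts from the left by a $k$-linear map $H\otimes A\to A$, $h\otimes a\mapsto h\cdot a$. Consider $A$ as a right $H$-comodule via the trivial coaction $a\mapsto a\otimes1$, and $H$ as a right $H$-comodule via its comultiplication $\Delta(h)=h_1\otimes h_2$. Let $\tau:H\otimes H\to A$ be a $k$-linear map and consider the following morphisms in the monoidal category $\mathcal M^H$ of right $H$-comodules: - $\psi:H\otimes A\to A\otimes H$, $\psi(h\otimes a)=h_1\cdot a\otimes h_2$; - $\zeta:H\otimes H\to A\otimes H$, $\zeta(h\otimes h')=\tau(h_1\otimes h'_1)\otimes h_2h'_2$; - $\sigma:k\to A\otimes H$, $\sigma(1)=1\otimes1$. Then $(A,H)$ with $\psi,\zeta,\sigma$ is a wreath in $\mathcal M^H$ if and only if $(A,\tau)$ is an $H$-crossed system. Furthermore, in this case the corresponding wreath product is the crossed product algebra $A\,\overline{\#}_\tau H$, an algebra in $\mathcal M^H$.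
   Context: Dual quasi-bialgebra: a coassociative counital $k$-coalgebra $(H,\Delta,\varepsilon)$ with a coalgebra map $H\otimes H\to H$ (multiplication), a unit $1\in H$ which is grouplike and two-sided neutral for the multiplication, and a convolution invertible $\phi:H^{\otimes3}\to k$ such that for all $h,g,l,m$: $h_1(g_1l_1)\phi(h_2,g_2,l_2)=\phi(h_1,g_1,l_1)(h_2g_2)l_2$; $\phi(h_1,g_1,l_1m_1)\phi(h_2g_2,l_2,m_2)=\phi(g_1,l_1,m_1)\phi(h_1,g_2l_2,m_2)\phi(h_2,g_3,l_3)$; $\phi(h,1,g)=\varepsilon(h)\varepsilon(g)$. It is a dual quasi-Hopf algebra if it moreover has an antipode: a coalgebra antimorphism $S:H\to H$ and $\alpha,\beta\in H^*$ with $S(h_1)h_3\,\alpha(h_2)=\alpha(h)1$, $h_1S(h_3)\,\beta(h_2)=\beta(h)1$, $\phi(h_1,S(h_3),h_5)\beta(h_2)\alpha(h_4)=\varepsilon(h)=\phi^{-1}(S(h_1),h_3,S(h_5))\alpha(h_2)\beta(h_4)$. The category $\mathcal M^H$ of right $H$-comodules is monoidal with $\otimes_k$, codiagonal coaction $u\otimes v\mapsto u_0\otimes v_0\otimes u_1v_1$ and associativity constraint $(u\otimes v)\otimes w\mapsto u_0\otimes(v_0\otimes w_0)\,\phi(u_1,v_1,w_1)$. $H$-crossed system $(A,\tau)$: for all $h,h',h''\in H$, $a,a'\in A$: $h\cdot(aa')=(h_1\cdot a)(h_2\cdot a')$, $h\cdot1_A=\varepsilon(h)1_A$, $1_H\cdot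 a=a$; $[h_1\cdot(h'_1\cdot a)]\tau(h_2\otimes h'_2)=\tau(h_1\otimes h'_1)(h_2h'_2\cdot a)$; $(h_1\cdot\tau(h'_1\otimes h''_1))\tau(h_2\otimes h'_2h''_2)=\tau(h_1\otimes h'_1)\tau(h_2h'_2\otimes h''_1)\phi^{-1}(h_3,h'_3,h''_2)$; $\tau(1\otimes h)=\tau(h\otimes1)=\varepsilon(h)1$. $A\,\overline{\#}_\tau H$ is $A\otimes H$ with coaction $a\otimes h\mapsto a\otimes h_1\otimes h_2$, multiplication $(a\otimes h)(a'\otimes h')=a(h_1\cdot a')\tau(h_2\otimes h'_1)\otimes h_3h'_2$ and unit $1\otimes1$. A wreath $(A,X)$ in a monoidal category $\mathcal C$ with unit $\underline1$ (associativity constraints inserted where needed; identities denoted by objects): an algebra $(A,m_A,\eta_A)$, an object $X$, and morphisms $\psi:X\otimes A\to A\otimes X$, $\zeta:X\otimes X\to A\otimes X$, $\sigma:\underline1\to A\otimes X$ satisfying $\psi(X\otimes m_A)=(m_A\otimes X)(A\otimes\psi)(\psi\otimes A)$, $\psi(X\otimes\eta_A)=\eta_A\otimes X$; $(m_A\otimes X)(A\otimes\psi)(\zeta\otimes A)=(m_A\otimes X)(A\otimes\zeta)(\psi\otimes X)(X\otimes\psi)$; $(m_A\otimes X)(A\otimes\zeta)(\psi\otimes X)(X\otimes\zeta)=(m_A\otimes X)(A\otimes\zeta)(\zeta\otimes X)$; $(m_A\otimes X)(A\otimes\sigma)=(m_A\otimes X)(A\otimes\psi)(\sigma\otimes A)$;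 $(m_A\otimes X)(A\otimes\zeta)(\psi\otimes X)(X\otimes\sigma)=\eta_A\otimes X=(m_A\otimes X)(A\otimes\zeta)(\sigma\otimes X)$. Its wreath product is the algebra $A\otimes X$ with multiplication $(m_A\otimes X)(m_A\otimes\zeta)(A\otimes\psi\otimes X)$ and unit $\sigma$. *)

theory Defs
  imports Complex_Main "HOL-Library.Function_Algebras"
begin

text \<open>
  A vector space over the field \<open>'k\<close> is a subspace \<open>carr V\<close> of an ambient type that is itself a
  vector space under \<open>scl V\<close> (\<open>carr V = UNIV\<close> is allowed).  Carriers are needed because the
  tensor product of two spaces depends on their scalar multiplications and hence is not a type.
  Maps are HOL functions of which only the values on the carriers matter; accordingly, all
  equations between maps are stated on carriers.
\<close>

record ('k, 'v) vspace =
  carr :: "'v set"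
  scl :: "'k \<Rightarrow> 'v \<Rightarrow> 'v"

definition is_vspace :: "('k::field, 'v::ab_group_add, 'z) vspace_scheme \<Rightarrow> bool" where
  "is_vspace V \<longleftrightarrow> vector_space (scl V) \<and> module.subspace (scl V) (carr V)"

definition k_space :: "('k::field, 'k) vspace" where
  "k_space = \<lparr>carr = UNIV, scl = (*)\<rparr>"

definition lin :: "('k::field, 'v::ab_group_add, 'y) vspace_scheme \<Rightarrow>
    ('k, 'w::ab_group_add, 'z) vspace_scheme \<Rightarrow> ('v \<Rightarrow> 'w) \<Rightarrow> bool" where
  "lin V W f \<longleftrightarrow>
     (\<forall>x\<in>carr V. f x \<in> carr W) \<and>
     (\<forall>x\<in>carr V. \<forall>y\<in>carr V. f (x + y) = f x + f y) \<and>
     (\<forall>c. \<forall>x\<in>carr V. f (scl V c x) = scl W c (f x))"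

definition bilin :: "('k::field, 'v::ab_group_add, 'x) vspace_scheme \<Rightarrow>
    ('k, 'w::ab_group_add, 'y) vspace_scheme \<Rightarrow> ('k, 'u::ab_group_add, 'z) vspace_scheme \<Rightarrow>
    ('v \<Rightarrow> 'w \<Rightarrow> 'u) \<Rightarrow> bool" where
  "bilin V W U f \<longleftrightarrow>
     (\<forall>v\<in>carr V. lin W U (f v)) \<and> (\<forall>w\<in>carr W. lin V U (\<lambda>v. f v w))"


section \<open>Tensor products over the field\<close>

text \<open>
  \<open>V \<otimes> W\<close> is realised inside the dual of the space of bilinear forms on \<open>V \<times> W\<close>: the pure tensor
  \<open>v \<otimes> w\<close> is evaluation at \<open>(v, w)\<close>, and \<open>V \<otimes> W\<close> is the span of the pure tensors.  Over a field
  this has the universal property of the tensor product, proved below.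
\<close>

type_synonym ('v, 'w, 'k) tensor = "('v \<Rightarrow> 'w \<Rightarrow> 'k) \<Rightarrow> 'k"

definition tens :: "('k::field, 'v::ab_group_add, 'y) vspace_scheme \<Rightarrow>
    ('k, 'w::ab_group_add, 'z) vspace_scheme \<Rightarrow> 'v \<Rightarrow> 'w \<Rightarrow> ('v, 'w, 'k) tensor" where
  "tens V W v w = (\<lambda>B. if bilin V W k_space B then B v w else 0)"

definition tensor :: "('k::field, 'v::ab_group_add, 'y) vspace_scheme \<Rightarrow>
    ('k, 'w::ab_group_add, 'z) vspace_scheme \<Rightarrow> ('k, ('v, 'w, 'k) tensor) vspace" where
  "tensor V W =
     \<lparr>carr = module.span (\<lambda>c t B. c * t B) {tens V W v w |v w. v \<in> carr V \<and> w \<in> carr W},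
      scl = (\<lambda>c t B. c * t B)\<rparr>"

text \<open>
  The linear map on \<open>V \<otimes> W\<close> induced by a bilinear map \<open>f\<close>: it sends \<open>\<Sum>\<^sub>i v\<^sub>i \<otimes> w\<^sub>i\<close> to
  \<open>\<Sum>\<^sub>i f v\<^sub>i w\<^sub>i\<close>.
\<close>

definition tlift :: "('k::field, 'v::ab_group_add, 'y) vspace_scheme \<Rightarrow>
    ('k, 'w::ab_group_add, 'z) vspace_scheme \<Rightarrow> ('v \<Rightarrow> 'w \<Rightarrow> 'u::ab_group_add) \<Rightarrow>
    ('v, 'w, 'k) tensor \<Rightarrow> 'u" where
  "tlift V W f t = (THE z. \<exists>ps. set ps \<subseteq> carr V \<times> carr W \<and>
     t = (\<Sum>(v, w)\<leftarrow>ps. tens V W v w) \<and> z = (\<Sum>(v, w)\<leftarrow>ps. f v w))"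

definition tmap :: "('k::field, 'v::ab_group_add, 'x1) vspace_scheme \<Rightarrow>
    ('k, 'w::ab_group_add, 'x2) vspace_scheme \<Rightarrow>
    ('k, 'v1::ab_group_add, 'x3) vspace_scheme \<Rightarrow>
    ('k, 'w1::ab_group_add, 'x4) vspace_scheme \<Rightarrow>
    ('v \<Rightarrow> 'v1) \<Rightarrow> ('w \<Rightarrow> 'w1) \<Rightarrow> ('v, 'w, 'k) tensor \<Rightarrow> ('v1, 'w1, 'k) tensor" where
  "tmap V W V' W' f g = tlift V W (\<lambda>v w. tens V' W' (f v) (g w))"


subsection \<open>The universal property\<close>

lemma vector_space_tensor_scale:
  "vector_space (\<lambda>c (t :: 'i \<Rightarrow> 'k::field) B. c * t B)"
  by unfold_locales (auto simp: fun_eq_iff algebra_simps)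

lemma is_vspace_k_space: "is_vspace (k_space :: ('k::field, 'k) vspace)"
proof -
  have vs: "vector_space ((*) :: 'k \<Rightarrow> 'k \<Rightarrow> 'k)"
    by unfold_locales (auto simp: algebra_simps)
  then interpret vector_space "(*) :: 'k \<Rightarrow> 'k \<Rightarrow> 'k" .
  show ?thesis
    using vs by (simp add: is_vspace_def k_space_def)
qed

lemma is_vspace_tensor:
  fixes V :: "('k::field, 'v::ab_group_add, 'y) vspace_scheme"
    and W :: "('k, 'w::ab_group_add, 'z) vspace_scheme"
  shows "is_vspace (tensor V W)"
proof -
  interpret vector_space "\<lambda>c (t :: ('v \<Rightarrow> 'w \<Rightarrow> 'k) \<Rightarrow> 'k) B. c * t B"
    by (rule vector_space_tensor_scale)
  show ?thesis
    using vector_space_axioms by (simp add: is_vspace_def tensor_def)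
qed

lemma tens_in_tensor:
  fixes V :: "('k::field, 'v::ab_group_add, 'y) vspace_scheme"
    and W :: "('k, 'w::ab_group_add, 'z) vspace_scheme"
  assumes "v \<in> carr V" "w \<in> carr W"
  shows "tens V W v w \<in> carr (tensor V W)"
proof -
  interpret vector_space "\<lambda>c (t :: ('v \<Rightarrow> 'w \<Rightarrow> 'k) \<Rightarrow> 'k) B. c * t B"
    by (rule vector_space_tensor_scale)
  show ?thesis
    using assms by (auto simp: tensor_def intro!: span_base)
qed

lemma is_vspace_closed:
  assumes "is_vspace V"
  shows "0 \<in> carr V" "x \<in> carr V \<Longrightarrow> y \<in> carr V \<Longrightarrow> x + y \<in> carr V"
    "x \<in> carr V \<Longrightarrow> scl V c x \<in> carr V"
proof -
  interpret vector_space "scl V" using assms by (simp add: is_vspace_def)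
  have "subspace (carr V)" using assms by (simp add: is_vspace_def)
  then show "0 \<in> carr V" "x \<in> carr V \<Longrightarrow> y \<in> carr V \<Longrightarrow> x + y \<in> carr V"
    "x \<in> carr V \<Longrightarrow> scl V c x \<in> carr V"
    by (auto intro: subspace_0 subspace_add subspace_scale)
qed

lemma scl_tens:
  fixes V :: "('k::field, 'v::ab_group_add, 'y) vspace_scheme"
    and W :: "('k, 'w::ab_group_add, 'z) vspace_scheme"
  assumes "v \<in> carr V" "w \<in> carr W"
  shows "scl (tensor V W) c (tens V W v w) = tens V W (scl V c v) w"
  using assms
  by (auto simp: tensor_def tens_def bilin_def lin_def k_space_def fun_eq_iff)

lemma tensor_repr:
  fixes V :: "('k::field, 'v::ab_group_add, 'y) vspace_scheme"
    and W :: "('k, 'w::ab_group_add, 'z) vspace_scheme"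
  assumes V: "is_vspace V" and "t \<in> carr (tensor V W)"
  shows "\<exists>ps. set ps \<subseteq> carr V \<times> carr W \<and> t = (\<Sum>(v, w)\<leftarrow>ps. tens V W v w)"
proof -
  interpret vector_space "\<lambda>c (t :: ('v \<Rightarrow> 'w \<Rightarrow> 'k) \<Rightarrow> 'k) B. c * t B"
    by (rule vector_space_tensor_scale)
  have "t \<in> span {tens V W v w |v w. v \<in> carr V \<and> w \<in> carr W}"
    using assms(2) by (simp add: tensor_def)
  then show ?thesis
  proof (induction rule: span_induct_alt)
    case base
    show ?case by (rule exI[of _ "[]"]) simp
  next
    case (step c x y)
    then obtain v w ps where vw: "v \<in> carr V" "w \<in> carr W" "x = tens V W v w"
      and ps: "set ps \<subseteq> carr V \<times> carr W" "y = (\<Sum>(v, w)\<leftarrow>ps. tens V W v w)"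
      by auto
    have "(\<lambda>B. c * x B) = tens V W (scl V c v) w"
      using scl_tens[OF vw(1,2), of c] by (simp add: tensor_def vw(3))
    moreover have "scl V c v \<in> carr V"
      using V vw(1) by (rule is_vspace_closed(3))
    ultimately show ?case
      using vw ps by (intro exI[of _ "(scl V c v, w) # ps"]) auto
  qed
qed

lemma sum_list_apply: "(\<Sum>p\<leftarrow>ps. F p) B = (\<Sum>p\<leftarrow>ps. F p B)"
  by (induction ps) auto

lemma tlift_sum_unique:
  fixes V :: "('k::field, 'v::ab_group_add, 'y) vspace_scheme"
    and W :: "('k, 'w::ab_group_add, 'z) vspace_scheme"
    and Z :: "('k, 'u::ab_group_add, 'x) vspace_scheme"
  assumes Z: "is_vspace Z" and f: "bilin V W Z f"
    and ps: "set ps \<subseteq> carr V \<times> carr W" and qs: "set qs \<subseteq> carr V \<times> carr W"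
    and eq: "(\<Sum>(v, w)\<leftarrow>ps. tens V W v w) = (\<Sum>(v, w)\<leftarrow>qs. tens V W v w)"
  shows "(\<Sum>(v, w)\<leftarrow>ps. f v w) = (\<Sum>(v, w)\<leftarrow>qs. f v w)"
proof (rule ccontr)
  assume neq: "(\<Sum>(v, w)\<leftarrow>ps. f v w) \<noteq> (\<Sum>(v, w)\<leftarrow>qs. f v w)"
  define d where "d = (\<Sum>(v, w)\<leftarrow>ps. f v w) - (\<Sum>(v, w)\<leftarrow>qs. f v w)"
  have d: "d \<noteq> 0" using neq by (simp add: d_def)
  interpret Z: vector_space "scl Z" using Z by (simp add: is_vspace_def)
  interpret K: vector_space "(*) :: 'k \<Rightarrow> 'k \<Rightarrow> 'k"
    by unfold_locales (auto simp: algebra_simps)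
  interpret ZK: vector_space_pair "scl Z" "(*) :: 'k \<Rightarrow> 'k \<Rightarrow> 'k" ..
  have "Z.independent {d}" using d by simp
  then obtain g where g: "Vector_Spaces.linear (scl Z) (*) g" "g d = 1"
    using ZK.linear_independent_extend[of "{d}" "\<lambda>_. 1"] by auto
  interpret g: Vector_Spaces.linear "scl Z" "(*)" g by (rule g(1))
  have B: "bilin V W k_space (\<lambda>v w. g (f v w))"
    using f by (auto simp: bilin_def lin_def k_space_def g.add g.scale)
  have val: "(\<Sum>(v, w)\<leftarrow>rs. tens V W v w) (\<lambda>v w. g (f v w)) = g (\<Sum>(v, w)\<leftarrow>rs. f v w)" for rs
    using B by (induction rs) (auto simp: tens_def g.add g.zero)
  have "g d = 0"
    using val[of ps] val[of qs] eq by (simp add: d_def g.diff)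
  then show False using g(2) by simp
qed

lemma tlift_eqI:
  fixes V :: "('k::field, 'v::ab_group_add, 'y) vspace_scheme"
    and W :: "('k, 'w::ab_group_add, 'z) vspace_scheme"
    and Z :: "('k, 'u::ab_group_add, 'x) vspace_scheme"
  assumes "is_vspace Z" "bilin V W Z f" "set ps \<subseteq> carr V \<times> carr W"
    and "t = (\<Sum>(v, w)\<leftarrow>ps. tens V W v w)"
  shows "tlift V W f t = (\<Sum>(v, w)\<leftarrow>ps. f v w)"
  unfolding tlift_def
  by (rule the_equality) (use assms tlift_sum_unique[OF assms(1,2)] in blast)+

theorem tensor_universal:
  fixes V :: "('k::field, 'v::ab_group_add, 'y) vspace_scheme"
    and W :: "('k, 'w::ab_group_add, 'z) vspace_scheme"
    and Z :: "('k, 'u::ab_group_add, 'x) vspace_scheme"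
  assumes V: "is_vspace V" and Z: "is_vspace Z" and f: "bilin V W Z f"
  shows "lin (tensor V W) Z (tlift V W f)"
    and "\<And>v w. v \<in> carr V \<Longrightarrow> w \<in> carr W \<Longrightarrow> tlift V W f (tens V W v w) = f v w"
    and "\<And>F t. lin (tensor V W) Z F \<Longrightarrow>
      (\<And>v w. v \<in> carr V \<Longrightarrow> w \<in> carr W \<Longrightarrow> F (tens V W v w) = f v w) \<Longrightarrow>
      t \<in> carr (tensor V W) \<Longrightarrow> F t = tlift V W f t"
proof -
  interpret Z: vector_space "scl Z" using Z by (simp add: is_vspace_def)
  have fZ: "f v w \<in> carr Z" if "v \<in> carr V" "w \<in> carr W" for v w
    using f that by (auto simp: bilin_def lin_def)
  have sumZ: "(\<Sum>(v, w)\<leftarrow>ps. f v w) \<in> carr Z" if "set ps \<subseteq> carr V \<times> carr W" for ps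
    using that by (induction ps) (auto intro!: is_vspace_closed[OF Z] fZ)
  show pure: "tlift V W f (tens V W v w) = f v w" if "v \<in> carr V" "w \<in> carr W" for v w
    using tlift_eqI[OF Z f, of "[(v, w)]"] that by simp
  show "lin (tensor V W) Z (tlift V W f)"
    unfolding lin_def
  proof (intro conjI ballI allI)
    fix t assume t: "t \<in> carr (tensor V W)"
    then obtain ps where ps: "set ps \<subseteq> carr V \<times> carr W" "t = (\<Sum>(v, w)\<leftarrow>ps. tens V W v w)"
      using tensor_repr[OF V] by blast
    have tl: "tlift V W f t = (\<Sum>(v, w)\<leftarrow>ps. f v w)" by (rule tlift_eqI[OF Z f ps])
    show "tlift V W f t \<in> carr Z" using tl sumZ ps by simp
    show "tlift V W f (t + s) = tlift V W f t + tlift V W f s"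
      if s: "s \<in> carr (tensor V W)" for s
    proof -
      obtain qs where qs: "set qs \<subseteq> carr V \<times> carr W" "s = (\<Sum>(v, w)\<leftarrow>qs. tens V W v w)"
        using tensor_repr[OF V s] by blast
      show ?thesis
        using tlift_eqI[OF Z f, of "ps @ qs" "t + s"] tlift_eqI[OF Z f qs] tl ps qs by simp
    qed
    show "tlift V W f (scl (tensor V W) c t) = scl Z c (tlift V W f t)" for c
    proof -
      let ?ps = "map (\<lambda>(v, w). (scl V c v, w)) ps"
      have set: "set ?ps \<subseteq> carr V \<times> carr W"
        using ps(1) is_vspace_closed(3)[OF V] by auto
      have "scl (tensor V W) c (\<Sum>(v, w)\<leftarrow>ps. tens V W v w) =
          (\<Sum>(v, w)\<leftarrow>?ps. tens V W v w)" using ps(1)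
      proof (induction ps)
        case Nil
        then show ?case by (simp add: tensor_def fun_eq_iff)
      next
        case (Cons p ps)
        then have "scl (tensor V W) c (tens V W (fst p) (snd p)) =
            tens V W (scl V c (fst p)) (snd p)"
          by (intro scl_tens) auto
        with Cons show ?case
          by (auto simp: tensor_def fun_eq_iff algebra_simps split: prod.splits)
      qed
      moreover have "scl Z c (\<Sum>(v, w)\<leftarrow>ps. f v w) = (\<Sum>(v, w)\<leftarrow>?ps. f v w)"
        using ps(1)
      proof (induction ps)
        case (Cons p ps)
        then have "f (scl V c (fst p)) (snd p) = scl Z c (f (fst p) (snd p))"
          using f by (auto simp: bilin_def lin_def)
        with Cons show ?case by (auto simp: Z.scale_right_distrib split: prod.splits)
      qed simp
      ultimately show ?thesis
        using tlift_eqI[OF Z f set] tl ps(2) by simp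
    qed
  qed
  show "F t = tlift V W f t"
    if F: "lin (tensor V W) Z F"
      "\<And>v w. v \<in> carr V \<Longrightarrow> w \<in> carr W \<Longrightarrow> F (tens V W v w) = f v w"
      and t: "t \<in> carr (tensor V W)" for F t
  proof -
    obtain ps where ps: "set ps \<subseteq> carr V \<times> carr W" "t = (\<Sum>(v, w)\<leftarrow>ps. tens V W v w)"
      using tensor_repr[OF V t] by blast
    have T: "is_vspace (tensor V W)" by (rule is_vspace_tensor)
    have "F 0 = F 0 + F 0"
      using F(1) is_vspace_closed(1)[OF T] by (metis add.right_neutral lin_def)
    then have F0: "F 0 = 0" by simp
    have "(\<Sum>(v, w)\<leftarrow>ps. tens V W v w) \<in> carr (tensor V W) \<and>
        F (\<Sum>(v, w)\<leftarrow>ps. tens V W v w) = (\<Sum>(v, w)\<leftarrow>ps. f v w)" using ps(1)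
    proof (induction ps)
      case Nil
      then show ?case using F0 is_vspace_closed(1)[OF T] by (simp add: zero_fun_def)
    next
      case (Cons p ps)
      then have p: "fst p \<in> carr V" "snd p \<in> carr W" by auto
      let ?t = "tens V W (fst p) (snd p)" and ?s = "\<Sum>(v, w)\<leftarrow>ps. tens V W v w"
      have in_t: "?t \<in> carr (tensor V W)" by (rule tens_in_tensor[OF p])
      have in_s: "?s \<in> carr (tensor V W)" and Fs: "F ?s = (\<Sum>(v, w)\<leftarrow>ps. f v w)"
        using Cons by auto
      have "F (?t + ?s) = F ?t + F ?s"
        using F(1) in_t in_s unfolding lin_def by blast
      moreover have "F ?t = f (fst p) (snd p)" using F(2) p by blast
      moreover have "?t + ?s \<in> carr (tensor V W)"
        by (rule is_vspace_closed(2)[OF T in_t in_s])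
      ultimately show ?case using Fs by (simp add: split_def del: plus_fun_apply)
    qed
    then show ?thesis using tlift_eqI[OF Z f ps] ps(2) by simp
  qed
qed


section \<open>Coalgebras\<close>

record ('k, 'v) coalg = "('k, 'v) vspace" +
  comul :: "'v \<Rightarrow> ('v, 'v, 'k) tensor"
  counit :: "'v \<Rightarrow> 'k"

text \<open>
  Sweedler notation: \<open>sw C x (\<lambda>x\<^sub>1 x\<^sub>2. f x\<^sub>1 x\<^sub>2)\<close> stands for \<open>f(x\<^sub>1, x\<^sub>2)\<close> with \<open>\<Delta>(x) = x\<^sub>1 \<otimes> x\<^sub>2\<close>
  (summation understood), for bilinear \<open>f\<close>.
\<close>

definition sw :: "('k::field, 'v::ab_group_add, 'z) coalg_scheme \<Rightarrow> 'v \<Rightarrow>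
    ('v \<Rightarrow> 'v \<Rightarrow> 'u::ab_group_add) \<Rightarrow> 'u" where
  "sw C x f = tlift C C f (comul C x)"

definition sw3 :: "('k::field, 'v::ab_group_add, 'z) coalg_scheme \<Rightarrow> 'v \<Rightarrow>
    ('v \<Rightarrow> 'v \<Rightarrow> 'v \<Rightarrow> 'u::ab_group_add) \<Rightarrow> 'u" where
  "sw3 C x f = sw C x (\<lambda>x1 y. sw C y (\<lambda>x2 x3. f x1 x2 x3))"

definition sw5 :: "('k::field, 'v::ab_group_add, 'z) coalg_scheme \<Rightarrow> 'v \<Rightarrow>
    ('v \<Rightarrow> 'v \<Rightarrow> 'v \<Rightarrow> 'v \<Rightarrow> 'v \<Rightarrow> 'u::ab_group_add) \<Rightarrow> 'u" where
  "sw5 C x f = sw3 C x (\<lambda>x1 x2 y. sw3 C y (\<lambda>x3 x4 x5. f x1 x2 x3 x4 x5))"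

definition coalgebra :: "('k::field, 'v::ab_group_add, 'z) coalg_scheme \<Rightarrow> bool" where
  "coalgebra C \<longleftrightarrow>
     is_vspace C \<and> lin C (tensor C C) (comul C) \<and> lin C k_space (counit C) \<and>
     (\<forall>x\<in>carr C.
        sw C x (\<lambda>y x3. sw C y (\<lambda>x1 x2. tens C (tensor C C) x1 (tens C C x2 x3))) =
        sw C x (\<lambda>x1 y. sw C y (\<lambda>x2 x3. tens C (tensor C C) x1 (tens C C x2 x3)))) \<and>
     (\<forall>x\<in>carr C. sw C x (\<lambda>x1 x2. scl C (counit C x1) x2) = x) \<and>
     (\<forall>x\<in>carr C. sw C x (\<lambda>x1 x2. scl C (counit C x2) x1) = x)"

definition tensor_coalg :: "('k::field, 'v::ab_group_add, 'y) coalg_scheme \<Rightarrow>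
    ('k, 'w::ab_group_add, 'z) coalg_scheme \<Rightarrow> ('k, ('v, 'w, 'k) tensor) coalg" where
  "tensor_coalg C D =
     \<lparr>carr = carr (tensor C D), scl = scl (tensor C D),
      comul = tlift C D (\<lambda>x y. sw C x (\<lambda>x1 x2. sw D y (\<lambda>y1 y2.
        tens (tensor C D) (tensor C D) (tens C D x1 y1) (tens C D x2 y2)))),
      counit = tlift C D (\<lambda>x y. counit C x * counit D y)\<rparr>"

definition coalgebra_hom :: "('k::field, 'v::ab_group_add, 'y) coalg_scheme \<Rightarrow>
    ('k, 'w::ab_group_add, 'z) coalg_scheme \<Rightarrow> ('v \<Rightarrow> 'w) \<Rightarrow> bool" where
  "coalgebra_hom C D f \<longleftrightarrow> lin C D f \<and>
     (\<forall>x\<in>carr C. comul D (f x) = sw C x (\<lambda>x1 x2. tens D D (f x1) (f x2))) \<and>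
     (\<forall>x\<in>carr C. counit D (f x) = counit C x)"

definition coalgebra_antihom :: "('k::field, 'v::ab_group_add, 'y) coalg_scheme \<Rightarrow>
    ('k, 'w::ab_group_add, 'z) coalg_scheme \<Rightarrow> ('v \<Rightarrow> 'w) \<Rightarrow> bool" where
  "coalgebra_antihom C D f \<longleftrightarrow> lin C D f \<and>
     (\<forall>x\<in>carr C. comul D (f x) = sw C x (\<lambda>x1 x2. tens D D (f x2) (f x1))) \<and>
     (\<forall>x\<in>carr C. counit D (f x) = counit C x)"

definition conv :: "('k::field, 'v::ab_group_add, 'z) coalg_scheme \<Rightarrow>
    ('v \<Rightarrow> 'k) \<Rightarrow> ('v \<Rightarrow> 'k) \<Rightarrow> 'v \<Rightarrow> 'k" where
  "conv C f g x = sw C x (\<lambda>x1 x2. f x1 * g x2)"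

definition is_conv_inverse :: "('k::field, 'v::ab_group_add, 'z) coalg_scheme \<Rightarrow>
    ('v \<Rightarrow> 'k) \<Rightarrow> ('v \<Rightarrow> 'k) \<Rightarrow> bool" where
  "is_conv_inverse C f g \<longleftrightarrow> lin C k_space g \<and>
     (\<forall>x\<in>carr C. conv C f g x = counit C x \<and> conv C g f x = counit C x)"

text \<open>The inverse is unique on the carrier of \<open>C\<close>; \<open>SOME\<close> only fixes its values elsewhere.\<close>

definition conv_inv :: "('k::field, 'v::ab_group_add, 'z) coalg_scheme \<Rightarrow>
    ('v \<Rightarrow> 'k) \<Rightarrow> 'v \<Rightarrow> 'k" where
  "conv_inv C f = (SOME g. is_conv_inverse C f g)"


section \<open>Dual quasi-Hopf algebras\<close>

record ('k, 'h) dqb = "('k, 'h) coalg" +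
  mult :: "('h, 'h, 'k) tensor \<Rightarrow> 'h"
  one :: "'h"
  reass :: "(('h, 'h, 'k) tensor, 'h, 'k) tensor \<Rightarrow> 'k"

definition mul :: "('k::field, 'h::ab_group_add, 'z) dqb_scheme \<Rightarrow> 'h \<Rightarrow> 'h \<Rightarrow> 'h" where
  "mul H h g = mult H (tens H H h g)"

definition phi :: "('k::field, 'h::ab_group_add, 'z) dqb_scheme \<Rightarrow> 'h \<Rightarrow> 'h \<Rightarrow> 'h \<Rightarrow> 'k" where
  "phi H h g l = reass H (tens (tensor H H) H (tens H H h g) l)"

definition phi_inv :: "('k::field, 'h::ab_group_add, 'z) dqb_scheme \<Rightarrow>
    'h \<Rightarrow> 'h \<Rightarrow> 'h \<Rightarrow> 'k" where
  "phi_inv H h g l = conv_inv (tensor_coalg (tensor_coalg H H) H) (reass H)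
     (tens (tensor H H) H (tens H H h g) l)"

definition dual_quasi_bialgebra :: "('k::field, 'h::ab_group_add, 'z) dqb_scheme \<Rightarrow> bool" where
  "dual_quasi_bialgebra H \<longleftrightarrow>
     coalgebra H \<and>
     coalgebra_hom (tensor_coalg H H) H (mult H) \<and>
     one H \<in> carr H \<and> comul H (one H) = tens H H (one H) (one H) \<and> counit H (one H) = 1 \<and>
     (\<forall>h\<in>carr H. mul H (one H) h = h \<and> mul H h (one H) = h) \<and>
     lin (tensor (tensor H H) H) k_space (reass H) \<and>
     (\<exists>g. is_conv_inverse (tensor_coalg (tensor_coalg H H) H) (reass H) g) \<and>
     (\<forall>h\<in>carr H. \<forall>g\<in>carr H. \<forall>l\<in>carr H.
        sw H h (\<lambda>h1 h2. sw H g (\<lambda>g1 g2. sw H l (\<lambda>l1 l2.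
          scl H (phi H h2 g2 l2) (mul H h1 (mul H g1 l1))))) =
        sw H h (\<lambda>h1 h2. sw H g (\<lambda>g1 g2. sw H l (\<lambda>l1 l2.
          scl H (phi H h1 g1 l1) (mul H (mul H h2 g2) l2))))) \<and>
     (\<forall>h\<in>carr H. \<forall>g\<in>carr H. \<forall>l\<in>carr H. \<forall>m\<in>carr H.
        sw H h (\<lambda>h1 h2. sw H g (\<lambda>g1 g2. sw H l (\<lambda>l1 l2. sw H m (\<lambda>m1 m2.
          phi H h1 g1 (mul H l1 m1) * phi H (mul H h2 g2) l2 m2)))) =
        sw H h (\<lambda>h1 h2. sw3 H g (\<lambda>g1 g2 g3. sw3 H l (\<lambda>l1 l2 l3. sw H m (\<lambda>m1 m2.
          phi H g1 l1 m1 * phi H h1 (mul H g2 l2) m2 * phi H h2 g3 l3))))) \<and>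
     (\<forall>h\<in>carr H. \<forall>g\<in>carr H. phi H h (one H) g = counit H h * counit H g)"

definition antipode :: "('k::field, 'h::ab_group_add, 'z) dqb_scheme \<Rightarrow>
    ('h \<Rightarrow> 'h) \<Rightarrow> ('h \<Rightarrow> 'k) \<Rightarrow> ('h \<Rightarrow> 'k) \<Rightarrow> bool" where
  "antipode H S \<alpha> \<beta> \<longleftrightarrow>
     coalgebra_antihom H H S \<and> lin H k_space \<alpha> \<and> lin H k_space \<beta> \<and>
     (\<forall>h\<in>carr H.
        sw3 H h (\<lambda>h1 h2 h3. scl H (\<alpha> h2) (mul H (S h1) h3)) = scl H (\<alpha> h) (one H) \<and>
        sw3 H h (\<lambda>h1 h2 h3. scl H (\<beta> h2) (mul H h1 (S h3))) = scl H (\<beta> h) (one H) \<and>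
        sw5 H h (\<lambda>h1 h2 h3 h4 h5. phi H h1 (S h3) h5 * \<beta> h2 * \<alpha> h4) = counit H h \<and>
        sw5 H h (\<lambda>h1 h2 h3 h4 h5. phi_inv H (S h1) h3 (S h5) * \<alpha> h2 * \<beta> h4) = counit H h)"

definition dual_quasi_hopf_algebra :: "('k::field, 'h::ab_group_add, 'z) dqb_scheme \<Rightarrow> bool" where
  "dual_quasi_hopf_algebra H \<longleftrightarrow> dual_quasi_bialgebra H \<and> (\<exists>S \<alpha> \<beta>. antipode H S \<alpha> \<beta>)"


section \<open>The monoidal category of right comodules\<close>

record ('k, 'v, 'h) comod = "('k, 'v) vspace" +
  coact :: "'v \<Rightarrow> ('v, 'h, 'k) tensor"

text \<open>\<open>csw H V v (\<lambda>v\<^sub>0 v\<^sub>1. f v\<^sub>0 v\<^sub>1)\<close> stands for \<open>f(v\<^sub>0, v\<^sub>1)\<close>, where \<open>v\<^sub>0 \<otimes> v\<^sub>1\<close> is the coaction on \<open>v\<close>.\<close>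

definition csw :: "('k::field, 'h::ab_group_add, 'y) vspace_scheme \<Rightarrow>
    ('k, 'v::ab_group_add, 'h, 'z) comod_scheme \<Rightarrow> 'v \<Rightarrow>
    ('v \<Rightarrow> 'h \<Rightarrow> 'u::ab_group_add) \<Rightarrow> 'u" where
  "csw H V v f = tlift V H f (coact V v)"

definition comodule :: "('k::field, 'h::ab_group_add, 'y) coalg_scheme \<Rightarrow>
    ('k, 'v::ab_group_add, 'h, 'z) comod_scheme \<Rightarrow> bool" where
  "comodule H V \<longleftrightarrow>
     is_vspace V \<and> lin V (tensor V H) (coact V) \<and>
     (\<forall>v\<in>carr V.
        csw H V v (\<lambda>x h2. csw H V x (\<lambda>v0 h1. tens V (tensor H H) v0 (tens H H h1 h2))) =
        csw H V v (\<lambda>v0 y. sw H y (\<lambda>h1 h2. tens V (tensor H H) v0 (tens H H h1 h2)))) \<and>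
     (\<forall>v\<in>carr V. csw H V v (\<lambda>v0 v1. scl V (counit H v1) v0) = v)"

definition comod_hom :: "('k::field, 'h::ab_group_add, 'x) coalg_scheme \<Rightarrow>
    ('k, 'v::ab_group_add, 'h, 'y) comod_scheme \<Rightarrow>
    ('k, 'w::ab_group_add, 'h, 'z) comod_scheme \<Rightarrow> ('v \<Rightarrow> 'w) \<Rightarrow> bool" where
  "comod_hom H V W f \<longleftrightarrow> lin V W f \<and>
     (\<forall>v\<in>carr V. coact W (f v) = csw H V v (\<lambda>v0 v1. tens W H (f v0) v1))"

definition unit_comod :: "('k::field, 'h::ab_group_add, 'z) dqb_scheme \<Rightarrow> ('k, 'k, 'h) comod" where
  "unit_comod H = \<lparr>carr = carr k_space, scl = scl k_space,
     coact = (\<lambda>c. tens k_space H c (one H))\<rparr>"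

definition tensor_comod :: "('k::field, 'h::ab_group_add, 'x) dqb_scheme \<Rightarrow>
    ('k, 'v::ab_group_add, 'h, 'y) comod_scheme \<Rightarrow>
    ('k, 'w::ab_group_add, 'h, 'z) comod_scheme \<Rightarrow>
    ('k, ('v, 'w, 'k) tensor, 'h) comod" where
  "tensor_comod H V W =
     \<lparr>carr = carr (tensor V W), scl = scl (tensor V W),
      coact = tlift V W (\<lambda>v w. csw H V v (\<lambda>v0 v1. csw H W w (\<lambda>w0 w1.
        tens (tensor V W) H (tens V W v0 w0) (mul H v1 w1))))\<rparr>"

definition assoc :: "('k::field, 'h::ab_group_add, 'x) dqb_scheme \<Rightarrow>
    ('k, 'u::ab_group_add, 'h, 'y) comod_scheme \<Rightarrow>
    ('k, 'v::ab_group_add, 'h, 'z) comod_scheme \<Rightarrow>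
    ('k, 'w::ab_group_add, 'h, 'zz) comod_scheme \<Rightarrow>
    (('u, 'v, 'k) tensor, 'w, 'k) tensor \<Rightarrow> ('u, ('v, 'w, 'k) tensor, 'k) tensor" where
  "assoc H U V W = tlift (tensor U V) W (\<lambda>x w. tlift U V (\<lambda>u v.
     csw H U u (\<lambda>u0 u1. csw H V v (\<lambda>v0 v1. csw H W w (\<lambda>w0 w1.
       scl (tensor U (tensor V W)) (phi H u1 v1 w1)
         (tens U (tensor V W) u0 (tens V W v0 w0)))))) x)"

definition assoc_inv :: "('k::field, 'h::ab_group_add, 'x) dqb_scheme \<Rightarrow>
    ('k, 'u::ab_group_add, 'h, 'y) comod_scheme \<Rightarrow>
    ('k, 'v::ab_group_add, 'h, 'z) comod_scheme \<Rightarrow>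
    ('k, 'w::ab_group_add, 'h, 'zz) comod_scheme \<Rightarrow>
    ('u, ('v, 'w, 'k) tensor, 'k) tensor \<Rightarrow> (('u, 'v, 'k) tensor, 'w, 'k) tensor" where
  "assoc_inv H U V W = tlift U (tensor V W) (\<lambda>u y. tlift V W (\<lambda>v w.
     csw H U u (\<lambda>u0 u1. csw H V v (\<lambda>v0 v1. csw H W w (\<lambda>w0 w1.
       scl (tensor (tensor U V) W) (phi_inv H u1 v1 w1)
         (tens (tensor U V) W (tens U V u0 v0) w0))))) y)"

text \<open>The inverse unit constraints \<open>V \<rightarrow> k \<otimes> V\<close> and \<open>V \<rightarrow> V \<otimes> k\<close>.\<close>

definition lunit_inv :: "('k::field, 'v::ab_group_add, 'z) vspace_scheme \<Rightarrow>
    'v \<Rightarrow> ('k, 'v, 'k) tensor" where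
  "lunit_inv V = tens k_space V 1"

definition runit_inv :: "('k::field, 'v::ab_group_add, 'z) vspace_scheme \<Rightarrow>
    'v \<Rightarrow> ('v, 'k, 'k) tensor" where
  "runit_inv V v = tens V k_space v 1"

definition eq_arr :: "('k, 'v, 'z) vspace_scheme \<Rightarrow> ('v \<Rightarrow> 'w) \<Rightarrow> ('v \<Rightarrow> 'w) \<Rightarrow> bool" where
  "eq_arr V f g \<longleftrightarrow> (\<forall>x\<in>carr V. f x = g x)"


section \<open>Algebras and wreaths in the category of comodules\<close>

record ('k, 'v, 'h) comod_alg = "('k, 'v, 'h) comod" +
  amult :: "('v, 'v, 'k) tensor \<Rightarrow> 'v"
  aunit :: "'k \<Rightarrow> 'v"

definition comod_algebra :: "('k::field, 'h::ab_group_add, 'y) dqb_scheme \<Rightarrow>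
    ('k, 'a::ab_group_add, 'h, 'z) comod_alg_scheme \<Rightarrow> bool" where
  "comod_algebra H A \<longleftrightarrow>
     comodule H A \<and>
     comod_hom H (tensor_comod H A A) A (amult A) \<and>
     comod_hom H (unit_comod H) A (aunit A) \<and>
     eq_arr (tensor (tensor A A) A)
       (amult A \<circ> tmap (tensor A A) A A A (amult A) id)
       (amult A \<circ> tmap A (tensor A A) A A id (amult A) \<circ> assoc H A A A) \<and>
     eq_arr A (amult A \<circ> tmap k_space A A A (aunit A) id \<circ> lunit_inv A) id \<and>
     eq_arr A (amult A \<circ> tmap A k_space A A id (aunit A) \<circ> runit_inv A) id"

text \<open>The two structures are equal; maps are compared on their domains.\<close>

definition comod_alg_eq :: "('k::field, 'v::ab_group_add, 'h, 'y) comod_alg_scheme \<Rightarrow>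
    ('k, 'v, 'h, 'z) comod_alg_scheme \<Rightarrow> bool" where
  "comod_alg_eq A B \<longleftrightarrow>
     carr A = carr B \<and> (\<forall>c. eq_arr A (scl A c) (scl B c)) \<and>
     eq_arr A (coact A) (coact B) \<and>
     eq_arr (tensor A A) (amult A) (amult B) \<and> aunit A = aunit B"

text \<open>
  In \<open>wreath\<close>, \<open>m_X\<close> is \<open>m\<^sub>A \<otimes> X\<close>, \<open>A_psi\<close> is \<open>A \<otimes> \<psi>\<close>, \<open>psi_A\<close> is \<open>\<psi> \<otimes> A\<close>, and so on, composed with
  the constraints of the category that make them composable, namely
  \<open>m_X : A(A X) \<rightarrow> A X\<close>, \<open>A_psi : A(X A) \<rightarrow> A(A X)\<close>, \<open>A_zeta : A(X X) \<rightarrow> A(A X)\<close>,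
  \<open>psi_A : (X A)A \<rightarrow> A(X A)\<close>, \<open>psi_X : (X A)X \<rightarrow> A(X X)\<close>, \<open>zeta_A : (X X)A \<rightarrow> A(X A)\<close>,
  \<open>zeta_X : (X X)X \<rightarrow> A(X X)\<close>, \<open>sigma_A : A \<rightarrow> A(X A)\<close>, \<open>sigma_X : X \<rightarrow> A(X X)\<close>,
  \<open>A_sigma : A \<rightarrow> A(A X)\<close>, \<open>X_sigma : X \<rightarrow> X(A X)\<close>, \<open>eta_X : X \<rightarrow> A X\<close>.
\<close>

definition wreath :: "('k::field, 'h::ab_group_add, 'y) dqb_scheme \<Rightarrow>
    ('k, 'a::ab_group_add, 'h, 'z) comod_alg_scheme \<Rightarrow>
    ('k, 'x::ab_group_add, 'h, 'zz) comod_scheme \<Rightarrow>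
    (('x, 'a, 'k) tensor \<Rightarrow> ('a, 'x, 'k) tensor) \<Rightarrow>
    (('x, 'x, 'k) tensor \<Rightarrow> ('a, 'x, 'k) tensor) \<Rightarrow>
    ('k \<Rightarrow> ('a, 'x, 'k) tensor) \<Rightarrow> bool" where
  "wreath H A X \<psi> \<zeta> \<sigma> \<longleftrightarrow>
     (let AA = tensor_comod H A A; AX = tensor_comod H A X;
          XA = tensor_comod H X A; XX = tensor_comod H X X; K = unit_comod H;
          m_X = tmap AA X A X (amult A) id \<circ> assoc_inv H A A X;
          A_psi = tmap A XA A AX id \<psi>;
          A_zeta = tmap A XX A AX id \<zeta>;
          psi_A = assoc H A X A \<circ> tmap XA A AX A \<psi> id;
          psi_X = assoc H A X X \<circ> tmap XA X AX X \<psi> id;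
          zeta_A = assoc H A X A \<circ> tmap XX A AX A \<zeta> id;
          zeta_X = assoc H A X X \<circ> tmap XX X AX X \<zeta> id;
          sigma_A = assoc H A X A \<circ> tmap K A AX A \<sigma> id \<circ> lunit_inv A;
          sigma_X = assoc H A X X \<circ> tmap K X AX X \<sigma> id \<circ> lunit_inv X;
          A_sigma = tmap A K A AX id \<sigma> \<circ> runit_inv A;
          X_sigma = tmap X K X AX id \<sigma> \<circ> runit_inv X;
          eta_X = tmap K X A X (aunit A) id \<circ> lunit_inv X
      in
        comod_algebra H A \<and> comodule H X \<and>
        comod_hom H XA AX \<psi> \<and> comod_hom H XX AX \<zeta> \<and> comod_hom H K AX \<sigma> \<and>
        eq_arr (tensor X AA)
          (\<psi> \<circ> tmap X AA X A id (amult A))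
          (m_X \<circ> A_psi \<circ> psi_A \<circ> assoc_inv H X A A) \<and>
        eq_arr X (\<psi> \<circ> tmap X K X A id (aunit A) \<circ> runit_inv X) eta_X \<and>
        eq_arr (tensor XX A)
          (m_X \<circ> A_psi \<circ> zeta_A)
          (m_X \<circ> A_zeta \<circ> psi_X \<circ> assoc_inv H X A X \<circ> tmap X XA X AX id \<psi> \<circ> assoc H X X A) \<and>
        eq_arr (tensor XX X)
          (m_X \<circ> A_zeta \<circ> psi_X \<circ> assoc_inv H X A X \<circ> tmap X XX X AX id \<zeta> \<circ> assoc H X X X)
          (m_X \<circ> A_zeta \<circ> zeta_X) \<and>
        eq_arr A (m_X \<circ> A_sigma) (m_X \<circ> A_psi \<circ> sigma_A) \<and>
        eq_arr X (m_X \<circ> A_zeta \<circ> psi_X \<circ> assoc_inv H X A X \<circ> X_sigma) eta_X \<and>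
        eq_arr X (m_X \<circ> A_zeta \<circ> sigma_X) eta_X)"

text \<open>
  The multiplication is the composite
  \<open>(A X)(A X) \<rightarrow> A(X(A X)) \<rightarrow> A((X A) X) \<rightarrow> A((A X) X) \<rightarrow> A(A(X X)) \<rightarrow> (A A)(X X) \<rightarrow> A(A X) \<rightarrow>
  (A A)X \<rightarrow> A X\<close>.
\<close>

definition wreath_product :: "('k::field, 'h::ab_group_add, 'y) dqb_scheme \<Rightarrow>
    ('k, 'a::ab_group_add, 'h, 'z) comod_alg_scheme \<Rightarrow>
    ('k, 'x::ab_group_add, 'h, 'zz) comod_scheme \<Rightarrow>
    (('x, 'a, 'k) tensor \<Rightarrow> ('a, 'x, 'k) tensor) \<Rightarrow>
    (('x, 'x, 'k) tensor \<Rightarrow> ('a, 'x, 'k) tensor) \<Rightarrow>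
    ('k \<Rightarrow> ('a, 'x, 'k) tensor) \<Rightarrow> ('k, ('a, 'x, 'k) tensor, 'h) comod_alg" where
  "wreath_product H A X \<psi> \<zeta> \<sigma> =
     (let AA = tensor_comod H A A; AX = tensor_comod H A X;
          XA = tensor_comod H X A; XX = tensor_comod H X X;
          X_AX = tensor_comod H X AX; XA_X = tensor_comod H XA X;
          AX_X = tensor_comod H AX X; A_XX = tensor_comod H A XX
      in \<lparr>carr = carr AX, scl = scl AX, coact = coact AX,
          amult = tmap AA X A X (amult A) id \<circ> assoc_inv H A A X \<circ>
            tmap AA XX A AX (amult A) \<zeta> \<circ> assoc_inv H A A XX \<circ>
            tmap A AX_X A A_XX id (assoc H A X X) \<circ>
            tmap A XA_X A AX_X id (tmap XA X AX X \<psi> id) \<circ>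
            tmap A X_AX A XA_X id (assoc_inv H X A X) \<circ> assoc H A X AX,
          aunit = \<sigma>\<rparr>)"


section \<open>Crossed systems and crossed products\<close>

record ('k, 'a) alg = "('k, 'a) vspace" +
  times_alg :: "'a \<Rightarrow> 'a \<Rightarrow> 'a"
  one_alg :: "'a"

definition k_algebra :: "('k::field, 'a::ab_group_add, 'z) alg_scheme \<Rightarrow> bool" where
  "k_algebra A \<longleftrightarrow>
     is_vspace A \<and> bilin A A A (times_alg A) \<and> one_alg A \<in> carr A \<and>
     (\<forall>a\<in>carr A. \<forall>b\<in>carr A. \<forall>c\<in>carr A.
        times_alg A (times_alg A a b) c = times_alg A a (times_alg A b c)) \<and>
     (\<forall>a\<in>carr A. times_alg A (one_alg A) a = a \<and> times_alg A a (one_alg A) = a)"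

definition crossed_system :: "('k::field, 'h::ab_group_add, 'y) dqb_scheme \<Rightarrow>
    ('k, 'a::ab_group_add, 'z) alg_scheme \<Rightarrow>
    (('h, 'a, 'k) tensor \<Rightarrow> 'a) \<Rightarrow> (('h, 'h, 'k) tensor \<Rightarrow> 'a) \<Rightarrow> bool" where
  "crossed_system H A act \<tau> \<longleftrightarrow>
     (let dot = (\<lambda>h a. act (tens H A h a)); ta = (\<lambda>h g. \<tau> (tens H H h g)); m = times_alg A in
       (\<forall>h\<in>carr H. \<forall>a\<in>carr A. \<forall>b\<in>carr A.
          dot h (m a b) = sw H h (\<lambda>h1 h2. m (dot h1 a) (dot h2 b))) \<and>
       (\<forall>h\<in>carr H. dot h (one_alg A) = scl A (counit H h) (one_alg A)) \<and>
       (\<forall>a\<in>carr A. dot (one H) a = a) \<and>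
       (\<forall>h\<in>carr H. \<forall>g\<in>carr H. \<forall>a\<in>carr A.
          sw H h (\<lambda>h1 h2. sw H g (\<lambda>g1 g2. m (dot h1 (dot g1 a)) (ta h2 g2))) =
          sw H h (\<lambda>h1 h2. sw H g (\<lambda>g1 g2. m (ta h1 g1) (dot (mul H h2 g2) a)))) \<and>
       (\<forall>h\<in>carr H. \<forall>g\<in>carr H. \<forall>l\<in>carr H.
          sw H h (\<lambda>h1 h2. sw H g (\<lambda>g1 g2. sw H l (\<lambda>l1 l2.
            m (dot h1 (ta g1 l1)) (ta h2 (mul H g2 l2))))) =
          sw3 H h (\<lambda>h1 h2 h3. sw3 H g (\<lambda>g1 g2 g3. sw H l (\<lambda>l1 l2.
            scl A (phi_inv H h3 g3 l2) (m (ta h1 g1) (ta (mul H h2 g2) l1)))))) \<and>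
       (\<forall>h\<in>carr H. ta (one H) h = scl A (counit H h) (one_alg A) \<and>
          ta h (one H) = scl A (counit H h) (one_alg A)))"

definition crossed_product :: "('k::field, 'h::ab_group_add, 'y) dqb_scheme \<Rightarrow>
    ('k, 'a::ab_group_add, 'z) alg_scheme \<Rightarrow>
    (('h, 'a, 'k) tensor \<Rightarrow> 'a) \<Rightarrow> (('h, 'h, 'k) tensor \<Rightarrow> 'a) \<Rightarrow>
    ('k, ('a, 'h, 'k) tensor, 'h) comod_alg" where
  "crossed_product H A act \<tau> =
     (let dot = (\<lambda>h a. act (tens H A h a)); ta = (\<lambda>h g. \<tau> (tens H H h g)); m = times_alg A in
      \<lparr>carr = carr (tensor A H), scl = scl (tensor A H),
       coact = tlift A H (\<lambda>a h. sw H h (\<lambda>h1 h2. tens (tensor A H) H (tens A H a h1) h2)),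
       amult = tlift (tensor A H) (tensor A H) (\<lambda>x y.
         tlift A H (\<lambda>a h. tlift A H (\<lambda>b g.
           sw3 H h (\<lambda>h1 h2 h3. sw H g (\<lambda>g1 g2.
             tens A H (m (m a (dot h1 b)) (ta h2 g1)) (mul H h3 g2)))) y) x),
       aunit = (\<lambda>c. scl (tensor A H) c (tens A H (one_alg A) (one H)))\<rparr>)"


section \<open>The data of the proposition\<close>

text \<open>\<open>A\<close> with the trivial coaction \<open>a \<mapsto> a \<otimes> 1\<close>, and \<open>H\<close> coacting on itself by \<open>\<Delta>\<close>.\<close>

definition trivial_comod_alg :: "('k::field, 'h::ab_group_add, 'y) dqb_scheme \<Rightarrow>
    ('k, 'a::ab_group_add, 'z) alg_scheme \<Rightarrow> ('k, 'a, 'h) comod_alg" where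
  "trivial_comod_alg H A =
     \<lparr>carr = carr A, scl = scl A, coact = (\<lambda>a. tens A H a (one H)),
      amult = tlift A A (times_alg A), aunit = (\<lambda>c. scl A c (one_alg A))\<rparr>"

definition regular_comod :: "('k::field, 'h::ab_group_add, 'z) coalg_scheme \<Rightarrow>
    ('k, 'h, 'h) comod" where
  "regular_comod H = \<lparr>carr = carr H, scl = scl H, coact = comul H\<rparr>"

definition psi_map :: "('k::field, 'h::ab_group_add, 'y) coalg_scheme \<Rightarrow>
    ('k, 'a::ab_group_add, 'z) vspace_scheme \<Rightarrow> (('h, 'a, 'k) tensor \<Rightarrow> 'a) \<Rightarrow>
    ('h, 'a, 'k) tensor \<Rightarrow> ('a, 'h, 'k) tensor" where
  "psi_map H A act = tlift H A (\<lambda>h a. sw H h (\<lambda>h1 h2. tens A H (act (tens H A h1 a)) h2))"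

definition zeta_map :: "('k::field, 'h::ab_group_add, 'y) dqb_scheme \<Rightarrow>
    ('k, 'a::ab_group_add, 'z) vspace_scheme \<Rightarrow> (('h, 'h, 'k) tensor \<Rightarrow> 'a) \<Rightarrow>
    ('h, 'h, 'k) tensor \<Rightarrow> ('a, 'h, 'k) tensor" where
  "zeta_map H A \<tau> = tlift H H (\<lambda>h g. sw H h (\<lambda>h1 h2. sw H g (\<lambda>g1 g2.
     tens A H (\<tau> (tens H H h1 g1)) (mul H h2 g2))))"

definition sigma_map :: "('k::field, 'h::ab_group_add, 'y) dqb_scheme \<Rightarrow>
    ('k, 'a::ab_group_add, 'z) alg_scheme \<Rightarrow> 'k \<Rightarrow> ('a, 'h, 'k) tensor" where
  "sigma_map H A c = scl (tensor A H) c (tens A H (one_alg A) (one H))"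

end

theory Submission
  imports Defs
begin

text \<open>
  The maps in question are convolutions.  With Sweedler notation on a tensor power \<open>C\<close> of \<open>H\<close>,
  \<open>\<psi>(- \<otimes> a)\<close>, \<open>\<zeta>\<close> and, up to \<open>\<phi>\<close>, the two sides of the wreath axioms have the form
  \<open>x \<mapsto> F(x\<^sub>1) \<otimes> p(x\<^sub>2)\<close>, where \<open>F : C \<rightarrow> A\<close> is linear and \<open>p : C \<rightarrow> H\<close> is a coalgebra map (the identity,
  the product of two factors or a product of three).  Three facts about such maps carry the proof.
  Acting on them from the left by \<open>G : C \<rightarrow> A\<close> replaces \<open>F\<close> by the convolution product \<open>G * F\<close>
  (\<open>cv_lact_tens\<close>).  They are colinear when \<open>A\<close> has the trivial coaction (\<open>coact_cv_tens\<close>), so \<open>\<psi>\<close> and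
  \<open>\<zeta>\<close> are always morphisms of comodules.  And \<open>F\<close> can be recovered from them by applying \<open>\<epsilon>\<close>
  to the \<open>H\<close>-component (\<open>cv_tens_eq_iff\<close>).

  The reassociator is normalised in all three arguments, since \<open>\<phi>(1, -, -)\<close> and \<open>\<phi>(-, -, 1)\<close> are
  convolution idempotents with an inverse.  Hence an associativity constraint with a factor \<open>A\<close> is
  plain rebracketing (\<open>assoc_trivial\<close>, \<open>assoc_inv_trivial\<close>), and \<open>\<phi>\<close> enters the wreath axioms only
  through the constraint of \<open>(H \<otimes> H) \<otimes> H\<close> in the associativity of \<open>\<zeta>\<close>.  There it appears next to
  \<open>h(gl)\<close>; quasi-associativity of \<open>H\<close> rebrackets this to \<open>(hg)l\<close> and moves \<open>\<phi>\<close> next to the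
  coefficient in \<open>A\<close> (\<open>shift_phi\<close>).  After cancelling the \<open>H\<close>-components, the wreath axioms become
  convolution identities in \<open>A\<close>: multiplicativity and unitality of the action, the twisted module
  condition, \<open>X * \<phi> = Y\<close> for the two sides \<open>X\<close>, \<open>Y\<close> of the cocycle condition, and normalisation of
  \<open>\<tau>\<close>.  These are the axioms of a crossed system (\<open>crossed_system_iff\<close>), because \<open>X * \<phi> = Y\<close> is
  equivalent to \<open>X = Y * \<phi>\<^sup>-\<^sup>1\<close>.

  The multiplication of the wreath product is evaluated in the same way and is that of the crossed
  product.  For the associativity of the latter up to \<open>\<phi>\<close>, both products of \<open>a \<otimes> h\<close>, \<open>b \<otimes> g\<close>,
  \<open>c \<otimes> l\<close> have the above form with \<open>p = (hg)l\<close>, once \<open>\<phi>\<close> has been moved to the coefficient, and the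
  two coefficients agree by the cocycle and twisted module conditions (\<open>coef_cocycle\<close>).

  For calculations, the comultiplication of each element is expanded into a finite sum of pure
  tensors (\<open>tsum\<close>, \<open>ssum\<close>).
\<close>

section \<open>Linear maps and sums over tensors\<close>

lemma lin_mem: "lin V W f \<Longrightarrow> x \<in> carr V \<Longrightarrow> f x \<in> carr W"
  by (simp add: lin_def)

lemma bilin_mem: "bilin V W Z f \<Longrightarrow> v \<in> carr V \<Longrightarrow> w \<in> carr W \<Longrightarrow> f v w \<in> carr Z"
  by (simp add: bilin_def lin_def)

lemma bilinI:
  assumes "\<And>w. w \<in> carr W \<Longrightarrow> lin V Z (\<lambda>v. f v w)"
    and "\<And>v. v \<in> carr V \<Longrightarrow> lin W Z (\<lambda>w. f v w)"
  shows "bilin V W Z f"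
  using assms by (simp add: bilin_def)

lemma bilin_lin1: "bilin V W Z f \<Longrightarrow> w \<in> carr W \<Longrightarrow> lin V Z (\<lambda>v. f v w)"
  by (simp add: bilin_def)

lemma bilin_lin2: "bilin V W Z f \<Longrightarrow> v \<in> carr V \<Longrightarrow> lin W Z (f v)"
  by (simp add: bilin_def)

lemma lin_scl: "lin V W f \<Longrightarrow> x \<in> carr V \<Longrightarrow> f (scl V c x) = scl W c (f x)"
  by (simp add: lin_def)

lemma lin_ident: "lin V V (\<lambda>x. x)"
  by (simp add: lin_def)

lemma lin_comp: "lin V W f \<Longrightarrow> lin U V g \<Longrightarrow> lin U W (\<lambda>x. f (g x))"
  by (simp add: lin_def)

lemma lin_comp_o: "lin U V g \<Longrightarrow> lin V W f \<Longrightarrow> lin U W (f \<circ> g)"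
  by (simp add: lin_def)

lemma lin_cong:
  assumes "\<And>x. x \<in> carr V \<Longrightarrow> f x = g x" and "is_vspace V"
  shows "lin V W f \<longleftrightarrow> lin V W g"
  using assms is_vspace_closed[OF assms(2)] by (simp add: lin_def)

lemma lin_bilin1: "bilin V W Z f \<Longrightarrow> lin U V g \<Longrightarrow> w \<in> carr W \<Longrightarrow> lin U Z (\<lambda>x. f (g x) w)"
  by (rule lin_comp[OF bilin_lin1])

lemma lin_bilin2: "bilin V W Z f \<Longrightarrow> v \<in> carr V \<Longrightarrow> lin U W g \<Longrightarrow> lin U Z (\<lambda>x. f v (g x))"
  by (rule lin_comp[OF bilin_lin2])

lemma lin_zero:
  assumes "is_vspace V" "lin V W f"
  shows "f 0 = 0"
proof -
  have "f (0 + 0) = f 0 + f 0"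
    using assms is_vspace_closed(1)[OF assms(1)] unfolding lin_def by blast
  then show ?thesis by simp
qed

lemma vspace_scale:
  assumes "is_vspace V"
  shows "scl V 1 x = x" "scl V a (scl V b x) = scl V (a * b) x" "scl V 0 x = 0"
    "scl V c (x + y) = scl V c x + scl V c y" "scl V (a + b) x = scl V a x + scl V b x"
    "scl V c 0 = 0"
proof -
  interpret vector_space "scl V" using assms by (simp add: is_vspace_def)
  show "scl V 1 x = x" "scl V a (scl V b x) = scl V (a * b) x" "scl V 0 x = 0"
    "scl V c (x + y) = scl V c x + scl V c y" "scl V (a + b) x = scl V a x + scl V b x"
    "scl V c 0 = 0"
    by (auto simp: scale_right_distrib scale_left_distrib)
qed

lemma carr_k_space [simp]: "carr k_space = UNIV" and scl_k_space [simp]: "scl k_space = (*)"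
  by (simp_all add: k_space_def)

declare is_vspace_k_space [simp] is_vspace_tensor [simp]

lemma bilin_scl: "is_vspace V \<Longrightarrow> bilin k_space V V (scl V)"
  by (auto simp: bilin_def lin_def vspace_scale is_vspace_closed mult.commute)

lemma bilin_scl_right: "is_vspace V \<Longrightarrow> bilin V k_space V (\<lambda>v c. scl V c v)"
  using bilin_scl by (auto simp: bilin_def)

lemma bilin_times_k: "bilin k_space k_space k_space (*)"
  using bilin_scl[of k_space] by simp

lemma bilin_tens:
  fixes V :: "('k::field, 'v::ab_group_add, 'y) vspace_scheme"
    and W :: "('k, 'w::ab_group_add, 'z) vspace_scheme"
  shows "bilin V W (tensor V W) (tens V W)"
proof (rule bilinI)
  show "lin V (tensor V W) (\<lambda>v. tens V W v w)" if "w \<in> carr W" for w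
    using that tens_in_tensor[of _ V w W]
    by (auto simp: lin_def scl_tens)
      (auto simp: tens_def bilin_def lin_def k_space_def fun_eq_iff)
  show "lin W (tensor V W) (\<lambda>w. tens V W v w)" if "v \<in> carr V" for v
    using that tens_in_tensor[of v V _ W]
    by (auto simp: lin_def)
      (auto simp: tensor_def tens_def bilin_def lin_def k_space_def fun_eq_iff)
qed

definition trep :: "('k::field, 'v::ab_group_add, 'y) vspace_scheme \<Rightarrow>
    ('k, 'w::ab_group_add, 'z) vspace_scheme \<Rightarrow> ('v, 'w, 'k) tensor \<Rightarrow> ('v \<times> 'w) list" where
  "trep V W t =
     (let P = (\<lambda>ps. set ps \<subseteq> carr V \<times> carr W \<and> t = (\<Sum>(v, w)\<leftarrow>ps. tens V W v w))
      in if Ex P then SOME ps. P ps else [])"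

text \<open>
  Both \<open>tlift V W f\<close> and this sum apply \<open>f\<close> to the factors of a decomposition of \<open>t\<close>, and they agree
  for bilinear \<open>f\<close>.  The sum is finite whatever \<open>f\<close> is, so that such sums can be interchanged with
  each other and with linear maps without checking any bilinearity.
\<close>

definition tsum :: "('k::field, 'v::ab_group_add, 'y) vspace_scheme \<Rightarrow>
    ('k, 'w::ab_group_add, 'z) vspace_scheme \<Rightarrow> ('v, 'w, 'k) tensor \<Rightarrow>
    ('v \<Rightarrow> 'w \<Rightarrow> 'u::ab_group_add) \<Rightarrow> 'u" where
  "tsum V W t f = (\<Sum>(v, w)\<leftarrow>trep V W t. f v w)"

lemma trep_carr: "set (trep V W t) \<subseteq> carr V \<times> carr W"
proof -
  let ?P = "\<lambda>ps. set ps \<subseteq> carr V \<times> carr W \<and> t = (\<Sum>(v, w)\<leftarrow>ps. tens V W v w)"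
  show ?thesis
  proof (cases "Ex ?P")
    case True
    then have "?P (SOME ps. ?P ps)" by (rule someI_ex)
    with True show ?thesis by (simp add: trep_def)
  next
    case False
    then show ?thesis unfolding trep_def Let_def by (subst if_not_P) auto
  qed
qed

lemma trep_sum:
  assumes "is_vspace V" "t \<in> carr (tensor V W)"
  shows "t = (\<Sum>(v, w)\<leftarrow>trep V W t. tens V W v w)"
proof -
  let ?P = "\<lambda>ps. set ps \<subseteq> carr V \<times> carr W \<and> t = (\<Sum>(v, w)\<leftarrow>ps. tens V W v w)"
  have ex: "Ex ?P" by (rule tensor_repr[OF assms])
  then have "?P (SOME ps. ?P ps)" by (rule someI_ex)
  with ex show ?thesis by (simp add: trep_def)
qed

lemma tsum_cong [cong]:
  assumes "V = V'" "W = W'" "t = t'"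
    and "\<And>v w. v \<in> carr V' \<Longrightarrow> w \<in> carr W' \<Longrightarrow> f v w = g v w"
  shows "tsum V W t f = tsum V' W' t' g"
proof -
  have "map (\<lambda>(v, w). f v w) (trep V' W' t') = map (\<lambda>(v, w). g v w) (trep V' W' t')"
    using trep_carr[of V' W' t'] assms(4) by (intro map_cong) auto
  with assms(1-3) show ?thesis unfolding tsum_def by (metis (no_types, lifting))
qed

lemma sum_list_carr:
  assumes "is_vspace Z" "\<And>v w. (v, w) \<in> set ps \<Longrightarrow> f v w \<in> carr Z"
  shows "(\<Sum>(v, w)\<leftarrow>ps. f v w) \<in> carr Z"
  using assms(2) by (induction ps) (auto intro: is_vspace_closed[OF assms(1)])

lemma tsum_mem:
  assumes "is_vspace Z" "\<And>v w. v \<in> carr V \<Longrightarrow> w \<in> carr W \<Longrightarrow> f v w \<in> carr Z"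
  shows "tsum V W t f \<in> carr Z"
  unfolding tsum_def using trep_carr[of V W t] assms(2) by (intro sum_list_carr[OF assms(1)]) auto

lemma lin_sum_list:
  assumes "is_vspace U" "lin U Z F" "\<And>v w. (v, w) \<in> set ps \<Longrightarrow> f v w \<in> carr U"
  shows "F (\<Sum>(v, w)\<leftarrow>ps. f v w) = (\<Sum>(v, w)\<leftarrow>ps. F (f v w))"
  using assms(3)
proof (induction ps)
  case Nil
  then show ?case using lin_zero[OF assms(1,2)] by simp
next
  case (Cons p ps)
  obtain v w where p: "p = (v, w)" by (cases p)
  have "(\<Sum>(v, w)\<leftarrow>ps. f v w) \<in> carr U"
    using Cons.prems by (intro sum_list_carr[OF assms(1)]) auto
  moreover have "f v w \<in> carr U" using Cons.prems p by auto
  ultimately have "F (f v w + (\<Sum>(v, w)\<leftarrow>ps. f v w)) = F (f v w) + F (\<Sum>(v, w)\<leftarrow>ps. f v w)"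
    using assms(2) unfolding lin_def by blast
  then show ?case using Cons p by simp
qed

lemma lin_tsum:
  assumes "lin U Z F" "is_vspace U" "\<And>v w. v \<in> carr V \<Longrightarrow> w \<in> carr W \<Longrightarrow> f v w \<in> carr U"
  shows "F (tsum V W t f) = tsum V W t (\<lambda>v w. F (f v w))"
  unfolding tsum_def using trep_carr[of V W t] assms(3) by (intro lin_sum_list[OF assms(2,1)]) auto

lemma tsum_add: "tsum V W t f + tsum V W t g = tsum V W t (\<lambda>v w. f v w + g v w)"
proof -
  have "(\<Sum>(v, w)\<leftarrow>ps. f v w) + (\<Sum>(v, w)\<leftarrow>ps. g v w) = (\<Sum>(v, w)\<leftarrow>ps. f v w + g v w)" for ps
    by (induction ps) (auto simp: algebra_simps)
  then show ?thesis by (simp add: tsum_def)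
qed

lemma tsum_scl:
  assumes "is_vspace Z"
  shows "scl Z c (tsum V W t f) = tsum V W t (\<lambda>v w. scl Z c (f v w))"
proof -
  have "scl Z c (\<Sum>(v, w)\<leftarrow>ps. f v w) = (\<Sum>(v, w)\<leftarrow>ps. scl Z c (f v w))" for ps
    by (induction ps) (auto simp: vspace_scale[OF assms])
  then show ?thesis by (simp add: tsum_def)
qed

lemma tsum_swap:
  "tsum V W t (\<lambda>v w. tsum V' W' s (f v w)) = tsum V' W' s (\<lambda>v' w'. tsum V W t (\<lambda>v w. f v w v' w'))"
proof -
  have "(\<Sum>(v, w)\<leftarrow>ps. \<Sum>(v', w')\<leftarrow>qs. f v w v' w') =
      (\<Sum>(v', w')\<leftarrow>qs. \<Sum>(v, w)\<leftarrow>ps. f v w v' w')" for ps qs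
  proof (induction ps)
    case Nil
    show ?case by (induction qs) auto
  next
    case (Cons p ps)
    have "(\<Sum>(v', w')\<leftarrow>qs. f (fst p) (snd p) v' w') + (\<Sum>(v', w')\<leftarrow>qs. \<Sum>(v, w)\<leftarrow>ps. f v w v' w') =
        (\<Sum>(v', w')\<leftarrow>qs. f (fst p) (snd p) v' w' + (\<Sum>(v, w)\<leftarrow>ps. f v w v' w'))"
      by (induction qs) (auto simp: algebra_simps)
    with Cons show ?case by (simp add: split_def)
  qed
  then show ?thesis by (simp add: tsum_def)
qed

lemma tlift_tsum:
  assumes "bilin V W Z f" "is_vspace V" "is_vspace Z" "t \<in> carr (tensor V W)"
  shows "tlift V W f t = tsum V W t f"
  unfolding tsum_def by (rule tlift_eqI[OF assms(3,1) trep_carr trep_sum[OF assms(2,4)]])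

lemma tlift_cong:
  assumes "\<And>v w. v \<in> carr V \<Longrightarrow> w \<in> carr W \<Longrightarrow> f v w = g v w"
  shows "tlift V W f = tlift V W g"
proof
  fix t
  have *: "(\<Sum>(v, w)\<leftarrow>ps. f v w) = (\<Sum>(v, w)\<leftarrow>ps. g v w)" if "set ps \<subseteq> carr V \<times> carr W" for ps
    using that assms by (induction ps) auto
  then have "(\<exists>ps. set ps \<subseteq> carr V \<times> carr W \<and> t = (\<Sum>(v, w)\<leftarrow>ps. tens V W v w) \<and>
      z = (\<Sum>(v, w)\<leftarrow>ps. f v w)) \<longleftrightarrow> (\<exists>ps. set ps \<subseteq> carr V \<times> carr W \<and>
      t = (\<Sum>(v, w)\<leftarrow>ps. tens V W v w) \<and> z = (\<Sum>(v, w)\<leftarrow>ps. g v w))" for z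
    by (intro ex_cong1) auto
  then show "tlift V W f t = tlift V W g t" by (simp add: tlift_def)
qed

lemma tsum_tens:
  assumes "bilin V W Z f" "is_vspace V" "is_vspace Z" "v \<in> carr V" "w \<in> carr W"
  shows "tsum V W (tens V W v w) f = f v w"
  using tlift_tsum[OF assms(1-3) tens_in_tensor[OF assms(4,5)]]
    tensor_universal(2)[OF assms(2,3,1,4,5)] by simp

lemma tsum_of_tens:
  assumes "is_vspace V" "t \<in> carr (tensor V W)"
  shows "tsum V W t (tens V W) = t"
  using trep_sum[OF assms] by (simp add: tsum_def)

lemma lin_tsum_arg:
  assumes "bilin V W Z f" "is_vspace V" "is_vspace Z" "lin U (tensor V W) g"
  shows "lin U Z (\<lambda>x. tsum V W (g x) f)"
proof -
  have L: "lin (tensor V W) Z (tlift V W f)"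
    by (rule tensor_universal(1)[OF assms(2,3,1)])
  have eq: "tsum V W t f = tlift V W f t" if "t \<in> carr (tensor V W)" for t
    using tlift_tsum[OF assms(1-3) that] by simp
  have "lin (tensor V W) Z (\<lambda>t. tsum V W t f)"
    using L by (subst lin_cong[where g = "tlift V W f"]) (auto simp: eq)
  then show ?thesis by (rule lin_comp[OF _ assms(4)])
qed

lemma lin_tsum_body:
  assumes "is_vspace Z" "\<And>v w. v \<in> carr V \<Longrightarrow> w \<in> carr W \<Longrightarrow> lin U Z (\<lambda>x. f x v w)"
  shows "lin U Z (\<lambda>x. tsum V W t (f x))"
  unfolding lin_def
proof (intro conjI ballI allI)
  show "tsum V W t (f x) \<in> carr Z" if "x \<in> carr U" for x
    using assms that by (intro tsum_mem) (auto simp: lin_def)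
  show "tsum V W t (f (x + y)) = tsum V W t (f x) + tsum V W t (f y)"
    if "x \<in> carr U" "y \<in> carr U" for x y
    unfolding tsum_add using assms that by (intro tsum_cong refl) (auto simp: lin_def)
  show "tsum V W t (f (scl U c x)) = scl Z c (tsum V W t (f x))" if "x \<in> carr U" for c x
    unfolding tsum_scl[OF assms(1)] using assms that by (intro tsum_cong refl) (auto simp: lin_def)
qed

lemma tensor_ext:
  assumes "lin (tensor V W) Z F" "lin (tensor V W) Z G" "is_vspace V"
    and "\<And>v w. v \<in> carr V \<Longrightarrow> w \<in> carr W \<Longrightarrow> F (tens V W v w) = G (tens V W v w)"
    and "t \<in> carr (tensor V W)"
  shows "F t = G t"
proof -
  have "F t = F (tsum V W t (tens V W))"
    using assms by (simp add: tsum_of_tens)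
  also have "\<dots> = tsum V W t (\<lambda>v w. F (tens V W v w))"
    by (rule lin_tsum[OF assms(1)]) (auto intro: tens_in_tensor)
  also have "\<dots> = tsum V W t (\<lambda>v w. G (tens V W v w))"
    using assms(4) by (intro tsum_cong) auto
  also have "\<dots> = G (tsum V W t (tens V W))"
    by (rule lin_tsum[OF assms(2), symmetric]) (auto intro: tens_in_tensor)
  finally show ?thesis using assms by (simp add: tsum_of_tens)
qed

lemma tensor_eq_iff:
  assumes "lin (tensor V W) Z F" "lin (tensor V W) Z G" "is_vspace V"
  shows "(\<forall>t\<in>carr (tensor V W). F t = G t) \<longleftrightarrow>
    (\<forall>v\<in>carr V. \<forall>w\<in>carr W. F (tens V W v w) = G (tens V W v w))"
  using tensor_ext[OF assms] tens_in_tensor[of _ V _ W] by blast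

lemma tensor_left_eq_iff:
  fixes U :: "('k::field, 'u::ab_group_add, 'x) vspace_scheme"
    and V :: "('k, 'v::ab_group_add, 'y) vspace_scheme"
    and W :: "('k, 'w::ab_group_add, 'z) vspace_scheme"
  assumes F: "lin (tensor (tensor U V) W) Z F" and G: "lin (tensor (tensor U V) W) Z G"
    and U: "is_vspace U"
  shows "(\<forall>t\<in>carr (tensor (tensor U V) W). F t = G t) \<longleftrightarrow>
    (\<forall>u\<in>carr U. \<forall>v\<in>carr V. \<forall>w\<in>carr W. F (tens (tensor U V) W (tens U V u v) w) =
      G (tens (tensor U V) W (tens U V u v) w))"
proof -
  have l: "lin (tensor U V) Z (\<lambda>x. L (tens (tensor U V) W x w))"
    if "lin (tensor (tensor U V) W) Z L" "w \<in> carr W" for L w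
    by (rule lin_comp[OF that(1) bilin_lin1[OF bilin_tens that(2)]])
  have "(\<forall>x\<in>carr (tensor U V). F (tens (tensor U V) W x w) = G (tens (tensor U V) W x w)) \<longleftrightarrow>
    (\<forall>u\<in>carr U. \<forall>v\<in>carr V. F (tens (tensor U V) W (tens U V u v) w) =
      G (tens (tensor U V) W (tens U V u v) w))" if "w \<in> carr W" for w
    by (rule tensor_eq_iff[OF l[OF F that] l[OF G that] U])
  then show ?thesis
    unfolding tensor_eq_iff[OF F G is_vspace_tensor] by blast
qed

lemma tensor_right_eq_iff:
  fixes U :: "('k::field, 'u::ab_group_add, 'x) vspace_scheme"
    and V :: "('k, 'v::ab_group_add, 'y) vspace_scheme"
    and W :: "('k, 'w::ab_group_add, 'z) vspace_scheme"
  assumes F: "lin (tensor U (tensor V W)) Z F" and G: "lin (tensor U (tensor V W)) Z G"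
    and U: "is_vspace U" "is_vspace V"
  shows "(\<forall>t\<in>carr (tensor U (tensor V W)). F t = G t) \<longleftrightarrow>
    (\<forall>u\<in>carr U. \<forall>v\<in>carr V. \<forall>w\<in>carr W. F (tens U (tensor V W) u (tens V W v w)) =
      G (tens U (tensor V W) u (tens V W v w)))"
proof -
  have l: "lin (tensor V W) Z (\<lambda>x. L (tens U (tensor V W) u x))"
    if "lin (tensor U (tensor V W)) Z L" "u \<in> carr U" for L u
    by (rule lin_comp[OF that(1) bilin_lin2[OF bilin_tens that(2)]])
  have "(\<forall>x\<in>carr (tensor V W). F (tens U (tensor V W) u x) = G (tens U (tensor V W) u x)) \<longleftrightarrow>
    (\<forall>v\<in>carr V. \<forall>w\<in>carr W. F (tens U (tensor V W) u (tens V W v w)) =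
      G (tens U (tensor V W) u (tens V W v w)))" if "u \<in> carr U" for u
    by (rule tensor_eq_iff[OF l[OF F that] l[OF G that] U(2)])
  then show ?thesis
    unfolding tensor_eq_iff[OF F G U(1)] by blast
qed

lemma tensor_tensor_ext:
  fixes U :: "('k::field, 'u::ab_group_add, 'x1) vspace_scheme"
    and V :: "('k, 'v::ab_group_add, 'x2) vspace_scheme"
    and W :: "('k, 'w::ab_group_add, 'x3) vspace_scheme"
    and X :: "('k, 'y::ab_group_add, 'x4) vspace_scheme"
  assumes F: "lin (tensor (tensor U V) (tensor W X)) Z F" and G: "lin (tensor (tensor U V) (tensor W X)) Z G"
    and sp: "is_vspace U" "is_vspace W"
    and eq: "\<And>u v w x. u \<in> carr U \<Longrightarrow> v \<in> carr V \<Longrightarrow> w \<in> carr W \<Longrightarrow> x \<in> carr X \<Longrightarrow>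
      F (tens (tensor U V) (tensor W X) (tens U V u v) (tens W X w x)) =
      G (tens (tensor U V) (tensor W X) (tens U V u v) (tens W X w x))"
    and t: "t \<in> carr (tensor (tensor U V) (tensor W X))"
  shows "F t = G t"
proof -
  have l: "lin (tensor W X) Z (\<lambda>y. L (tens (tensor U V) (tensor W X) (tens U V u v) y))"
    if "lin (tensor (tensor U V) (tensor W X)) Z L" "u \<in> carr U" "v \<in> carr V" for L u v
    by (rule lin_comp[OF that(1) bilin_lin2[OF bilin_tens tens_in_tensor[OF that(2,3)]]])
  show ?thesis
  proof (rule tensor_left_eq_iff[THEN iffD2, rule_format, OF F G sp(1) _ t])
    fix u v y assume m: "u \<in> carr U" "v \<in> carr V" "y \<in> carr (tensor W X)"
    show "F (tens (tensor U V) (tensor W X) (tens U V u v) y) =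
        G (tens (tensor U V) (tensor W X) (tens U V u v) y)"
      by (rule tensor_ext[OF l[OF F m(1,2)] l[OF G m(1,2)] sp(2) _ m(3)]) (rule eq[OF m(1,2)])
  qed
qed

lemma bilin_tmap:
  assumes "lin V V' f" "lin W W' g"
  shows "bilin V W (tensor V' W') (\<lambda>v w. tens V' W' (f v) (g w))"
  using assms
  by (intro bilinI lin_bilin1[OF bilin_tens] lin_bilin2[OF bilin_tens]) (auto simp: lin_mem)

lemma lin_tmap:
  assumes "lin V V' f" "lin W W' g" "is_vspace V"
  shows "lin (tensor V W) (tensor V' W') (tmap V W V' W' f g)"
  unfolding tmap_def
  by (rule tensor_universal(1)[OF assms(3) is_vspace_tensor bilin_tmap[OF assms(1,2)]])

lemma tmap_tens:
  assumes "lin V V' f" "lin W W' g" "is_vspace V" "v \<in> carr V" "w \<in> carr W"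
  shows "tmap V W V' W' f g (tens V W v w) = tens V' W' (f v) (g w)"
  unfolding tmap_def
  by (rule tensor_universal(2)[OF assms(3) is_vspace_tensor bilin_tmap[OF assms(1,2)] assms(4,5)])

text \<open>
  Tensor products and linear maps only see the carrier and the scaling of a record.  As rewrite rules
  for the records below, these equations reduce everything to tensor products of \<open>A\<close>, \<open>H\<close> and \<open>k\<close>.
\<close>

context
  fixes V :: "('k::field, 'v::ab_group_add, 'x) vspace_scheme"
    and V' :: "('k, 'v, 'y) vspace_scheme"
  assumes carr: "carr V = carr V'" and scl: "scl V = scl V'"
begin

lemma same_vspace: "is_vspace V = is_vspace V'"
  by (simp add: is_vspace_def carr scl)

lemma same_lin: "lin V W f = lin V' W f" "lin U V g = lin U V' g"
  by (simp_all add: lin_def carr scl)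

lemma same_bilin: "bilin V W Z f = bilin V' W Z f" "bilin U V Z g = bilin U V' Z g"
  "bilin U W V h = bilin U W V' h"
  by (simp_all add: bilin_def same_lin carr)

lemma same_tens: "tens V W = tens V' W" "tens U V = tens U V'"
  by (simp_all add: tens_def fun_eq_iff same_bilin)

lemma same_tensor: "tensor V W = tensor V' W" "tensor U V = tensor U V'"
  by (simp_all add: tensor_def same_tens carr)

lemma same_tlift: "tlift V W = tlift V' W" "tlift U V = tlift U V'"
  by (simp_all add: tlift_def fun_eq_iff same_tens carr)

lemma same_trep: "trep V W = trep V' W" "trep U V = trep U V'"
  by (simp_all add: trep_def fun_eq_iff same_tens carr)

lemma same_tsum: "tsum V W = tsum V' W" "tsum U V = tsum U V'"
  by (simp_all add: tsum_def fun_eq_iff same_trep)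

lemma same_tmap: "tmap V W X Y = tmap V' W X Y" "tmap W V X Y = tmap W V' X Y"
  "tmap X Y V W = tmap X Y V' W" "tmap X Y W V = tmap X Y W V'"
  by (simp_all add: tmap_def fun_eq_iff same_tens same_tlift)

end

lemmas same_space = same_vspace same_lin same_bilin same_tens same_tensor same_tlift same_trep
  same_tsum same_tmap

lemma same_carr_scl:
  "carr (tensor_comod H U V) = carr (tensor U V)" "scl (tensor_comod H U V) = scl (tensor U V)"
  "carr (tensor_coalg C D) = carr (tensor C D)" "scl (tensor_coalg C D) = scl (tensor C D)"
  "carr (unit_comod H) = carr k_space" "scl (unit_comod H) = scl k_space"
  "carr (trivial_comod_alg H A) = carr A" "scl (trivial_comod_alg H A) = scl A"
  "carr (regular_comod C) = carr C" "scl (regular_comod C) = scl C"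
  by (simp_all add: tensor_comod_def tensor_coalg_def unit_comod_def trivial_comod_alg_def
      regular_comod_def)

lemma same_carr_scl_crossed:
  "carr (crossed_product H A act \<tau>) = carr (tensor A H)"
  "scl (crossed_product H A act \<tau>) = scl (tensor A H)"
  by (simp_all add: crossed_product_def Let_def)

lemmas same_tensor_comod [simp] = same_carr_scl(1,2) same_space[OF same_carr_scl(1,2)]
lemmas same_tensor_coalg [simp] = same_carr_scl(3,4) same_space[OF same_carr_scl(3,4)]
lemmas same_unit_comod [simp] = same_carr_scl(5,6) same_space[OF same_carr_scl(5,6)]
lemmas same_trivial [simp] = same_carr_scl(7,8) same_space[OF same_carr_scl(7,8)]
lemmas same_regular [simp] = same_carr_scl(9,10) same_space[OF same_carr_scl(9,10)]
lemmas same_crossed [simp] = same_carr_scl_crossed same_space[OF same_carr_scl_crossed]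

section \<open>Coalgebras, Sweedler sums and convolution\<close>

definition ssum :: "('k::field, 'v::ab_group_add, 'z) coalg_scheme \<Rightarrow> 'v \<Rightarrow>
    ('v \<Rightarrow> 'v \<Rightarrow> 'u::ab_group_add) \<Rightarrow> 'u" where
  "ssum C x = tsum C C (comul C x)"

lemma ssum_cong [cong]:
  assumes "C = C'" "x = x'"
    and "\<And>x1 x2. x1 \<in> carr C' \<Longrightarrow> x2 \<in> carr C' \<Longrightarrow> f x1 x2 = g x1 x2"
  shows "ssum C x f = ssum C' x' g"
  unfolding ssum_def using assms by (intro tsum_cong) auto

lemma ssum_mem:
  "is_vspace Z \<Longrightarrow> (\<And>x1 x2. x1 \<in> carr C \<Longrightarrow> x2 \<in> carr C \<Longrightarrow> f x1 x2 \<in> carr Z) \<Longrightarrow>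
    ssum C x f \<in> carr Z"
  unfolding ssum_def by (rule tsum_mem)

lemma lin_ssum:
  assumes "lin U Z F" "is_vspace U" "\<And>x1 x2. x1 \<in> carr C \<Longrightarrow> x2 \<in> carr C \<Longrightarrow> f x1 x2 \<in> carr U"
  shows "F (ssum C x f) = ssum C x (\<lambda>x1 x2. F (f x1 x2))"
  unfolding ssum_def by (rule lin_tsum[OF assms])

lemma scl_ssum: "is_vspace Z \<Longrightarrow> scl Z c (ssum C x f) = ssum C x (\<lambda>x1 x2. scl Z c (f x1 x2))"
  unfolding ssum_def by (rule tsum_scl)

lemma tens_ssum:
  assumes "is_vspace V" "is_vspace W"
  shows "w \<in> carr W \<Longrightarrow> (\<And>x1 x2. x1 \<in> carr C \<Longrightarrow> x2 \<in> carr C \<Longrightarrow> f x1 x2 \<in> carr V) \<Longrightarrow>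
      tens V W (ssum C x f) w = ssum C x (\<lambda>x1 x2. tens V W (f x1 x2) w)"
    and "v \<in> carr V \<Longrightarrow> (\<And>x1 x2. x1 \<in> carr C \<Longrightarrow> x2 \<in> carr C \<Longrightarrow> g x1 x2 \<in> carr W) \<Longrightarrow>
      tens V W v (ssum C x g) = ssum C x (\<lambda>x1 x2. tens V W v (g x1 x2))"
  by (rule lin_ssum[where F = "\<lambda>v. tens V W v w", OF bilin_lin1[OF bilin_tens] assms(1)]; assumption)
    (rule lin_ssum[where F = "tens V W v", OF bilin_lin2[OF bilin_tens] assms(2)]; assumption)

lemma ssum_swap:
  "ssum C x (\<lambda>x1 x2. ssum D y (f x1 x2)) = ssum D y (\<lambda>y1 y2. ssum C x (\<lambda>x1 x2. f x1 x2 y1 y2))"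
  unfolding ssum_def by (rule tsum_swap)

lemma lin_ssum_body:
  assumes "is_vspace Z" "\<And>x1 x2. x1 \<in> carr C \<Longrightarrow> x2 \<in> carr C \<Longrightarrow> lin U Z (\<lambda>u. f u x1 x2)"
  shows "lin U Z (\<lambda>u. ssum C x (f u))"
  unfolding ssum_def using assms by (rule lin_tsum_body)

definition trilin :: "('k::field, 'u::ab_group_add, 'x) vspace_scheme \<Rightarrow>
    ('k, 'v::ab_group_add, 'y) vspace_scheme \<Rightarrow> ('k, 'w::ab_group_add, 'z) vspace_scheme \<Rightarrow>
    ('k, 't::ab_group_add, 'zz) vspace_scheme \<Rightarrow> ('u \<Rightarrow> 'v \<Rightarrow> 'w \<Rightarrow> 't) \<Rightarrow> bool" where
  "trilin U V W Z f \<longleftrightarrow>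
     (\<forall>v\<in>carr V. \<forall>w\<in>carr W. lin U Z (\<lambda>u. f u v w)) \<and>
     (\<forall>u\<in>carr U. \<forall>w\<in>carr W. lin V Z (\<lambda>v. f u v w)) \<and>
     (\<forall>u\<in>carr U. \<forall>v\<in>carr V. lin W Z (\<lambda>w. f u v w))"

lemma coalgebraD:
  assumes "coalgebra C"
  shows "is_vspace C" "lin C (tensor C C) (comul C)" "lin C k_space (counit C)"
  using assms by (simp_all add: coalgebra_def)

lemma sw_ssum:
  assumes "is_vspace C" "lin C (tensor C C) (comul C)" "x \<in> carr C" "is_vspace Z" "bilin C C Z f"
  shows "sw C x f = ssum C x f"
  unfolding sw_def ssum_def
  by (rule tlift_tsum[OF assms(5,1,4)]) (rule lin_mem[OF assms(2,3)])

lemma sw_cong [cong]: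
  assumes "C = C'" "x = x'"
    and "\<And>x1 x2. x1 \<in> carr C' \<Longrightarrow> x2 \<in> carr C' \<Longrightarrow> f x1 x2 = g x1 x2"
  shows "sw C x f = sw C' x' g"
  unfolding sw_def assms(1,2) using tlift_cong[of C' C' f g] assms(3) by metis

lemma lin_ssum_arg:
  assumes "bilin C C Z f" "is_vspace C" "lin C (tensor C C) (comul C)" "is_vspace Z" "lin U C g"
  shows "lin U Z (\<lambda>u. ssum C (g u) f)"
  unfolding ssum_def
  by (rule lin_tsum_arg[OF assms(1,2,4) lin_comp[OF assms(3,5)]])

text \<open>Nested \<open>sw\<close> expressions are turned into finite sums by repeated use of this rule.\<close>

lemma sw_eqI:
  assumes "coalgebra C" "is_vspace Z" "x \<in> carr C"
    and "\<And>x1 x2. x1 \<in> carr C \<Longrightarrow> x2 \<in> carr C \<Longrightarrow> f x1 x2 = g x1 x2"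
    and "bilin C C Z g"
  shows "sw C x f = ssum C x g"
proof -
  have "sw C x f = sw C x g" using assms(4) by (intro sw_cong) auto
  then show ?thesis using sw_ssum[OF coalgebraD(1,2)[OF assms(1)] assms(3,2,5)] by simp
qed

lemma sw_eq_swI:
  "(\<And>x1 x2. x1 \<in> carr C \<Longrightarrow> x2 \<in> carr C \<Longrightarrow> f x1 x2 = g x1 x2) \<Longrightarrow> sw C x f = sw C x g"
  by (intro sw_cong) auto

text \<open>
  Coassociativity is an equation in \<open>C \<otimes> (C \<otimes> C)\<close>; apply to both sides the linear map induced by \<open>f\<close>.
\<close>

lemma ssum_coassoc:
  assumes C: "coalgebra C" and x: "x \<in> carr C" and Z: "is_vspace Z" and f: "trilin C C C Z f"
  shows "ssum C x (\<lambda>y x3. ssum C y (\<lambda>x1 x2. f x1 x2 x3)) =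
    ssum C x (\<lambda>x1 y. ssum C y (\<lambda>x2 x3. f x1 x2 x3))"
proof -
  note vC = coalgebraD(1)[OF C]
  let ?T = "tensor C (tensor C C)"
  have tri: "lin C ?T (\<lambda>v. tens C (tensor C C) v (tens C C b c))"
    "lin C ?T (\<lambda>v. tens C (tensor C C) b (tens C C v c))"
    "lin C ?T (\<lambda>v. tens C (tensor C C) b (tens C C c v))" if "b \<in> carr C" "c \<in> carr C" for b c
    using that by (auto intro!: lin_bilin1[OF bilin_tens] lin_bilin2[OF bilin_tens] lin_ident
        tens_in_tensor)
  have e1: "sw C y (\<lambda>x1 x2. tens C (tensor C C) x1 (tens C C x2 x3)) =
      ssum C y (\<lambda>x1 x2. tens C (tensor C C) x1 (tens C C x2 x3))"
    if "y \<in> carr C" "x3 \<in> carr C" for y x3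
    using that tri by (intro sw_ssum[OF coalgebraD(1,2)[OF C] _ is_vspace_tensor] bilinI) auto
  have e2: "sw C y (\<lambda>x2 x3. tens C (tensor C C) x1 (tens C C x2 x3)) =
      ssum C y (\<lambda>x2 x3. tens C (tensor C C) x1 (tens C C x2 x3))"
    if "y \<in> carr C" "x1 \<in> carr C" for y x1
    using that tri by (intro sw_ssum[OF coalgebraD(1,2)[OF C] _ is_vspace_tensor] bilinI) auto
  have "sw C x (\<lambda>y x3. ssum C y (\<lambda>x1 x2. tens C (tensor C C) x1 (tens C C x2 x3))) =
      sw C x (\<lambda>x1 y. ssum C y (\<lambda>x2 x3. tens C (tensor C C) x1 (tens C C x2 x3)))"
    using C x e1 e2 by (simp add: coalgebra_def)
  moreover have "sw C x (\<lambda>y x3. ssum C y (\<lambda>x1 x2. tens C (tensor C C) x1 (tens C C x2 x3))) =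
      ssum C x (\<lambda>y x3. ssum C y (\<lambda>x1 x2. tens C (tensor C C) x1 (tens C C x2 x3)))"
    by (rule sw_ssum[OF coalgebraD(1,2)[OF C] x is_vspace_tensor], rule bilinI)
      (auto intro!: lin_ssum_arg[OF _ coalgebraD(1,2)[OF C]] lin_ssum_body bilinI tri lin_ident)
  moreover have "sw C x (\<lambda>x1 y. ssum C y (\<lambda>x2 x3. tens C (tensor C C) x1 (tens C C x2 x3))) =
      ssum C x (\<lambda>x1 y. ssum C y (\<lambda>x2 x3. tens C (tensor C C) x1 (tens C C x2 x3)))"
    by (rule sw_ssum[OF coalgebraD(1,2)[OF C] x is_vspace_tensor], rule bilinI)
      (auto intro!: lin_ssum_arg[OF _ coalgebraD(1,2)[OF C]] lin_ssum_body bilinI tri lin_ident)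
  ultimately have eq: "ssum C x (\<lambda>y x3. ssum C y (\<lambda>x1 x2. tens C (tensor C C) x1 (tens C C x2 x3))) =
      ssum C x (\<lambda>x1 y. ssum C y (\<lambda>x2 x3. tens C (tensor C C) x1 (tens C C x2 x3)))" by simp
  define G where "G = tlift C (tensor C C) (\<lambda>x1. tlift C C (f x1))"
  have b2: "bilin C C Z (f a)" if "a \<in> carr C" for a
    using f that by (auto simp: trilin_def bilin_def)
  have b1: "bilin C (tensor C C) Z (\<lambda>x1. tlift C C (f x1))"
  proof (rule bilinI)
    show "lin (tensor C C) Z (tlift C C (f a))" if "a \<in> carr C" for a
      using tensor_universal(1)[OF vC Z b2[OF that]] .
    show "lin C Z (\<lambda>a. tlift C C (f a) t)" if t: "t \<in> carr (tensor C C)" for t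
    proof -
      have "lin C Z (\<lambda>a. tsum C C t (f a))"
        using f by (intro lin_tsum_body[OF Z]) (auto simp: trilin_def)
      then show ?thesis
        using t by (subst lin_cong[where g = "\<lambda>a. tsum C C t (f a)"])
          (auto simp: vC tlift_tsum[OF b2 vC Z])
    qed
  qed
  have G: "lin ?T Z G" unfolding G_def by (rule tensor_universal(1)[OF vC Z b1])
  have Gt: "G (tens C (tensor C C) a (tens C C b c)) = f a b c"
    if "a \<in> carr C" "b \<in> carr C" "c \<in> carr C" for a b c
    unfolding G_def using that
    by (simp add: tensor_universal(2)[OF vC Z b1] tens_in_tensor tensor_universal(2)[OF vC Z b2])
  have push: "G (ssum C y g) = ssum C y (\<lambda>y1 y2. G (g y1 y2))"
    if "\<And>y1 y2. y1 \<in> carr C \<Longrightarrow> y2 \<in> carr C \<Longrightarrow> g y1 y2 \<in> carr ?T" for y g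
    by (rule lin_ssum[OF G is_vspace_tensor that])
  have "G (ssum C x (\<lambda>y x3. ssum C y (\<lambda>x1 x2. tens C (tensor C C) x1 (tens C C x2 x3)))) =
      G (ssum C x (\<lambda>x1 y. ssum C y (\<lambda>x2 x3. tens C (tensor C C) x1 (tens C C x2 x3))))"
    by (simp add: eq)
  then show ?thesis
    by (simp add: push Gt ssum_mem tens_in_tensor)
qed

lemma ssum_counit:
  assumes C: "coalgebra C" and x: "x \<in> carr C" and Z: "is_vspace Z" and f: "lin C Z f"
  shows "ssum C x (\<lambda>x1 x2. scl Z (counit C x1) (f x2)) = f x"
    and "ssum C x (\<lambda>x1 x2. scl Z (counit C x2) (f x1)) = f x"
proof -
  note vC = coalgebraD(1)[OF C] and cC = coalgebraD(3)[OF C]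
  have b: "bilin C C C (\<lambda>x1 x2. scl C (counit C x1) x2)" "bilin C C C (\<lambda>x1 x2. scl C (counit C x2) x1)"
    by (auto intro!: bilinI lin_bilin1[OF bilin_scl] lin_bilin2[OF bilin_scl] vC cC lin_ident)
  have "f (ssum C x (\<lambda>x1 x2. scl C (counit C x1) x2)) = f x"
    "f (ssum C x (\<lambda>x1 x2. scl C (counit C x2) x1)) = f x"
    using C x sw_ssum[OF coalgebraD(1,2)[OF C] x vC b(1)] sw_ssum[OF coalgebraD(1,2)[OF C] x vC b(2)] by (simp_all add: coalgebra_def)
  moreover have "f (scl C c y) = scl Z c (f y)" if "y \<in> carr C" for c y
    using f that by (simp add: lin_def)
  ultimately show "ssum C x (\<lambda>x1 x2. scl Z (counit C x1) (f x2)) = f x"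
    "ssum C x (\<lambda>x1 x2. scl Z (counit C x2) (f x1)) = f x"
    by (simp_all add: lin_ssum[OF f vC] is_vspace_closed[OF vC])
qed

text \<open>
  Convolution.  The pairing \<open>op\<close> is a parameter because the same calculus serves products in \<open>A\<close>,
  scalars acting on \<open>A\<close>, and the maps \<open>x \<mapsto> F(x\<^sub>1) \<otimes> p(x\<^sub>2)\<close> into \<open>A \<otimes> H\<close>.
\<close>

definition cv :: "('k::field, 'v::ab_group_add, 'z) coalg_scheme \<Rightarrow> ('a \<Rightarrow> 'b \<Rightarrow> 'c::ab_group_add) \<Rightarrow>
    ('v \<Rightarrow> 'a) \<Rightarrow> ('v \<Rightarrow> 'b) \<Rightarrow> 'v \<Rightarrow> 'c" where
  "cv C op f g x = ssum C x (\<lambda>x1 x2. op (f x1) (g x2))"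

lemma bilin_cv_body:
  assumes "lin C U f" "lin C V g" "bilin U V Z op"
  shows "bilin C C Z (\<lambda>x1 x2. op (f x1) (g x2))"
  using assms by (auto intro!: bilinI lin_bilin1[OF assms(3)] lin_bilin2[OF assms(3)] simp: lin_mem)

lemma lin_cv:
  assumes "coalgebra C" "is_vspace Z" "lin C U f" "lin C V g" "bilin U V Z op"
  shows "lin C Z (cv C op f g)"
  unfolding cv_def
  by (rule lin_ssum_arg[OF bilin_cv_body[OF assms(3-5)] coalgebraD(1,2)[OF assms(1)] assms(2) lin_ident])

lemma cv_cong:
  assumes "\<And>y. y \<in> carr C \<Longrightarrow> f y = f' y" "\<And>y. y \<in> carr C \<Longrightarrow> g y = g' y"
  shows "cv C op f g x = cv C op f' g' x"
  unfolding cv_def using assms by (intro ssum_cong) auto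

text \<open>
  Coassociativity of \<open>C\<close> together with the mixed associativity of the four pairings.
\<close>

lemma cv_assoc:
  assumes C: "coalgebra C" and x: "x \<in> carr C" and Z: "is_vspace Z" "is_vspace P" "is_vspace Q"
    and f: "lin C U f" and g: "lin C V g" and h: "lin C W h"
    and b1: "bilin U V P op1" and b2: "bilin P W Z op2"
    and b3: "bilin V W Q op3" and b4: "bilin U Q Z op4"
    and eq: "\<And>u v w. u \<in> carr U \<Longrightarrow> v \<in> carr V \<Longrightarrow> w \<in> carr W \<Longrightarrow> op2 (op1 u v) w = op4 u (op3 v w)"
  shows "cv C op2 (cv C op1 f g) h x = cv C op4 f (cv C op3 g h) x"
proof -
  have "cv C op2 (cv C op1 f g) h x =
      ssum C x (\<lambda>y x3. ssum C y (\<lambda>x1 x2. op2 (op1 (f x1) (g x2)) (h x3)))"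
    unfolding cv_def
  proof (intro ssum_cong refl)
    fix y x3 assume y: "y \<in> carr C" "x3 \<in> carr C"
    show "op2 (ssum C y (\<lambda>x1 x2. op1 (f x1) (g x2))) (h x3) =
        ssum C y (\<lambda>x1 x2. op2 (op1 (f x1) (g x2)) (h x3))"
      by (rule lin_ssum[OF bilin_lin1[OF b2 lin_mem[OF h y(2)]] Z(2)])
        (auto intro: bilin_mem[OF b1] lin_mem[OF f] lin_mem[OF g])
  qed
  also have "\<dots> = ssum C x (\<lambda>x1 y. ssum C y (\<lambda>x2 x3. op2 (op1 (f x1) (g x2)) (h x3)))"
  proof (rule ssum_coassoc[OF C x Z(1)])
    show "trilin C C C Z (\<lambda>x1 x2 x3. op2 (op1 (f x1) (g x2)) (h x3))"
      unfolding trilin_def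
      by (auto intro!: lin_bilin1[OF b2] lin_bilin2[OF b2] lin_bilin1[OF b1] lin_bilin2[OF b1]
          f g h bilin_mem[OF b1] lin_mem[OF f] lin_mem[OF g] lin_mem[OF h])
  qed
  also have "\<dots> = ssum C x (\<lambda>x1 y. ssum C y (\<lambda>x2 x3. op4 (f x1) (op3 (g x2) (h x3))))"
    using eq by (intro ssum_cong refl) (auto intro: lin_mem[OF f] lin_mem[OF g] lin_mem[OF h])
  also have "\<dots> = cv C op4 f (cv C op3 g h) x"
    unfolding cv_def
  proof (intro ssum_cong refl)
    fix x1 y assume y: "x1 \<in> carr C" "y \<in> carr C"
    show "ssum C y (\<lambda>x2 x3. op4 (f x1) (op3 (g x2) (h x3))) =
        op4 (f x1) (ssum C y (\<lambda>x2 x3. op3 (g x2) (h x3)))"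
      by (rule lin_ssum[OF bilin_lin2[OF b4 lin_mem[OF f y(1)]] Z(3), symmetric])
        (auto intro: bilin_mem[OF b3] lin_mem[OF g] lin_mem[OF h])
  qed
  finally show ?thesis .
qed

lemma cv_counit:
  assumes "coalgebra C" "x \<in> carr C" "is_vspace Z" "lin C Z f"
  shows "cv C (scl Z) (counit C) f x = f x" "cv C (\<lambda>z c. scl Z c z) f (counit C) x = f x"
  unfolding cv_def by (rule ssum_counit[OF assms])+

lemma cv_lin:
  assumes "lin P Z F" "is_vspace P" "lin C U f" "lin C V g" "bilin U V P op"
  shows "F (cv C op f g x) = cv C (\<lambda>u v. F (op u v)) f g x"
  unfolding cv_def
  by (rule lin_ssum[OF assms(1,2)]) (auto intro: bilin_mem[OF assms(5)] lin_mem[OF assms(3)] lin_mem[OF assms(4)])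

lemma ssum_coalgebra_hom:
  assumes "coalgebra_hom C D r" "coalgebra D" "is_vspace Z" "coalgebra C" "x \<in> carr C" "bilin D D Z f"
  shows "ssum D (r x) f = ssum C x (\<lambda>x1 x2. f (r x1) (r x2))"
proof -
  note r = assms(1)[unfolded coalgebra_hom_def, THEN conjunct1]
  note vD = coalgebraD(1)[OF assms(2)]
  have b: "bilin C C (tensor D D) (\<lambda>x1 x2. tens D D (r x1) (r x2))"
    by (rule bilin_tmap[OF r r])
  have "comul D (r x) = ssum C x (\<lambda>x1 x2. tens D D (r x1) (r x2))"
    using assms(1,5) sw_ssum[OF coalgebraD(1,2)[OF assms(4)] assms(5) is_vspace_tensor b] by (simp add: coalgebra_hom_def)
  then have "ssum D (r x) f = tlift D D f (ssum C x (\<lambda>x1 x2. tens D D (r x1) (r x2)))"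
    using tlift_tsum[OF assms(6) vD assms(3) lin_mem[OF coalgebraD(2)[OF assms(2)] lin_mem[OF r assms(5)]]]
    by (simp add: ssum_def)
  also have "\<dots> = ssum C x (\<lambda>x1 x2. tlift D D f (tens D D (r x1) (r x2)))"
    by (rule lin_ssum[OF tensor_universal(1)[OF vD assms(3,6)] is_vspace_tensor])
      (auto intro: tens_in_tensor lin_mem[OF r])
  also have "\<dots> = ssum C x (\<lambda>x1 x2. f (r x1) (r x2))"
    by (auto intro!: ssum_cong tensor_universal(2)[OF vD assms(3,6)] lin_mem[OF r])
  finally show ?thesis .
qed

lemma coalgebra_homI:
  assumes "coalgebra C" "lin C D r"
    and "\<And>x. x \<in> carr C \<Longrightarrow> comul D (r x) = ssum C x (\<lambda>x1 x2. tens D D (r x1) (r x2))"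
    and "\<And>x. x \<in> carr C \<Longrightarrow> counit D (r x) = counit C x"
  shows "coalgebra_hom C D r"
  unfolding coalgebra_hom_def
  using assms sw_ssum[OF coalgebraD(1,2)[OF assms(1)] _ is_vspace_tensor bilin_tmap[OF assms(2,2)]] by auto

lemma cv_coalgebra_hom:
  assumes "coalgebra_hom C D r" "coalgebra C" "coalgebra D" "is_vspace Z" "x \<in> carr C"
    "lin D U f" "lin D V g" "bilin U V Z op"
  shows "cv D op f g (r x) = cv C op (\<lambda>y. f (r y)) (\<lambda>y. g (r y)) x"
  unfolding cv_def
  by (rule ssum_coalgebra_hom[OF assms(1,3,4,2,5) bilin_cv_body[OF assms(6-8)]])

subsection \<open>The tensor product of two coalgebras\<close>

lemma coalgebraI:
  assumes v: "is_vspace C" and c: "lin C (tensor C C) (comul C)" and e: "lin C k_space (counit C)"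
    and "\<And>x. x \<in> carr C \<Longrightarrow>
      ssum C x (\<lambda>y x3. ssum C y (\<lambda>x1 x2. tens C (tensor C C) x1 (tens C C x2 x3))) =
      ssum C x (\<lambda>x1 y. ssum C y (\<lambda>x2 x3. tens C (tensor C C) x1 (tens C C x2 x3)))"
    and "\<And>x. x \<in> carr C \<Longrightarrow> ssum C x (\<lambda>x1 x2. scl C (counit C x1) x2) = x"
    and "\<And>x. x \<in> carr C \<Longrightarrow> ssum C x (\<lambda>x1 x2. scl C (counit C x2) x1) = x"
  shows "coalgebra C"
proof -
  note r = sw_ssum[OF v c]
  note lr = bilinI lin_bilin1[OF bilin_tens] lin_bilin2[OF bilin_tens] lin_ident tens_in_tensor
    lin_ssum_arg[OF _ v c] lin_ssum_body lin_bilin1[OF bilin_scl] lin_bilin2[OF bilin_scl] v e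
  have 1: "sw C x (\<lambda>y x3. sw C y (\<lambda>x1 x2. tens C (tensor C C) x1 (tens C C x2 x3))) =
      ssum C x (\<lambda>y x3. ssum C y (\<lambda>x1 x2. tens C (tensor C C) x1 (tens C C x2 x3)))"
    if x: "x \<in> carr C" for x
  proof -
    have "sw C x (\<lambda>y x3. sw C y (\<lambda>x1 x2. tens C (tensor C C) x1 (tens C C x2 x3))) =
        sw C x (\<lambda>y x3. ssum C y (\<lambda>x1 x2. tens C (tensor C C) x1 (tens C C x2 x3)))"
      by (rule sw_eq_swI) (auto intro!: r[OF _ is_vspace_tensor] lr)
    also have "\<dots> = ssum C x (\<lambda>y x3. ssum C y (\<lambda>x1 x2. tens C (tensor C C) x1 (tens C C x2 x3)))"
      using x by (auto intro!: r[OF _ is_vspace_tensor] lr)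
    finally show ?thesis .
  qed
  have 2: "sw C x (\<lambda>x1 y. sw C y (\<lambda>x2 x3. tens C (tensor C C) x1 (tens C C x2 x3))) =
      ssum C x (\<lambda>x1 y. ssum C y (\<lambda>x2 x3. tens C (tensor C C) x1 (tens C C x2 x3)))"
    if x: "x \<in> carr C" for x
  proof -
    have "sw C x (\<lambda>x1 y. sw C y (\<lambda>x2 x3. tens C (tensor C C) x1 (tens C C x2 x3))) =
        sw C x (\<lambda>x1 y. ssum C y (\<lambda>x2 x3. tens C (tensor C C) x1 (tens C C x2 x3)))"
      by (rule sw_eq_swI) (auto intro!: r[OF _ is_vspace_tensor] lr)
    also have "\<dots> = ssum C x (\<lambda>x1 y. ssum C y (\<lambda>x2 x3. tens C (tensor C C) x1 (tens C C x2 x3)))"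
      using x by (auto intro!: r[OF _ is_vspace_tensor] lr)
    finally show ?thesis .
  qed
  have 3: "sw C x (\<lambda>x1 x2. scl C (counit C x1) x2) = ssum C x (\<lambda>x1 x2. scl C (counit C x1) x2)"
    "sw C x (\<lambda>x1 x2. scl C (counit C x2) x1) = ssum C x (\<lambda>x1 x2. scl C (counit C x2) x1)"
    if x: "x \<in> carr C" for x
    using x by (auto intro!: r[OF _ v] lr)
  show ?thesis
    unfolding coalgebra_def using assms by (simp add: 1 2 3)
qed

context
  fixes C :: "('k::field, 'v::ab_group_add, 'y) coalg_scheme"
    and D :: "('k, 'w::ab_group_add, 'z) coalg_scheme"
  assumes C: "coalgebra C" and D: "coalgebra D"
begin

private lemmas vs = coalgebraD(1)[OF C] coalgebraD(1)[OF D]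

private lemmas lr = bilinI lin_bilin1[OF bilin_tens] lin_bilin2[OF bilin_tens] lin_ident
  tens_in_tensor lin_ssum_arg[OF _ coalgebraD(1,2)[OF C]] lin_ssum_arg[OF _ coalgebraD(1,2)[OF D]]
  lin_ssum_body ssum_mem

lemma bilin_comul_tensor:
  "bilin C D (tensor (tensor C D) (tensor C D)) (\<lambda>c d. ssum C c (\<lambda>c1 c2. ssum D d (\<lambda>d1 d2.
     tens (tensor C D) (tensor C D) (tens C D c1 d1) (tens C D c2 d2))))"
  by (auto intro!: lr)

lemma comul_tensor_eq:
  "comul (tensor_coalg C D) = tlift C D (\<lambda>c d. ssum C c (\<lambda>c1 c2. ssum D d (\<lambda>d1 d2.
     tens (tensor C D) (tensor C D) (tens C D c1 d1) (tens C D c2 d2))))"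
  unfolding tensor_coalg_def coalg.simps
  by (intro tlift_cong sw_eqI[OF C is_vspace_tensor] sw_eqI[OF D is_vspace_tensor] refl)
    (auto intro!: lr)

lemma comul_tensor:
  assumes "c \<in> carr C" "d \<in> carr D"
  shows "comul (tensor_coalg C D) (tens C D c d) = ssum C c (\<lambda>c1 c2. ssum D d (\<lambda>d1 d2.
     tens (tensor C D) (tensor C D) (tens C D c1 d1) (tens C D c2 d2)))"
  unfolding comul_tensor_eq
  by (rule tensor_universal(2)[OF vs(1) is_vspace_tensor bilin_comul_tensor assms])

lemma lin_comul_tensor:
  "lin (tensor_coalg C D) (tensor (tensor_coalg C D) (tensor_coalg C D)) (comul (tensor_coalg C D))"
  unfolding comul_tensor_eq
  using tensor_universal(1)[OF vs(1) is_vspace_tensor bilin_comul_tensor] by simp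

lemma bilin_counit_tensor: "bilin C D k_space (\<lambda>c d. counit C c * counit D d)"
  by (auto intro!: bilinI lin_bilin1[OF bilin_times_k] lin_bilin2[OF bilin_times_k]
      coalgebraD(3)[OF C] coalgebraD(3)[OF D])

lemma counit_tensor:
  assumes "c \<in> carr C" "d \<in> carr D"
  shows "counit (tensor_coalg C D) (tens C D c d) = counit C c * counit D d"
  unfolding tensor_coalg_def coalg.simps
  by (rule tensor_universal(2)[OF vs(1) is_vspace_k_space bilin_counit_tensor assms])

lemma lin_counit_tensor: "lin (tensor C D) k_space (counit (tensor_coalg C D))"
  unfolding tensor_coalg_def coalg.simps
  by (rule tensor_universal(1)[OF vs(1) is_vspace_k_space bilin_counit_tensor])

lemma ssum_tensor:
  assumes Z: "is_vspace Z" and c: "c \<in> carr C" and d: "d \<in> carr D"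
    and f: "bilin (tensor C D) (tensor C D) Z f"
  shows "ssum (tensor_coalg C D) (tens C D c d) f =
    ssum C c (\<lambda>c1 c2. ssum D d (\<lambda>d1 d2. f (tens C D c1 d1) (tens C D c2 d2)))"
proof -
  let ?T = "tensor C D"
  have L: "lin (tensor ?T ?T) Z (tlift ?T ?T f)"
    by (rule tensor_universal(1)[OF is_vspace_tensor Z f])
  have "comul (tensor_coalg C D) (tens C D c d) \<in> carr (tensor ?T ?T)"
    unfolding comul_tensor[OF c d] by (auto intro!: lr)
  then have "ssum (tensor_coalg C D) (tens C D c d) f =
      tlift ?T ?T f (comul (tensor_coalg C D) (tens C D c d))"
    using tlift_tsum[OF f is_vspace_tensor Z] by (simp add: ssum_def)
  also have "\<dots> = ssum C c (\<lambda>c1 c2. ssum D d (\<lambda>d1 d2.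
      tlift ?T ?T f (tens ?T ?T (tens C D c1 d1) (tens C D c2 d2))))"
    unfolding comul_tensor[OF c d]
    by (subst lin_ssum[OF L is_vspace_tensor]; (intro ssum_cong refl lin_ssum[OF L is_vspace_tensor])?;
        auto intro!: lr)
  also have "\<dots> = ssum C c (\<lambda>c1 c2. ssum D d (\<lambda>d1 d2. f (tens C D c1 d1) (tens C D c2 d2)))"
    by (auto intro!: ssum_cong tensor_universal(2)[OF is_vspace_tensor Z f] tens_in_tensor)
  finally show ?thesis .
qed

text \<open>
  Sums over \<open>c\<close> and over \<open>d\<close> can be interchanged, so each coalgebra law of \<open>C \<otimes> D\<close> splits into
  the corresponding laws of \<open>C\<close> and of \<open>D\<close>.
\<close>

lemma coalgebra_tensor: "coalgebra (tensor_coalg C D)"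
proof (rule coalgebraI[OF _ lin_comul_tensor])
  let ?T = "tensor C D"
  let ?F = "\<lambda>x1 x2 x3. tens ?T (tensor ?T ?T) x1 (tens ?T ?T x2 x3)"
  let ?E = "tensor ?T (tensor ?T ?T)"
  note T = lin_comul_tensor[simplified]
  note lT = lin_ssum_arg[where C = "tensor_coalg C D", simplified, OF _ T]
  have F: "trilin ?T ?T ?T ?E ?F"
    unfolding trilin_def by (auto intro!: lr)
  have LHS: "lin ?T ?E (\<lambda>x. ssum (tensor_coalg C D) x
      (\<lambda>y x3. ssum (tensor_coalg C D) y (\<lambda>x1 x2. ?F x1 x2 x3)))"
    by (auto intro!: lr lT)
  have RHS: "lin ?T ?E (\<lambda>x. ssum (tensor_coalg C D) x
      (\<lambda>x1 y. ssum (tensor_coalg C D) y (\<lambda>x2 x3. ?F x1 x2 x3)))"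
    by (auto intro!: lr lT)
  have "ssum (tensor_coalg C D) x (\<lambda>y x3. ssum (tensor_coalg C D) y (\<lambda>x1 x2. ?F x1 x2 x3)) =
      ssum (tensor_coalg C D) x (\<lambda>x1 y. ssum (tensor_coalg C D) y (\<lambda>x2 x3. ?F x1 x2 x3))"
    if "x \<in> carr ?T" for x
  proof (rule tensor_ext[OF LHS RHS vs(1) _ that])
    fix c d assume cd: "c \<in> carr C" "d \<in> carr D"
    let ?G = "\<lambda>c1 c2 c3 d1 d2 d3. ?F (tens C D c1 d1) (tens C D c2 d2) (tens C D c3 d3)"
    have "ssum (tensor_coalg C D) (tens C D c d) (\<lambda>y x3. ssum (tensor_coalg C D) y (\<lambda>x1 x2. ?F x1 x2 x3)) =
        ssum C c (\<lambda>c' c3. ssum D d (\<lambda>d' d3.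
          ssum (tensor_coalg C D) (tens C D c' d') (\<lambda>x1 x2. ?F x1 x2 (tens C D c3 d3))))"
      by (rule ssum_tensor[OF is_vspace_tensor cd]) (auto intro!: lr lT)
    also have "\<dots> = ssum C c (\<lambda>c' c3. ssum D d (\<lambda>d' d3. ssum C c' (\<lambda>c1 c2. ssum D d' (\<lambda>d1 d2.
          ?G c1 c2 c3 d1 d2 d3))))"
      by (intro ssum_cong refl ssum_tensor[OF is_vspace_tensor]) (auto intro!: lr)
    also have "\<dots> = ssum C c (\<lambda>c' c3. ssum C c' (\<lambda>c1 c2. ssum D d (\<lambda>d' d3. ssum D d' (\<lambda>d1 d2.
          ?G c1 c2 c3 d1 d2 d3))))"
      by (subst ssum_swap) (rule refl)
    also have "\<dots> = ssum C c (\<lambda>c' c3. ssum C c' (\<lambda>c1 c2. ssum D d (\<lambda>d1 d'. ssum D d' (\<lambda>d2 d3.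
          ?G c1 c2 c3 d1 d2 d3))))"
      by (intro ssum_cong refl ssum_coassoc[OF D cd(2) is_vspace_tensor])
        (auto simp: trilin_def intro!: lr)
    also have "\<dots> = ssum C c (\<lambda>c1 c'. ssum C c' (\<lambda>c2 c3. ssum D d (\<lambda>d1 d'. ssum D d' (\<lambda>d2 d3.
          ?G c1 c2 c3 d1 d2 d3))))"
      by (rule ssum_coassoc[OF C cd(1) is_vspace_tensor]) (auto simp: trilin_def intro!: lr)
    also have "\<dots> = ssum C c (\<lambda>c1 c'. ssum D d (\<lambda>d1 d'. ssum C c' (\<lambda>c2 c3. ssum D d' (\<lambda>d2 d3.
          ?G c1 c2 c3 d1 d2 d3))))"
      by (intro ssum_cong refl) (subst ssum_swap, rule refl)
    also have "\<dots> = ssum C c (\<lambda>c1 c'. ssum D d (\<lambda>d1 d'.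
          ssum (tensor_coalg C D) (tens C D c' d') (\<lambda>x2 x3. ?F (tens C D c1 d1) x2 x3)))"
      by (intro ssum_cong refl ssum_tensor[OF is_vspace_tensor, symmetric]) (auto intro!: lr)
    also have "\<dots> = ssum (tensor_coalg C D) (tens C D c d)
        (\<lambda>x1 y. ssum (tensor_coalg C D) y (\<lambda>x2 x3. ?F x1 x2 x3))"
      by (rule ssum_tensor[OF is_vspace_tensor cd, symmetric]) (auto intro!: lr lT)
    finally show "ssum (tensor_coalg C D) (tens C D c d)
          (\<lambda>y x3. ssum (tensor_coalg C D) y (\<lambda>x1 x2. ?F x1 x2 x3)) = \<dots>" .
  qed
  then show "ssum (tensor_coalg C D) x (\<lambda>y x3. ssum (tensor_coalg C D) y
      (\<lambda>x1 x2. tens (tensor_coalg C D) (tensor (tensor_coalg C D) (tensor_coalg C D)) x1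
        (tens (tensor_coalg C D) (tensor_coalg C D) x2 x3))) =
    ssum (tensor_coalg C D) x (\<lambda>x1 y. ssum (tensor_coalg C D) y
      (\<lambda>x2 x3. tens (tensor_coalg C D) (tensor (tensor_coalg C D) (tensor_coalg C D)) x1
        (tens (tensor_coalg C D) (tensor_coalg C D) x2 x3)))"
    if "x \<in> carr (tensor_coalg C D)" for x
    using that by simp
  note lc = lin_bilin1[OF bilin_scl] lin_bilin2[OF bilin_scl] lin_counit_tensor vs
    coalgebraD(3)[OF C] coalgebraD(3)[OF D]
  have "ssum (tensor_coalg C D) x (\<lambda>x1 x2. scl ?T (counit (tensor_coalg C D) x1) x2) = x"
    "ssum (tensor_coalg C D) x (\<lambda>x1 x2. scl ?T (counit (tensor_coalg C D) x2) x1) = x"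
    if "x \<in> carr ?T" for x
  proof -
    show "ssum (tensor_coalg C D) x (\<lambda>x1 x2. scl ?T (counit (tensor_coalg C D) x1) x2) = x"
    proof (rule tensor_ext[where G = "\<lambda>x. x", OF _ lin_ident vs(1) _ that])
      show "lin ?T ?T (\<lambda>x. ssum (tensor_coalg C D) x (\<lambda>x1 x2. scl ?T (counit (tensor_coalg C D) x1) x2))"
        by (auto intro!: lr lT lc)
      fix c d assume cd: "c \<in> carr C" "d \<in> carr D"
      have "ssum (tensor_coalg C D) (tens C D c d) (\<lambda>x1 x2. scl ?T (counit (tensor_coalg C D) x1) x2) =
          ssum C c (\<lambda>c1 c2. ssum D d (\<lambda>d1 d2. scl ?T (counit C c1 * counit D d1) (tens C D c2 d2)))"
        by (subst ssum_tensor[OF is_vspace_tensor cd]) (auto intro!: lr lc simp: counit_tensor)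
      also have "\<dots> = ssum C c (\<lambda>c1 c2. ssum D d (\<lambda>d1 d2. scl ?T (counit C c1)
          (scl ?T (counit D d1) (tens C D c2 d2))))"
        by (simp add: vspace_scale)
      also have "\<dots> = ssum C c (\<lambda>c1 c2. scl ?T (counit C c1)
          (ssum D d (\<lambda>d1 d2. scl ?T (counit D d1) (tens C D c2 d2))))"
        by (simp add: scl_ssum)
      also have "\<dots> = ssum C c (\<lambda>c1 c2. scl ?T (counit C c1) (tens C D c2 d))"
        using cd by (intro ssum_cong refl arg_cong2[where f = "scl ?T"] ssum_counit[OF D]) (auto intro!: lr)
      also have "\<dots> = tens C D c d"
        using cd by (intro ssum_counit[OF C]) (auto intro!: lr)
      finally show "ssum (tensor_coalg C D) (tens C D c d) (\<lambda>x1 x2. scl ?T (counit (tensor_coalg C D) x1) x2) = \<dots>" .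
    qed
    show "ssum (tensor_coalg C D) x (\<lambda>x1 x2. scl ?T (counit (tensor_coalg C D) x2) x1) = x"
    proof (rule tensor_ext[where G = "\<lambda>x. x", OF _ lin_ident vs(1) _ that])
      show "lin ?T ?T (\<lambda>x. ssum (tensor_coalg C D) x (\<lambda>x1 x2. scl ?T (counit (tensor_coalg C D) x2) x1))"
        by (auto intro!: lr lT lc)
      fix c d assume cd: "c \<in> carr C" "d \<in> carr D"
      have "ssum (tensor_coalg C D) (tens C D c d) (\<lambda>x1 x2. scl ?T (counit (tensor_coalg C D) x2) x1) =
          ssum C c (\<lambda>c1 c2. ssum D d (\<lambda>d1 d2. scl ?T (counit C c2 * counit D d2) (tens C D c1 d1)))"
        by (subst ssum_tensor[OF is_vspace_tensor cd]) (auto intro!: lr lc simp: counit_tensor)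
      also have "\<dots> = ssum C c (\<lambda>c1 c2. scl ?T (counit C c2)
          (ssum D d (\<lambda>d1 d2. scl ?T (counit D d2) (tens C D c1 d1))))"
        by (simp add: scl_ssum vspace_scale)
      also have "\<dots> = ssum C c (\<lambda>c1 c2. scl ?T (counit C c2) (tens C D c1 d))"
        using cd by (intro ssum_cong refl arg_cong2[where f = "scl ?T"] ssum_counit[OF D]) (auto intro!: lr)
      also have "\<dots> = tens C D c d"
        using cd by (intro ssum_counit[OF C]) (auto intro!: lr)
      finally show "ssum (tensor_coalg C D) (tens C D c d) (\<lambda>x1 x2. scl ?T (counit (tensor_coalg C D) x2) x1) = \<dots>" .
    qed
  qed
  then show "ssum (tensor_coalg C D) x (\<lambda>x1 x2. scl (tensor_coalg C D) (counit (tensor_coalg C D) x1) x2) = x"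
    "ssum (tensor_coalg C D) x (\<lambda>x1 x2. scl (tensor_coalg C D) (counit (tensor_coalg C D) x2) x1) = x"
    if "x \<in> carr (tensor_coalg C D)" for x
    using that by simp_all
qed (use lin_counit_tensor in simp_all)

end

section \<open>Dual quasi-bialgebras\<close>

locale dual_quasi_bialg =
  fixes H :: "('k::field, 'h::ab_group_add, 'z) dqb_scheme"
  assumes dqb: "dual_quasi_bialgebra H"
begin

abbreviation "HH \<equiv> tensor_coalg H H"
abbreviation "HHH \<equiv> tensor_coalg HH H"

abbreviation "H2 \<equiv> tensor H H"
abbreviation "H3 \<equiv> tensor (tensor H H) H"
abbreviation "t2 \<equiv> tens H H"
abbreviation "t3 h g l \<equiv> tens (tensor H H) H (tens H H h g) l"

abbreviation \<epsilon> where "\<epsilon> \<equiv> counit H"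

lemma coalg_H [simp]: "coalgebra H"
  using dqb by (simp add: dual_quasi_bialgebra_def)

lemma coalg_HH [simp]: "coalgebra HH"
  by (simp add: coalgebra_tensor)

lemma coalg_HHH [simp]: "coalgebra HHH"
  by (simp add: coalgebra_tensor)

lemma vspace_H [simp]: "is_vspace H"
  by (rule coalgebraD(1)[OF coalg_H])

lemma one_carr [simp]: "one H \<in> carr H"
  and comul_one: "comul H (one H) = t2 (one H) (one H)"
  and counit_one [simp]: "\<epsilon> (one H) = 1"
  and mul_one [simp]: "h \<in> carr H \<Longrightarrow> mul H (one H) h = h" "h \<in> carr H \<Longrightarrow> mul H h (one H) = h"
  and hom_mult: "coalgebra_hom HH H (mult H)"
  and lin_reass: "lin H3 k_space (reass H)"
  using dqb by (auto simp: dual_quasi_bialgebra_def)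

lemma lin_mult: "lin H2 H (mult H)"
  using hom_mult by (simp add: coalgebra_hom_def)

lemma bilin_mul: "bilin H H H (mul H)"
  unfolding mul_def
  by (auto intro!: bilinI lin_comp[OF lin_mult] lin_bilin1[OF bilin_tens] lin_bilin2[OF bilin_tens]
      lin_ident)

lemma mul_carr [simp]: "h \<in> carr H \<Longrightarrow> g \<in> carr H \<Longrightarrow> mul H h g \<in> carr H"
  by (rule bilin_mem[OF bilin_mul])

lemma counit_mul: "h \<in> carr H \<Longrightarrow> g \<in> carr H \<Longrightarrow> \<epsilon> (mul H h g) = \<epsilon> h * \<epsilon> g"
  using hom_mult by (simp add: coalgebra_hom_def mul_def tens_in_tensor counit_tensor)

definition "\<phi>inv = conv_inv HHH (reass H)"

lemma lin_phi_inv: "lin H3 k_space \<phi>inv"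
  and conv_phi: "x \<in> carr HHH \<Longrightarrow> cv HHH (*) (reass H) \<phi>inv x = counit HHH x"
    "x \<in> carr HHH \<Longrightarrow> cv HHH (*) \<phi>inv (reass H) x = counit HHH x"
proof -
  have "\<exists>g. is_conv_inverse HHH (reass H) g"
    using dqb by (simp add: dual_quasi_bialgebra_def)
  from someI_ex[OF this] have "is_conv_inverse HHH (reass H) \<phi>inv"
    by (simp add: \<phi>inv_def conv_inv_def)
  then have *: "lin HHH k_space \<phi>inv" "\<And>x. x \<in> carr HHH \<Longrightarrow>
      conv HHH (reass H) \<phi>inv x = counit HHH x \<and> conv HHH \<phi>inv (reass H) x = counit HHH x"
    by (auto simp: is_conv_inverse_def)
  then show L: "lin H3 k_space \<phi>inv" by simp
  have eq: "conv HHH f g x = cv HHH (*) f g x"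
    if "lin H3 k_space f" "lin H3 k_space g"
      "x \<in> carr HHH" for f g x
    unfolding conv_def cv_def using that
    by (intro sw_ssum[OF coalgebraD(1,2)[OF coalg_HHH] that(3) is_vspace_k_space])
      (auto intro!: bilin_cv_body[OF _ _ bilin_times_k])
  show "x \<in> carr HHH \<Longrightarrow> cv HHH (*) (reass H) \<phi>inv x = counit HHH x"
    "x \<in> carr HHH \<Longrightarrow> cv HHH (*) \<phi>inv (reass H) x = counit HHH x"
    using * eq[OF lin_reass L] eq[OF L lin_reass] by simp_all
qed

lemma phi_inv_eq: "phi_inv H h g l = \<phi>inv (t3 h g l)"
  by (simp add: phi_inv_def \<phi>inv_def)

lemma lin_phi:
  assumes "lin U H f" "b \<in> carr H" "c \<in> carr H"
  shows "lin U k_space (\<lambda>u. phi H (f u) b c)" "lin U k_space (\<lambda>u. phi H b (f u) c)"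
    "lin U k_space (\<lambda>u. phi H b c (f u))" "lin U k_space (\<lambda>u. phi_inv H (f u) b c)"
    "lin U k_space (\<lambda>u. phi_inv H b (f u) c)" "lin U k_space (\<lambda>u. phi_inv H b c (f u))"
  unfolding phi_def phi_inv_eq using assms
  by (auto intro!: lin_comp[OF lin_reass] lin_comp[OF lin_phi_inv] lin_bilin1[OF bilin_tens]
      lin_bilin2[OF bilin_tens] tens_in_tensor)

lemmas lin_rules = lin_ident lin_bilin1[OF bilin_tens] lin_bilin2[OF bilin_tens]
  lin_bilin1[OF bilin_scl] lin_bilin2[OF bilin_scl] lin_bilin1[OF bilin_times_k]
  lin_bilin2[OF bilin_times_k] lin_bilin1[OF bilin_mul] lin_bilin2[OF bilin_mul]
  lin_ssum_arg[OF _ coalgebraD(1,2)[OF coalg_H]] lin_ssum_body lin_phi bilinI ssum_mem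
  lin_comp[OF coalgebraD(3)[OF coalg_H]] coalgebraD(3)[OF coalg_H] tens_in_tensor

lemma ssum_one:
  assumes "is_vspace Z" "bilin H H Z f"
  shows "ssum H (one H) f = f (one H) (one H)"
  unfolding ssum_def comul_one by (rule tsum_tens[OF assms(2) vspace_H assms(1)]) simp_all

lemma ssum_HH:
  assumes "is_vspace Z" "bilin H2 H2 Z f" "h \<in> carr H" "g \<in> carr H"
  shows "ssum HH (t2 h g) f =
    ssum H h (\<lambda>h1 h2. ssum H g (\<lambda>g1 g2. f (t2 h1 g1) (t2 h2 g2)))"
  by (rule ssum_tensor[OF coalg_H coalg_H assms(1,3,4,2)])

lemma ssum_HHH:
  assumes Z: "is_vspace Z"
    and f: "bilin H3 H3 Z f"
    and h: "h \<in> carr H" "g \<in> carr H" "l \<in> carr H"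
  shows "ssum HHH (t3 h g l) f =
    ssum H h (\<lambda>h1 h2. ssum H g (\<lambda>g1 g2. ssum H l (\<lambda>l1 l2.
      f (t3 h1 g1 l1) (t3 h2 g2 l2))))"
proof -
  note f' = lin_bilin1[OF f] lin_bilin2[OF f]
  have "ssum HHH (t3 h g l) f =
      ssum HH (t2 h g) (\<lambda>x1 x2. ssum H l (\<lambda>l1 l2.
        f (tens H2 H x1 l1) (tens H2 H x2 l2)))"
    using ssum_tensor[OF coalg_HH coalg_H Z, simplified, OF _ h(3) f] h by (simp add: tens_in_tensor)
  also have "\<dots> = ssum H h (\<lambda>h1 h2. ssum H g (\<lambda>g1 g2. ssum H l (\<lambda>l1 l2.
      f (t3 h1 g1 l1) (t3 h2 g2 l2))))"
    by (rule ssum_HH[OF Z _ h(1,2)]) (auto intro!: lin_rules f' Z)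
  finally show ?thesis .
qed

lemma ssum_mul:
  assumes Z: "is_vspace Z" and f: "bilin H H Z f" and h: "h \<in> carr H" "g \<in> carr H"
  shows "ssum H (mul H h g) f =
    ssum H h (\<lambda>h1 h2. ssum H g (\<lambda>g1 g2. f (mul H h1 g1) (mul H h2 g2)))"
proof -
  have "ssum H (mul H h g) f = ssum HH (t2 h g) (\<lambda>x1 x2. f (mult H x1) (mult H x2))"
    unfolding mul_def using h
    by (intro ssum_coalgebra_hom[OF hom_mult coalg_H Z coalg_HH _ f]) (simp add: tens_in_tensor)
  also have "\<dots> = ssum H h (\<lambda>h1 h2. ssum H g (\<lambda>g1 g2. f (mul H h1 g1) (mul H h2 g2)))"
    unfolding mul_def
    by (rule ssum_HH[OF Z _ h]) (rule bilin_cv_body[OF lin_mult lin_mult f])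
  finally show ?thesis .
qed

lemma counit_HH: "h \<in> carr H \<Longrightarrow> g \<in> carr H \<Longrightarrow> counit HH (t2 h g) = \<epsilon> h * \<epsilon> g"
  by (simp add: counit_tensor)

lemma counit_HHH: "h \<in> carr H \<Longrightarrow> g \<in> carr H \<Longrightarrow> l \<in> carr H \<Longrightarrow>
    counit HHH (t3 h g l) = \<epsilon> h * \<epsilon> g * \<epsilon> l"
  using counit_tensor[OF coalg_HH coalg_H, of "t2 h g" l]
  by (simp add: counit_HH tens_in_tensor)

lemma phi_phi_inv:
  assumes h: "h \<in> carr H" "g \<in> carr H" "l \<in> carr H"
  shows "ssum H h (\<lambda>h1 h2. ssum H g (\<lambda>g1 g2. ssum H l (\<lambda>l1 l2.
      phi H h1 g1 l1 * phi_inv H h2 g2 l2))) = \<epsilon> h * \<epsilon> g * \<epsilon> l"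
    and "ssum H h (\<lambda>h1 h2. ssum H g (\<lambda>g1 g2. ssum H l (\<lambda>l1 l2.
      phi_inv H h1 g1 l1 * phi H h2 g2 l2))) = \<epsilon> h * \<epsilon> g * \<epsilon> l"
proof -
  have mem: "t3 h g l \<in> carr HHH" using h by (simp add: tens_in_tensor)
  note b = bilin_cv_body[OF lin_reass lin_phi_inv bilin_times_k]
    bilin_cv_body[OF lin_phi_inv lin_reass bilin_times_k]
  show "ssum H h (\<lambda>h1 h2. ssum H g (\<lambda>g1 g2. ssum H l (\<lambda>l1 l2.
      phi H h1 g1 l1 * phi_inv H h2 g2 l2))) = \<epsilon> h * \<epsilon> g * \<epsilon> l"
    using conv_phi(1)[OF mem] ssum_HHH[OF is_vspace_k_space b(1) h]
    by (simp add: cv_def counit_HHH h phi_def phi_inv_eq)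
  show "ssum H h (\<lambda>h1 h2. ssum H g (\<lambda>g1 g2. ssum H l (\<lambda>l1 l2.
      phi_inv H h1 g1 l1 * phi H h2 g2 l2))) = \<epsilon> h * \<epsilon> g * \<epsilon> l"
    using conv_phi(2)[OF mem] ssum_HHH[OF is_vspace_k_space b(2) h]
    by (simp add: cv_def counit_HHH h phi_def phi_inv_eq)
qed

subsection \<open>Normalisation of the reassociator\<close>

lemma phi_one_mid: "h \<in> carr H \<Longrightarrow> g \<in> carr H \<Longrightarrow> phi H h (one H) g = \<epsilon> h * \<epsilon> g"
  using dqb by (simp add: dual_quasi_bialgebra_def)

lemma pentagon:
  assumes "h \<in> carr H" "g \<in> carr H" "l \<in> carr H" "m \<in> carr H"
  shows "ssum H h (\<lambda>h1 h2. ssum H g (\<lambda>g1 g2. ssum H l (\<lambda>l1 l2. ssum H m (\<lambda>m1 m2.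
      phi H h1 g1 (mul H l1 m1) * phi H (mul H h2 g2) l2 m2)))) =
    ssum H h (\<lambda>h1 h2. ssum H g (\<lambda>g1 g'. ssum H g' (\<lambda>g2 g3. ssum H l (\<lambda>l1 l'. ssum H l' (\<lambda>l2 l3.
      ssum H m (\<lambda>m1 m2. phi H g1 l1 m1 * phi H h1 (mul H g2 l2) m2 * phi H h2 g3 l3))))))"
    (is "?L = ?R")
proof -
  have "sw H h (\<lambda>h1 h2. sw H g (\<lambda>g1 g2. sw H l (\<lambda>l1 l2. sw H m (\<lambda>m1 m2.
      phi H h1 g1 (mul H l1 m1) * phi H (mul H h2 g2) l2 m2)))) = ?L"
    using assms
    by (intro sw_eqI[OF coalg_H is_vspace_k_space] refl) (auto intro!: lin_rules)
  moreover have "sw H h (\<lambda>h1 h2. sw3 H g (\<lambda>g1 g2 g3. sw3 H l (\<lambda>l1 l2 l3. sw H m (\<lambda>m1 m2.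
      phi H g1 l1 m1 * phi H h1 (mul H g2 l2) m2 * phi H h2 g3 l3)))) = ?R"
    unfolding sw3_def using assms
    by (intro sw_eqI[OF coalg_H is_vspace_k_space] refl) (auto intro!: lin_rules)
  moreover note dqb[unfolded dual_quasi_bialgebra_def, THEN conjunct2, THEN conjunct2,
      THEN conjunct2, THEN conjunct2, THEN conjunct2, THEN conjunct2, THEN conjunct2,
      THEN conjunct2, THEN conjunct2, THEN conjunct1, rule_format, OF assms]
  ultimately show ?thesis by (simp only:)
qed

lemma quasi_assoc:
  assumes "h \<in> carr H" "g \<in> carr H" "l \<in> carr H"
  shows "ssum H h (\<lambda>h1 h2. ssum H g (\<lambda>g1 g2. ssum H l (\<lambda>l1 l2.
      scl H (phi H h2 g2 l2) (mul H h1 (mul H g1 l1))))) =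
    ssum H h (\<lambda>h1 h2. ssum H g (\<lambda>g1 g2. ssum H l (\<lambda>l1 l2.
      scl H (phi H h1 g1 l1) (mul H (mul H h2 g2) l2))))" (is "?L = ?R")
proof -
  have "sw H h (\<lambda>h1 h2. sw H g (\<lambda>g1 g2. sw H l (\<lambda>l1 l2.
      scl H (phi H h2 g2 l2) (mul H h1 (mul H g1 l1))))) = ?L"
    using assms
    by (intro sw_eqI[OF coalg_H vspace_H] refl) (auto intro!: lin_rules)
  moreover have "sw H h (\<lambda>h1 h2. sw H g (\<lambda>g1 g2. sw H l (\<lambda>l1 l2.
      scl H (phi H h1 g1 l1) (mul H (mul H h2 g2) l2)))) = ?R"
    using assms
    by (intro sw_eqI[OF coalg_H vspace_H] refl) (auto intro!: lin_rules)
  moreover note dqb[unfolded dual_quasi_bialgebra_def, THEN conjunct2, THEN conjunct2,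
      THEN conjunct2, THEN conjunct2, THEN conjunct2, THEN conjunct2, THEN conjunct2,
      THEN conjunct2, THEN conjunct1, rule_format, OF assms]
  ultimately show ?thesis by (simp only:)
qed

lemma ssum_counit_H:
  assumes "is_vspace Z" "lin H Z f" "h \<in> carr H"
  shows "ssum H h (\<lambda>h1 h2. scl Z (\<epsilon> h1) (f h2)) = f h"
    "ssum H h (\<lambda>h1 h2. scl Z (\<epsilon> h2) (f h1)) = f h"
  using ssum_counit[OF coalg_H assms(3,1,2)] by simp_all

lemma ssum_counit_k:
  assumes "lin H k_space f" "h \<in> carr H"
  shows "ssum H h (\<lambda>h1 h2. \<epsilon> h1 * f h2) = f h" "ssum H h (\<lambda>h1 h2. \<epsilon> h2 * f h1) = f h"
    "ssum H h (\<lambda>h1 h2. f h2 * \<epsilon> h1) = f h" "ssum H h (\<lambda>h1 h2. f h1 * \<epsilon> h2) = f h"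
  using ssum_counit_H[OF is_vspace_k_space assms] by (simp_all add: mult.commute)

lemma ssum_scale_k: "ssum H h (\<lambda>h1 h2. (c :: 'k) * f h1 h2) = c * ssum H h f"
  using scl_ssum[of k_space c H h f] by simp

lemma ssum_counit2:
  assumes F: "bilin H H k_space F" and h: "l \<in> carr H" "m \<in> carr H"
  shows "ssum H l (\<lambda>l1 l2. ssum H m (\<lambda>m1 m2. \<epsilon> l1 * \<epsilon> m1 * F l2 m2)) = F l m"
    and "ssum H l (\<lambda>l1 l2. ssum H m (\<lambda>m1 m2. \<epsilon> l2 * \<epsilon> m2 * F l1 m1)) = F l m"
  using h
  by (simp_all add: mult.assoc ssum_scale_k ssum_counit_k[OF bilin_lin2[OF F]]
      ssum_counit_k[OF bilin_lin1[OF F]])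

text \<open>
  If \<open>F * F = F\<close> and \<open>G * F = \<epsilon>\<close>, then \<open>F = (G * F) * F = G * (F * F) = \<epsilon>\<close>.
\<close>

lemma conv_idempotent:
  assumes F: "bilin H H k_space F" and G: "bilin H H k_space G"
    and idem: "\<And>l m. l \<in> carr H \<Longrightarrow> m \<in> carr H \<Longrightarrow>
      ssum H l (\<lambda>l1 l2. ssum H m (\<lambda>m1 m2. F l1 m1 * F l2 m2)) = F l m"
    and inv: "\<And>l m. l \<in> carr H \<Longrightarrow> m \<in> carr H \<Longrightarrow>
      ssum H l (\<lambda>l1 l2. ssum H m (\<lambda>m1 m2. G l1 m1 * F l2 m2)) = \<epsilon> l * \<epsilon> m"
    and h: "l \<in> carr H" "m \<in> carr H"
  shows "F l m = \<epsilon> l * \<epsilon> m"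
proof -
  let ?f = "tlift H H F" and ?g = "tlift H H G"
  note lf = tensor_universal(1)[OF vspace_H is_vspace_k_space F]
    tensor_universal(1)[OF vspace_H is_vspace_k_space G]
  note tf = tensor_universal(2)[OF vspace_H is_vspace_k_space F]
    tensor_universal(2)[OF vspace_H is_vspace_k_space G]
  note lc = lin_cv[OF coalg_HH is_vspace_k_space _ _ bilin_times_k, simplified]
  have cve: "cv HH (*) f g (t2 a b) =
      ssum H a (\<lambda>a1 a2. ssum H b (\<lambda>b1 b2. f (t2 a1 b1) * g (t2 a2 b2)))"
    if "lin H2 k_space f" "lin H2 k_space g" "a \<in> carr H" "b \<in> carr H"
    for f g a b
    unfolding cv_def using that
    by (intro ssum_HH[OF is_vspace_k_space]) (auto intro: bilin_cv_body[OF _ _ bilin_times_k])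
  have ff: "cv HH (*) ?f ?f x = ?f x" if "x \<in> carr H2" for x
    by (rule tensor_ext[OF lc[OF lf(1) lf(1)] lf(1) vspace_H _ that])
      (simp add: cve lf tf idem)
  have gf: "cv HH (*) ?g ?f x = counit HH x" if "x \<in> carr H2" for x
    by (rule tensor_ext[OF lc[OF lf(2) lf(1)] lin_counit_tensor[OF coalg_H coalg_H] vspace_H _ that])
      (simp add: cve lf tf inv counit_HH)
  have x: "t2 l m \<in> carr H2" using h by (rule tens_in_tensor)
  have "counit HH (t2 l m) = cv HH (*) ?g ?f (t2 l m)"
    using gf[OF x] by simp
  also have "\<dots> = cv HH (*) ?g (cv HH (*) ?f ?f) (t2 l m)"
    by (rule cv_cong) (simp_all add: ff)
  also have "\<dots> = cv HH (*) (cv HH (*) ?g ?f) ?f (t2 l m)"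
    by (rule cv_assoc[OF coalg_HH _ is_vspace_k_space is_vspace_k_space is_vspace_k_space _ _ _
          bilin_times_k bilin_times_k bilin_times_k bilin_times_k, symmetric])
      (simp_all add: lf x)
  also have "\<dots> = cv HH (*) (counit HH) ?f (t2 l m)"
    by (rule cv_cong) (simp_all add: gf)
  also have "\<dots> = ?f (t2 l m)"
    using cv_counit(1)[OF coalg_HH _ is_vspace_k_space, of "t2 l m" ?f] lf x by simp
  finally show ?thesis using h by (simp add: counit_HH tf)
qed

text \<open>
  Putting \<open>h = g = 1\<close> in the pentagon shows that \<open>\<phi>(1, -, -)\<close> is a convolution idempotent, and
  \<open>l = m = 1\<close> does the same for \<open>\<phi>(-, -, 1)\<close>.  Both have a convolution inverse, the corresponding
  restriction of \<open>\<phi>\<^sup>-\<^sup>1\<close>, because \<open>1\<close> is grouplike.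
\<close>

lemma phi_one_left:
  assumes lm: "l \<in> carr H" "m \<in> carr H"
  shows "phi H (one H) l m = \<epsilon> l * \<epsilon> m"
proof (rule conv_idempotent[OF _ _ _ _ lm, of "phi H (one H)" "phi_inv H (one H)"])
  show "bilin H H k_space (phi H (one H))" "bilin H H k_space (phi_inv H (one H))"
    by (auto intro!: lin_rules)
  fix l m assume lm: "l \<in> carr H" "m \<in> carr H"
  have "ssum H (one H) (\<lambda>h1 h2. ssum H l (\<lambda>l1 l2. ssum H m (\<lambda>m1 m2.
      phi_inv H h1 l1 m1 * phi H h2 l2 m2))) =
    ssum H l (\<lambda>l1 l2. ssum H m (\<lambda>m1 m2. phi_inv H (one H) l1 m1 * phi H (one H) l2 m2))"
    by (rule ssum_one[OF is_vspace_k_space]) (auto intro!: lin_rules)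
  then show "ssum H l (\<lambda>l1 l2. ssum H m (\<lambda>m1 m2. phi_inv H (one H) l1 m1 * phi H (one H) l2 m2)) =
      \<epsilon> l * \<epsilon> m"
    using phi_phi_inv(2)[of "one H" l m] lm by simp
  have L: "ssum H (one H) (\<lambda>h1 h2. ssum H (one H) (\<lambda>g1 g2. ssum H l (\<lambda>l1 l2. ssum H m (\<lambda>m1 m2.
      phi H h1 g1 (mul H l1 m1) * phi H (mul H h2 g2) l2 m2)))) = phi H (one H) l m" (is "?L = _")
  proof -
    have "?L = ssum H (one H) (\<lambda>g1 g2. ssum H l (\<lambda>l1 l2. ssum H m (\<lambda>m1 m2.
        phi H (one H) g1 (mul H l1 m1) * phi H (mul H (one H) g2) l2 m2)))"
      by (rule ssum_one[OF is_vspace_k_space]) (auto intro!: lin_rules)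
    also have "\<dots> = ssum H l (\<lambda>l1 l2. ssum H m (\<lambda>m1 m2.
        phi H (one H) (one H) (mul H l1 m1) * phi H (mul H (one H) (one H)) l2 m2))"
      by (rule ssum_one[OF is_vspace_k_space]) (auto intro!: lin_rules)
    also have "\<dots> = ssum H l (\<lambda>l1 l2. ssum H m (\<lambda>m1 m2. \<epsilon> l1 * \<epsilon> m1 * phi H (one H) l2 m2))"
      by (simp add: phi_one_mid counit_mul)
    also have "\<dots> = phi H (one H) l m"
      using lm by (intro ssum_counit2) (auto intro!: lin_rules)
    finally show ?thesis .
  qed
  have R: "ssum H (one H) (\<lambda>h1 h2. ssum H (one H) (\<lambda>g1 g'. ssum H g' (\<lambda>g2 g3. ssum H l (\<lambda>l1 l'.
      ssum H l' (\<lambda>l2 l3. ssum H m (\<lambda>m1 m2.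
        phi H g1 l1 m1 * phi H h1 (mul H g2 l2) m2 * phi H h2 g3 l3)))))) =
      ssum H l (\<lambda>l1 l2. ssum H m (\<lambda>m1 m2. phi H (one H) l1 m1 * phi H (one H) l2 m2))" (is "?R = _")
  proof -
    have "?R = ssum H (one H) (\<lambda>g1 g'. ssum H g' (\<lambda>g2 g3. ssum H l (\<lambda>l1 l'.
      ssum H l' (\<lambda>l2 l3. ssum H m (\<lambda>m1 m2.
        phi H g1 l1 m1 * phi H (one H) (mul H g2 l2) m2 * phi H (one H) g3 l3)))))"
      by (rule ssum_one[OF is_vspace_k_space]) (auto intro!: lin_rules)
    also have "\<dots> = ssum H (one H) (\<lambda>g2 g3. ssum H l (\<lambda>l1 l'. ssum H l' (\<lambda>l2 l3. ssum H m (\<lambda>m1 m2.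
        phi H (one H) l1 m1 * phi H (one H) (mul H g2 l2) m2 * phi H (one H) g3 l3))))"
      by (rule ssum_one[OF is_vspace_k_space]) (auto intro!: lin_rules)
    also have "\<dots> = ssum H l (\<lambda>l1 l'. ssum H l' (\<lambda>l2 l3. ssum H m (\<lambda>m1 m2.
        phi H (one H) l1 m1 * phi H (one H) (mul H (one H) l2) m2 * phi H (one H) (one H) l3)))"
      by (rule ssum_one[OF is_vspace_k_space]) (auto intro!: lin_rules)
    also have "\<dots> = ssum H l (\<lambda>l1 l'. ssum H l' (\<lambda>l2 l3. \<epsilon> l3 * ssum H m (\<lambda>m1 m2.
        phi H (one H) l1 m1 * phi H (one H) l2 m2)))"
      by (simp add: phi_one_mid ssum_scale_k[symmetric] mult.commute)
    also have "\<dots> = ssum H l (\<lambda>l1 l2. ssum H m (\<lambda>m1 m2. phi H (one H) l1 m1 * phi H (one H) l2 m2))"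
      by (intro ssum_cong refl ssum_counit_k(2)) (auto intro!: lin_rules)
    finally show ?thesis .
  qed
  show "ssum H l (\<lambda>l1 l2. ssum H m (\<lambda>m1 m2. phi H (one H) l1 m1 * phi H (one H) l2 m2)) =
      phi H (one H) l m"
    using pentagon[of "one H" "one H" l m] lm unfolding L R by simp
qed

lemma phi_one_right:
  assumes hg: "h \<in> carr H" "g \<in> carr H"
  shows "phi H h g (one H) = \<epsilon> h * \<epsilon> g"
proof (rule conv_idempotent[OF _ _ _ _ hg, of "\<lambda>h g. phi H h g (one H)" "\<lambda>h g. phi_inv H h g (one H)"])
  show "bilin H H k_space (\<lambda>h g. phi H h g (one H))" "bilin H H k_space (\<lambda>h g. phi_inv H h g (one H))"
    by (auto intro!: lin_rules)
  fix h g assume hg: "h \<in> carr H" "g \<in> carr H"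
  have "ssum H h (\<lambda>h1 h2. ssum H g (\<lambda>g1 g2. ssum H (one H) (\<lambda>m1 m2.
      phi_inv H h1 g1 m1 * phi H h2 g2 m2))) =
    ssum H h (\<lambda>h1 h2. ssum H g (\<lambda>g1 g2. phi_inv H h1 g1 (one H) * phi H h2 g2 (one H)))"
    by (intro ssum_cong refl ssum_one[OF is_vspace_k_space]) (auto intro!: lin_rules)
  then show "ssum H h (\<lambda>h1 h2. ssum H g (\<lambda>g1 g2. phi_inv H h1 g1 (one H) * phi H h2 g2 (one H))) =
      \<epsilon> h * \<epsilon> g"
    using phi_phi_inv(2)[of h g "one H"] hg by simp
  have L: "ssum H h (\<lambda>h1 h2. ssum H g (\<lambda>g1 g2. ssum H (one H) (\<lambda>l1 l2. ssum H (one H) (\<lambda>m1 m2.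
      phi H h1 g1 (mul H l1 m1) * phi H (mul H h2 g2) l2 m2)))) = phi H h g (one H)" (is "?L = _")
  proof -
    have "?L = ssum H h (\<lambda>h1 h2. ssum H g (\<lambda>g1 g2. ssum H (one H) (\<lambda>m1 m2.
        phi H h1 g1 (mul H (one H) m1) * phi H (mul H h2 g2) (one H) m2)))"
      by (intro ssum_cong refl ssum_one[OF is_vspace_k_space]) (auto intro!: lin_rules)
    also have "\<dots> = ssum H h (\<lambda>h1 h2. ssum H g (\<lambda>g1 g2.
        phi H h1 g1 (mul H (one H) (one H)) * phi H (mul H h2 g2) (one H) (one H)))"
      by (intro ssum_cong refl ssum_one[OF is_vspace_k_space]) (auto intro!: lin_rules)
    also have "\<dots> = ssum H h (\<lambda>h1 h2. ssum H g (\<lambda>g1 g2. \<epsilon> h2 * \<epsilon> g2 * phi H h1 g1 (one H)))"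
      by (simp add: phi_one_mid counit_mul mult.commute)
    also have "\<dots> = phi H h g (one H)"
      using hg by (intro ssum_counit2(2)[where F = "\<lambda>h g. phi H h g (one H)"]) (auto intro!: lin_rules)
    finally show ?thesis .
  qed
  have R: "ssum H h (\<lambda>h1 h2. ssum H g (\<lambda>g1 g'. ssum H g' (\<lambda>g2 g3. ssum H (one H) (\<lambda>l1 l'.
      ssum H l' (\<lambda>l2 l3. ssum H (one H) (\<lambda>m1 m2.
        phi H g1 l1 m1 * phi H h1 (mul H g2 l2) m2 * phi H h2 g3 l3)))))) =
      ssum H h (\<lambda>h1 h2. ssum H g (\<lambda>g1 g2. phi H h1 g1 (one H) * phi H h2 g2 (one H)))" (is "?R = _")
  proof -
    have "?R = ssum H h (\<lambda>h1 h2. ssum H g (\<lambda>g1 g'. ssum H g' (\<lambda>g2 g3. ssum H (one H) (\<lambda>l2 l3.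
        ssum H (one H) (\<lambda>m1 m2. phi H g1 (one H) m1 * phi H h1 (mul H g2 l2) m2 * phi H h2 g3 l3)))))"
      by (intro ssum_cong refl ssum_one[OF is_vspace_k_space]) (auto intro!: lin_rules)
    also have "\<dots> = ssum H h (\<lambda>h1 h2. ssum H g (\<lambda>g1 g'. ssum H g' (\<lambda>g2 g3. ssum H (one H) (\<lambda>m1 m2.
        phi H g1 (one H) m1 * phi H h1 (mul H g2 (one H)) m2 * phi H h2 g3 (one H)))))"
      by (intro ssum_cong refl ssum_one[OF is_vspace_k_space]) (auto intro!: lin_rules)
    also have "\<dots> = ssum H h (\<lambda>h1 h2. ssum H g (\<lambda>g1 g'. ssum H g' (\<lambda>g2 g3.
        phi H g1 (one H) (one H) * phi H h1 (mul H g2 (one H)) (one H) * phi H h2 g3 (one H))))"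
      by (intro ssum_cong refl ssum_one[OF is_vspace_k_space]) (auto intro!: lin_rules)
    also have "\<dots> = ssum H h (\<lambda>h1 h2. ssum H g (\<lambda>g1 g'. \<epsilon> g1 * ssum H g' (\<lambda>g2 g3.
        phi H h1 g2 (one H) * phi H h2 g3 (one H))))"
      by (simp add: phi_one_mid ssum_scale_k[symmetric] mult.assoc)
    also have "\<dots> = ssum H h (\<lambda>h1 h2. ssum H g (\<lambda>g1 g2. phi H h1 g1 (one H) * phi H h2 g2 (one H)))"
      using hg by (intro ssum_cong refl ssum_counit_k(1)) (auto intro!: lin_rules)
    finally show ?thesis .
  qed
  show "ssum H h (\<lambda>h1 h2. ssum H g (\<lambda>g1 g2. phi H h1 g1 (one H) * phi H h2 g2 (one H))) =
      phi H h g (one H)"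
    using pentagon[of h g "one H" "one H"] hg unfolding L R by simp
qed

text \<open>
  Where a restriction of \<open>\<phi>\<close> is the unit of convolution, so is the same restriction of its inverse.
\<close>

lemma phi_inv_one_left:
  assumes lm: "l \<in> carr H" "m \<in> carr H"
  shows "phi_inv H (one H) l m = \<epsilon> l * \<epsilon> m"
proof -
  have "\<epsilon> l * \<epsilon> m = ssum H (one H) (\<lambda>h1 h2. ssum H l (\<lambda>l1 l2. ssum H m (\<lambda>m1 m2.
      phi H h1 l1 m1 * phi_inv H h2 l2 m2)))"
    using phi_phi_inv(1)[of "one H" l m] lm by simp
  also have "\<dots> = ssum H l (\<lambda>l1 l2. ssum H m (\<lambda>m1 m2. phi H (one H) l1 m1 * phi_inv H (one H) l2 m2))"
    by (rule ssum_one[OF is_vspace_k_space]) (auto intro!: lin_rules)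
  also have "\<dots> = ssum H l (\<lambda>l1 l2. ssum H m (\<lambda>m1 m2. \<epsilon> l1 * \<epsilon> m1 * phi_inv H (one H) l2 m2))"
    by (simp add: phi_one_left)
  also have "\<dots> = phi_inv H (one H) l m"
    using lm by (intro ssum_counit2) (auto intro!: lin_rules)
  finally show ?thesis by simp
qed

lemma phi_inv_one_mid:
  assumes hg: "h \<in> carr H" "g \<in> carr H"
  shows "phi_inv H h (one H) g = \<epsilon> h * \<epsilon> g"
proof -
  have "\<epsilon> h * \<epsilon> g = ssum H h (\<lambda>h1 h2. ssum H (one H) (\<lambda>l1 l2. ssum H g (\<lambda>g1 g2.
      phi H h1 l1 g1 * phi_inv H h2 l2 g2)))"
    using phi_phi_inv(1)[of h "one H" g] hg by simp
  also have "\<dots> = ssum H h (\<lambda>h1 h2. ssum H g (\<lambda>g1 g2. phi H h1 (one H) g1 * phi_inv H h2 (one H) g2))"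
    by (intro ssum_cong refl ssum_one[OF is_vspace_k_space]) (auto intro!: lin_rules)
  also have "\<dots> = ssum H h (\<lambda>h1 h2. ssum H g (\<lambda>g1 g2. \<epsilon> h1 * \<epsilon> g1 * phi_inv H h2 (one H) g2))"
    by (simp add: phi_one_mid)
  also have "\<dots> = phi_inv H h (one H) g"
    using hg by (intro ssum_counit2(1)[where F = "\<lambda>h g. phi_inv H h (one H) g"]) (auto intro!: lin_rules)
  finally show ?thesis by simp
qed

end

section \<open>The associativity constraint of comodules\<close>

lemma trilinI:
  assumes "\<And>v w. v \<in> carr V \<Longrightarrow> w \<in> carr W \<Longrightarrow> lin U Z (\<lambda>u. f u v w)"
    and "\<And>u w. u \<in> carr U \<Longrightarrow> w \<in> carr W \<Longrightarrow> lin V Z (\<lambda>v. f u v w)"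
    and "\<And>u v. u \<in> carr U \<Longrightarrow> v \<in> carr V \<Longrightarrow> lin W Z (\<lambda>w. f u v w)"
  shows "trilin U V W Z f"
  using assms by (simp add: trilin_def)

lemma trilinD:
  assumes "trilin U V W Z f"
  shows "\<And>v w. v \<in> carr V \<Longrightarrow> w \<in> carr W \<Longrightarrow> lin U Z (\<lambda>u. f u v w)"
    and "\<And>u w. u \<in> carr U \<Longrightarrow> w \<in> carr W \<Longrightarrow> lin V Z (\<lambda>v. f u v w)"
    and "\<And>u v. u \<in> carr U \<Longrightarrow> v \<in> carr V \<Longrightarrow> lin W Z (\<lambda>w. f u v w)"
  using assms by (simp_all add: trilin_def)

context
  fixes U :: "('k::field, 'u::ab_group_add, 'x) vspace_scheme"
    and V :: "('k, 'v::ab_group_add, 'y) vspace_scheme"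
    and W :: "('k, 'w::ab_group_add, 'z) vspace_scheme"
    and Z :: "('k, 't::ab_group_add, 'zz) vspace_scheme"
    and f :: "'u \<Rightarrow> 'v \<Rightarrow> 'w \<Rightarrow> 't"
  assumes sp: "is_vspace U" "is_vspace V" "is_vspace W" "is_vspace Z" and f: "trilin U V W Z f"
begin

lemma bilin_tlift_left: "bilin (tensor U V) W Z (\<lambda>x w. tlift U V (\<lambda>u v. f u v w) x)"
proof (rule bilinI)
  have b: "bilin U V Z (\<lambda>u v. f u v w)" if "w \<in> carr W" for w
    using f that by (intro bilinI trilinD[OF f])
  show "lin (tensor U V) Z (tlift U V (\<lambda>u v. f u v w))" if "w \<in> carr W" for w
    by (rule tensor_universal(1)[OF sp(1,4) b[OF that]])
  show "lin W Z (\<lambda>w. tlift U V (\<lambda>u v. f u v w) x)" if "x \<in> carr (tensor U V)" for x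
  proof (subst lin_cong[OF _ sp(3)])
    show "lin W Z (\<lambda>w. tsum U V x (\<lambda>u v. f u v w))"
      by (intro lin_tsum_body[OF sp(4)] trilinD[OF f])
  qed (rule tlift_tsum[OF b sp(1,4) that])
qed

lemma lin_tlift_left:
  "lin (tensor (tensor U V) W) Z (tlift (tensor U V) W (\<lambda>x w. tlift U V (\<lambda>u v. f u v w) x))"
  by (rule tensor_universal(1)[OF is_vspace_tensor sp(4) bilin_tlift_left])

lemma tlift_left_tens:
  assumes "u \<in> carr U" "v \<in> carr V" "w \<in> carr W"
  shows "tlift (tensor U V) W (\<lambda>x w. tlift U V (\<lambda>u v. f u v w) x)
    (tens (tensor U V) W (tens U V u v) w) = f u v w"
  using assms
  by (simp add: tensor_universal(2)[OF is_vspace_tensor sp(4) bilin_tlift_left] tens_in_tensor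
      tensor_universal(2)[OF sp(1,4) bilinI[OF trilinD(1,2)[OF f]]])

lemma bilin_tlift_right: "bilin U (tensor V W) Z (\<lambda>u y. tlift V W (f u) y)"
proof (rule bilinI)
  have b: "bilin V W Z (f u)" if "u \<in> carr U" for u
    using f that by (intro bilinI trilinD[OF f])
  show "lin (tensor V W) Z (tlift V W (f u))" if "u \<in> carr U" for u
    by (rule tensor_universal(1)[OF sp(2,4) b[OF that]])
  show "lin U Z (\<lambda>u. tlift V W (f u) y)" if "y \<in> carr (tensor V W)" for y
  proof (subst lin_cong[OF _ sp(1)])
    show "lin U Z (\<lambda>u. tsum V W y (f u))"
      by (intro lin_tsum_body[OF sp(4)] trilinD[OF f])
  qed (rule tlift_tsum[OF b sp(2,4) that])
qed

lemma lin_tlift_right: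
  "lin (tensor U (tensor V W)) Z (tlift U (tensor V W) (\<lambda>u y. tlift V W (f u) y))"
  by (rule tensor_universal(1)[OF sp(1,4) bilin_tlift_right])

lemma tlift_right_tens:
  assumes "u \<in> carr U" "v \<in> carr V" "w \<in> carr W"
  shows "tlift U (tensor V W) (\<lambda>u y. tlift V W (f u) y)
    (tens U (tensor V W) u (tens V W v w)) = f u v w"
  using assms
  by (simp add: tensor_universal(2)[OF sp(1,4) bilin_tlift_right] tens_in_tensor
      tensor_universal(2)[OF sp(2,4) bilinI[OF trilinD(2,3)[OF f]]])

end

context dual_quasi_bialg
begin

abbreviation csum :: "('k, 'v::ab_group_add, 'h, 'zz) comod_scheme \<Rightarrow> 'v \<Rightarrow> ('v \<Rightarrow> 'h \<Rightarrow> 'u::ab_group_add) \<Rightarrow> 'u"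
  where "csum V v \<equiv> tsum V H (coact V v)"

text \<open>
  The counit law is what turns a constraint with trivial scalar \<open>\<epsilon> \<otimes> \<epsilon>\<close> into the plain rebracketing,
  and it passes from two comodules to their tensor product.
\<close>

definition counital :: "('k, 'v::ab_group_add, 'h, 'zz) comod_scheme \<Rightarrow> bool" where
  "counital V \<longleftrightarrow> is_vspace V \<and> lin V (tensor V H) (coact V) \<and>
     (\<forall>v\<in>carr V. csum V v (\<lambda>v0 v1. scl V (\<epsilon> v1) v0) = v)"

lemma csw_csum:
  assumes "is_vspace V" "lin V (tensor V H) (coact V)" "is_vspace Z" "v \<in> carr V"
    "\<And>v0 v1. v0 \<in> carr V \<Longrightarrow> v1 \<in> carr H \<Longrightarrow> f v0 v1 = g v0 v1" "bilin V H Z g"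
  shows "csw H V v f = csum V v g"
proof -
  have "csw H V v f = csw H V v g"
    unfolding csw_def by (rule arg_cong[OF tlift_cong, THEN fun_cong]) (use assms(5) in auto)
  then show ?thesis
    using tlift_tsum[OF assms(6,1,3) lin_mem[OF assms(2,4)]] by (simp add: csw_def)
qed

lemma comodule_counital:
  assumes "comodule H V"
  shows "counital V"
proof -
  have V: "is_vspace V" "lin V (tensor V H) (coact V)" using assms by (auto simp: comodule_def)
  have "bilin V H V (\<lambda>v0 v1. scl V (\<epsilon> v1) v0)"
    by (auto intro!: lin_rules V)
  then show ?thesis
    using assms csw_csum[OF V V(1), where f = "\<lambda>v0 v1. scl V (\<epsilon> v1) v0", OF _ refl]
    by (simp add: counital_def comodule_def)
qed

lemma counitalD:
  assumes "counital V"
  shows "is_vspace V" "lin V (tensor V H) (coact V)"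
  using assms by (auto simp: counital_def)

lemma lin_csum_arg:
  assumes "bilin V H Z f" "counital V" "is_vspace Z" "lin U V g"
  shows "lin U Z (\<lambda>u. csum V (g u) f)"
  by (rule lin_tsum_arg[OF assms(1) counitalD(1)[OF assms(2)] assms(3)
        lin_comp[OF counitalD(2)[OF assms(2)] assms(4)]])

lemma csum_counit:
  assumes V: "counital V" and Z: "is_vspace Z" and f: "lin V Z f" and v: "v \<in> carr V"
  shows "csum V v (\<lambda>v0 v1. scl Z (\<epsilon> v1) (f v0)) = f v"
proof -
  note vV = counitalD(1)[OF V]
  have "f (csum V v (\<lambda>v0 v1. scl V (\<epsilon> v1) v0)) = csum V v (\<lambda>v0 v1. f (scl V (\<epsilon> v1) v0))"
    by (rule lin_tsum[OF f vV]) (auto intro: is_vspace_closed[OF vV])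
  moreover have "f (scl V c y) = scl Z c (f y)" if "y \<in> carr V" for c y
    using f that by (simp add: lin_def)
  ultimately show ?thesis using V v by (simp add: counital_def)
qed

lemma csum_counit2:
  assumes V: "counital V" and W: "counital W" and Z: "is_vspace Z" and f: "bilin V W Z f"
    and v: "v \<in> carr V" and w: "w \<in> carr W"
  shows "csum V v (\<lambda>v0 v1. csum W w (\<lambda>w0 w1. scl Z (\<epsilon> v1 * \<epsilon> w1) (f v0 w0))) = f v w"
proof -
  have "csum V v (\<lambda>v0 v1. csum W w (\<lambda>w0 w1. scl Z (\<epsilon> v1 * \<epsilon> w1) (f v0 w0))) =
      csum V v (\<lambda>v0 v1. scl Z (\<epsilon> v1) (csum W w (\<lambda>w0 w1. scl Z (\<epsilon> w1) (f v0 w0))))"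
    by (simp add: tsum_scl[OF Z] vspace_scale[OF Z])
  also have "\<dots> = csum V v (\<lambda>v0 v1. scl Z (\<epsilon> v1) (f v0 w))"
    by (simp add: csum_counit[OF W Z bilin_lin2[OF f] w])
  also have "\<dots> = f v w"
    by (rule csum_counit[OF V Z bilin_lin1[OF f w] v])
  finally show ?thesis .
qed

lemmas lin_rules' = lin_rules lin_tsum_body tsum_mem lin_csum_arg

context
  fixes U :: "('k, 'u::ab_group_add, 'h, 'x) comod_scheme"
    and V :: "('k, 'v::ab_group_add, 'h, 'y) comod_scheme"
    and W :: "('k, 'w::ab_group_add, 'h, 'zz) comod_scheme"
  assumes U: "counital U" and V: "counital V" and W: "counital W"
begin

private lemmas sp = counitalD[OF U] counitalD[OF V] counitalD[OF W]

lemma trilin_assoc: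
  "trilin U V W (tensor U (tensor V W)) (\<lambda>u v w. csum U u (\<lambda>u0 u1. csum V v (\<lambda>v0 v1. csum W w
     (\<lambda>w0 w1. scl (tensor U (tensor V W)) (phi H u1 v1 w1) (tens U (tensor V W) u0 (tens V W v0 w0))))))"
  by (auto intro!: trilinI lin_rules' U V W)

lemma trilin_assoc_inv:
  "trilin U V W (tensor (tensor U V) W) (\<lambda>u v w. csum U u (\<lambda>u0 u1. csum V v (\<lambda>v0 v1. csum W w
     (\<lambda>w0 w1. scl (tensor (tensor U V) W) (phi_inv H u1 v1 w1) (tens (tensor U V) W (tens U V u0 v0) w0)))))"
  by (auto intro!: trilinI lin_rules' U V W)

lemma assoc_eq:
  "assoc H U V W = tlift (tensor U V) W (\<lambda>x w. tlift U V (\<lambda>u v.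
     csum U u (\<lambda>u0 u1. csum V v (\<lambda>v0 v1. csum W w
     (\<lambda>w0 w1. scl (tensor U (tensor V W)) (phi H u1 v1 w1) (tens U (tensor V W) u0 (tens V W v0 w0)))))) x)"
  unfolding assoc_def
  by (intro tlift_cong fun_cong[OF tlift_cong] csw_csum[OF sp(1,2) is_vspace_tensor]
      csw_csum[OF sp(3,4) is_vspace_tensor] csw_csum[OF sp(5,6) is_vspace_tensor] refl)
    (auto intro!: lin_rules' U V W)

lemma assoc_inv_eq:
  "assoc_inv H U V W = tlift U (tensor V W) (\<lambda>u y. tlift V W (\<lambda>v w.
     csum U u (\<lambda>u0 u1. csum V v (\<lambda>v0 v1. csum W w
     (\<lambda>w0 w1. scl (tensor (tensor U V) W) (phi_inv H u1 v1 w1) (tens (tensor U V) W (tens U V u0 v0) w0))))) y)"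
  unfolding assoc_inv_def
  by (intro tlift_cong fun_cong[OF tlift_cong] csw_csum[OF sp(1,2) is_vspace_tensor]
      csw_csum[OF sp(3,4) is_vspace_tensor] csw_csum[OF sp(5,6) is_vspace_tensor] refl)
    (auto intro!: lin_rules' U V W)

lemma lin_assoc: "lin (tensor (tensor U V) W) (tensor U (tensor V W)) (assoc H U V W)"
  unfolding assoc_eq by (rule lin_tlift_left[OF sp(1,3,5) is_vspace_tensor trilin_assoc])

lemma lin_assoc_inv: "lin (tensor U (tensor V W)) (tensor (tensor U V) W) (assoc_inv H U V W)"
  unfolding assoc_inv_eq by (rule lin_tlift_right[OF sp(1,3,5) is_vspace_tensor trilin_assoc_inv])

lemma assoc_tens:
  assumes "u \<in> carr U" "v \<in> carr V" "w \<in> carr W"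
  shows "assoc H U V W (tens (tensor U V) W (tens U V u v) w) =
    csum U u (\<lambda>u0 u1. csum V v (\<lambda>v0 v1. csum W w (\<lambda>w0 w1.
      scl (tensor U (tensor V W)) (phi H u1 v1 w1) (tens U (tensor V W) u0 (tens V W v0 w0)))))"
  unfolding assoc_eq by (rule tlift_left_tens[OF sp(1,3,5) is_vspace_tensor trilin_assoc assms])

lemma assoc_inv_tens:
  assumes "u \<in> carr U" "v \<in> carr V" "w \<in> carr W"
  shows "assoc_inv H U V W (tens U (tensor V W) u (tens V W v w)) =
    csum U u (\<lambda>u0 u1. csum V v (\<lambda>v0 v1. csum W w (\<lambda>w0 w1.
      scl (tensor (tensor U V) W) (phi_inv H u1 v1 w1) (tens (tensor U V) W (tens U V u0 v0) w0))))"
  unfolding assoc_inv_eq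
  by (rule tlift_right_tens[OF sp(1,3,5) is_vspace_tensor trilin_assoc_inv assms])

end

definition trivial_coact :: "('k, 'v::ab_group_add, 'h, 'zz) comod_scheme \<Rightarrow> bool" where
  "trivial_coact V \<longleftrightarrow> (\<forall>v\<in>carr V. coact V v = tens V H v (one H))"

lemma csum_trivial:
  assumes "trivial_coact V" "is_vspace V" "is_vspace Z" "bilin V H Z f" "v \<in> carr V"
  shows "csum V v f = f v (one H)"
  using assms(1,5) tsum_tens[OF assms(4,2,3,5) one_carr] by (simp add: trivial_coact_def)

text \<open>
  A factor with trivial coaction puts \<open>1\<close> into one of the slots of \<open>\<phi>\<close>, which leaves the counits of
  the other two.
\<close>

lemma assoc_trivial:
  assumes U: "counital U" and V: "counital V" and W: "counital W"
    and triv: "trivial_coact U \<or> trivial_coact W"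
    and m: "u \<in> carr U" "v \<in> carr V" "w \<in> carr W"
  shows "assoc H U V W (tens (tensor U V) W (tens U V u v) w) = tens U (tensor V W) u (tens V W v w)"
  using triv
proof
  assume t: "trivial_coact U"
  have "assoc H U V W (tens (tensor U V) W (tens U V u v) w) = csum V v (\<lambda>v0 v1. csum W w (\<lambda>w0 w1.
      scl (tensor U (tensor V W)) (phi H (one H) v1 w1) (tens U (tensor V W) u (tens V W v0 w0))))"
    unfolding assoc_tens[OF U V W m]
    by (rule csum_trivial[OF t counitalD(1)[OF U] is_vspace_tensor _ m(1)])
      (auto intro!: lin_rules' U V W m)
  also have "\<dots> = csum V v (\<lambda>v0 v1. csum W w (\<lambda>w0 w1.
      scl (tensor U (tensor V W)) (\<epsilon> v1 * \<epsilon> w1) (tens U (tensor V W) u (tens V W v0 w0))))"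
    by (simp add: phi_one_left)
  also have "\<dots> = tens U (tensor V W) u (tens V W v w)"
    by (rule csum_counit2[OF V W is_vspace_tensor _ m(2,3)]) (auto intro!: lin_rules' m)
  finally show ?thesis .
next
  assume t: "trivial_coact W"
  have "assoc H U V W (tens (tensor U V) W (tens U V u v) w) = csum U u (\<lambda>u0 u1. csum V v (\<lambda>v0 v1.
      scl (tensor U (tensor V W)) (phi H u1 v1 (one H)) (tens U (tensor V W) u0 (tens V W v0 w))))"
    unfolding assoc_tens[OF U V W m]
    by (intro tsum_cong refl csum_trivial[OF t counitalD(1)[OF W] is_vspace_tensor _ m(3)])
      (auto intro!: lin_rules' U V W m)
  also have "\<dots> = csum U u (\<lambda>u0 u1. csum V v (\<lambda>v0 v1.
      scl (tensor U (tensor V W)) (\<epsilon> u1 * \<epsilon> v1) (tens U (tensor V W) u0 (tens V W v0 w))))"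
    by (simp add: phi_one_right)
  also have "\<dots> = tens U (tensor V W) u (tens V W v w)"
    by (rule csum_counit2[OF U V is_vspace_tensor _ m(1,2)]) (auto intro!: lin_rules' m)
  finally show ?thesis .
qed

lemma assoc_inv_trivial:
  assumes U: "counital U" and V: "counital V" and W: "counital W"
    and triv: "trivial_coact U \<or> trivial_coact V"
    and m: "u \<in> carr U" "v \<in> carr V" "w \<in> carr W"
  shows "assoc_inv H U V W (tens U (tensor V W) u (tens V W v w)) =
    tens (tensor U V) W (tens U V u v) w"
  using triv
proof
  assume t: "trivial_coact U"
  have "assoc_inv H U V W (tens U (tensor V W) u (tens V W v w)) = csum V v (\<lambda>v0 v1. csum W w (\<lambda>w0 w1.
      scl (tensor (tensor U V) W) (phi_inv H (one H) v1 w1) (tens (tensor U V) W (tens U V u v0) w0)))"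
    unfolding assoc_inv_tens[OF U V W m]
    by (rule csum_trivial[OF t counitalD(1)[OF U] is_vspace_tensor _ m(1)])
      (auto intro!: lin_rules' U V W m)
  also have "\<dots> = csum V v (\<lambda>v0 v1. csum W w (\<lambda>w0 w1.
      scl (tensor (tensor U V) W) (\<epsilon> v1 * \<epsilon> w1) (tens (tensor U V) W (tens U V u v0) w0)))"
    by (simp add: phi_inv_one_left)
  also have "\<dots> = tens (tensor U V) W (tens U V u v) w"
    by (rule csum_counit2[OF V W is_vspace_tensor _ m(2,3)]) (auto intro!: lin_rules' m)
  finally show ?thesis .
next
  assume t: "trivial_coact V"
  have "assoc_inv H U V W (tens U (tensor V W) u (tens V W v w)) = csum U u (\<lambda>u0 u1. csum W w (\<lambda>w0 w1.
      scl (tensor (tensor U V) W) (phi_inv H u1 (one H) w1) (tens (tensor U V) W (tens U V u0 v) w0)))"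
    unfolding assoc_inv_tens[OF U V W m]
    by (intro tsum_cong refl csum_trivial[OF t counitalD(1)[OF V] is_vspace_tensor _ m(2)])
      (auto intro!: lin_rules' U V W m)
  also have "\<dots> = csum U u (\<lambda>u0 u1. csum W w (\<lambda>w0 w1.
      scl (tensor (tensor U V) W) (\<epsilon> u1 * \<epsilon> w1) (tens (tensor U V) W (tens U V u0 v) w0)))"
    by (simp add: phi_inv_one_mid)
  also have "\<dots> = tens (tensor U V) W (tens U V u v) w"
    by (rule csum_counit2[OF U W is_vspace_tensor _ m(1,3)]) (auto intro!: lin_rules' m)
  finally show ?thesis .
qed

context
  fixes V :: "('k, 'v::ab_group_add, 'h, 'y) comod_scheme"
    and W :: "('k, 'w::ab_group_add, 'h, 'zz) comod_scheme"
  assumes V: "counital V" and W: "counital W"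
begin

private lemmas spc = counitalD[OF V] counitalD[OF W]

lemma bilin_coact_tensor: "bilin V W (tensor (tensor V W) H) (\<lambda>v w. csum V v (\<lambda>v0 v1. csum W w
    (\<lambda>w0 w1. tens (tensor V W) H (tens V W v0 w0) (mul H v1 w1))))"
  by (auto intro!: lin_rules' V W)

lemma coact_tensor_eq: "coact (tensor_comod H V W) = tlift V W (\<lambda>v w. csum V v (\<lambda>v0 v1. csum W w
    (\<lambda>w0 w1. tens (tensor V W) H (tens V W v0 w0) (mul H v1 w1))))"
  unfolding tensor_comod_def comod.simps
  by (intro tlift_cong csw_csum[OF spc(1,2) is_vspace_tensor] csw_csum[OF spc(3,4) is_vspace_tensor] refl)
    (auto intro!: lin_rules' V W)

lemma lin_coact_tensor: "lin (tensor V W) (tensor (tensor V W) H) (coact (tensor_comod H V W))"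
  unfolding coact_tensor_eq
  by (rule tensor_universal(1)[OF spc(1) is_vspace_tensor bilin_coact_tensor])

lemma coact_tensor:
  assumes "v \<in> carr V" "w \<in> carr W"
  shows "coact (tensor_comod H V W) (tens V W v w) =
    csum V v (\<lambda>v0 v1. csum W w (\<lambda>w0 w1. tens (tensor V W) H (tens V W v0 w0) (mul H v1 w1)))"
  unfolding coact_tensor_eq
  by (rule tensor_universal(2)[OF spc(1) is_vspace_tensor bilin_coact_tensor assms])

lemma csum_tensor:
  assumes Z: "is_vspace Z" and f: "bilin (tensor V W) H Z f" and m: "v \<in> carr V" "w \<in> carr W"
  shows "tsum (tensor V W) H (coact (tensor_comod H V W) (tens V W v w)) f =
    csum V v (\<lambda>v0 v1. csum W w (\<lambda>w0 w1. f (tens V W v0 w0) (mul H v1 w1)))"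
proof -
  let ?T = "tensor V W"
  have L: "lin (tensor ?T H) Z (tlift ?T H f)"
    by (rule tensor_universal(1)[OF is_vspace_tensor Z f])
  have "tsum ?T H (coact (tensor_comod H V W) (tens V W v w)) f =
      tlift ?T H f (coact (tensor_comod H V W) (tens V W v w))"
    by (rule tlift_tsum[OF f is_vspace_tensor Z lin_mem[OF lin_coact_tensor], symmetric])
      (rule tens_in_tensor[OF m])
  also have "\<dots> = csum V v (\<lambda>v0 v1. csum W w (\<lambda>w0 w1.
      tlift ?T H f (tens ?T H (tens V W v0 w0) (mul H v1 w1))))"
    unfolding coact_tensor[OF m]
    by (subst lin_tsum[OF L is_vspace_tensor]; (intro tsum_cong refl lin_tsum[OF L is_vspace_tensor])?;
        auto intro!: tsum_mem tens_in_tensor)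
  also have "\<dots> = csum V v (\<lambda>v0 v1. csum W w (\<lambda>w0 w1. f (tens V W v0 w0) (mul H v1 w1)))"
    by (auto intro!: tsum_cong tensor_universal(2)[OF is_vspace_tensor Z f] tens_in_tensor)
  finally show ?thesis .
qed

lemma counital_tensor: "counital (tensor_comod H V W)"
proof -
  let ?T = "tensor V W"
  have "tsum ?T H (coact (tensor_comod H V W) x) (\<lambda>v0 v1. scl ?T (\<epsilon> v1) v0) = x" if "x \<in> carr ?T" for x
  proof (rule tensor_ext[where G = "\<lambda>x. x", OF _ lin_ident spc(1) _ that])
    show "lin ?T ?T (\<lambda>x. tsum ?T H (coact (tensor_comod H V W) x) (\<lambda>v0 v1. scl ?T (\<epsilon> v1) v0))"
      by (auto intro!: lin_tsum_arg lin_coact_tensor lin_rules')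
    fix v w assume m: "v \<in> carr V" "w \<in> carr W"
    have "tsum ?T H (coact (tensor_comod H V W) (tens V W v w)) (\<lambda>v0 v1. scl ?T (\<epsilon> v1) v0) =
        csum V v (\<lambda>v0 v1. csum W w (\<lambda>w0 w1. scl ?T (\<epsilon> (mul H v1 w1)) (tens V W v0 w0)))"
      by (rule csum_tensor[OF is_vspace_tensor _ m]) (auto intro!: lin_rules')
    also have "\<dots> = csum V v (\<lambda>v0 v1. csum W w (\<lambda>w0 w1. scl ?T (\<epsilon> v1 * \<epsilon> w1) (tens V W v0 w0)))"
      by (simp add: counit_mul)
    also have "\<dots> = tens V W v w"
      by (rule csum_counit2[OF V W is_vspace_tensor bilin_tens m])
    finally show "tsum ?T H (coact (tensor_comod H V W) (tens V W v w)) (\<lambda>v0 v1. scl ?T (\<epsilon> v1) v0) = \<dots>" .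
  qed
  then show ?thesis
    by (simp add: counital_def lin_coact_tensor)
qed

end

end

section \<open>Crossed systems as convolution identities\<close>

locale crossed_data = dual_quasi_bialg H
  for H :: "('k::field, 'h::ab_group_add) dqb" +
  fixes A :: "('k, 'a::ab_group_add) alg"
    and act :: "('h, 'a, 'k) tensor \<Rightarrow> 'a"
    and \<tau> :: "('h, 'h, 'k) tensor \<Rightarrow> 'a"
  assumes alg: "k_algebra A"
    and lin_act: "lin (tensor H A) A act"
    and lin_tau: "lin H2 A \<tau>"
begin

abbreviation "AH \<equiv> tensor A H"
abbreviation "m \<equiv> times_alg A"
abbreviation "e \<equiv> one_alg A"
abbreviation dot :: "'h \<Rightarrow> 'a \<Rightarrow> 'a" where "dot h a \<equiv> act (tens H A h a)"
abbreviation ta :: "'h \<Rightarrow> 'h \<Rightarrow> 'a" where "ta h g \<equiv> \<tau> (t2 h g)"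
abbreviation scr :: "'a \<Rightarrow> 'k \<Rightarrow> 'a" where "scr a c \<equiv> scl A c a"

lemma vspace_A [simp]: "is_vspace A"
  and bilin_m: "bilin A A A m"
  and e_carr [simp]: "e \<in> carr A"
  and m_assoc: "a \<in> carr A \<Longrightarrow> b \<in> carr A \<Longrightarrow> c \<in> carr A \<Longrightarrow> m (m a b) c = m a (m b c)"
  and m_one [simp]: "a \<in> carr A \<Longrightarrow> m e a = a" "a \<in> carr A \<Longrightarrow> m a e = a"
  using alg by (auto simp: k_algebra_def)

lemma m_carr [simp]: "a \<in> carr A \<Longrightarrow> b \<in> carr A \<Longrightarrow> m a b \<in> carr A"
  by (rule bilin_mem[OF bilin_m])

lemma scl_carr [simp]: "a \<in> carr A \<Longrightarrow> scl A c a \<in> carr A"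
  by (rule is_vspace_closed(3)[OF vspace_A])

lemma dot_carr [simp]: "h \<in> carr H \<Longrightarrow> a \<in> carr A \<Longrightarrow> dot h a \<in> carr A"
  by (rule lin_mem[OF lin_act tens_in_tensor])

lemma ta_carr [simp]: "h \<in> carr H \<Longrightarrow> g \<in> carr H \<Longrightarrow> ta h g \<in> carr A"
  by (rule lin_mem[OF lin_tau tens_in_tensor])

declare tens_in_tensor [simp]

text \<open>
  The left \<open>A\<close>-module structure of \<open>A \<otimes> H\<close>.  In every composite of the wreath axioms, \<open>m\<^sub>A \<otimes> X\<close>
  acts through it.
\<close>

definition lact :: "'a \<Rightarrow> ('a, 'h, 'k) tensor \<Rightarrow> ('a, 'h, 'k) tensor" where
  "lact a = tlift A H (\<lambda>b h. tens A H (m a b) h)"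

lemma trilin_lact: "trilin A A H AH (\<lambda>a b h. tens A H (m a b) h)"
  by (auto intro!: trilinI lin_bilin1[OF bilin_tens] lin_bilin2[OF bilin_tens]
      lin_bilin1[OF bilin_m] lin_bilin2[OF bilin_m] lin_ident)

lemma bilin_lact: "bilin A AH AH lact"
  unfolding lact_def
  using bilin_tlift_right[OF vspace_A vspace_A vspace_H is_vspace_tensor trilin_lact] .

lemma lact_tens [simp]:
  "a \<in> carr A \<Longrightarrow> b \<in> carr A \<Longrightarrow> h \<in> carr H \<Longrightarrow> lact a (tens A H b h) = tens A H (m a b) h"
  unfolding lact_def
  by (rule tensor_universal(2)[OF vspace_A is_vspace_tensor bilinI[OF trilinD(2,3)[OF trilin_lact]]])

lemma lact_carr [simp]: "a \<in> carr A \<Longrightarrow> y \<in> carr AH \<Longrightarrow> lact a y \<in> carr AH"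
  by (rule bilin_mem[OF bilin_lact])

lemma lact_ssum:
  "a \<in> carr A \<Longrightarrow> (\<And>x1 x2. x1 \<in> carr C \<Longrightarrow> x2 \<in> carr C \<Longrightarrow> f x1 x2 \<in> carr AH) \<Longrightarrow>
    lact a (ssum C x f) = ssum C x (\<lambda>x1 x2. lact a (f x1 x2))"
  using lin_ssum[OF bilin_lin2[OF bilin_lact] is_vspace_tensor] by blast

lemma lact_mult:
  assumes "a \<in> carr A" "b \<in> carr A" "y \<in> carr AH"
  shows "lact a (lact b y) = lact (m a b) y"
  by (rule tensor_ext[OF _ _ vspace_A _ assms(3)])
    (use assms in \<open>auto intro!: lin_bilin2[OF bilin_lact] lin_ident simp: m_assoc\<close>)

lemma lact_one: "y \<in> carr AH \<Longrightarrow> lact e y = y"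
  by (rule tensor_ext[where G = "\<lambda>x. x", OF _ lin_ident vspace_A])
    (auto intro!: lin_bilin2[OF bilin_lact] lin_ident)

lemmas lin_A_rules = lin_comp[OF lin_act] lin_comp[OF lin_tau] lin_bilin1[OF bilin_m] lin_bilin2[OF bilin_m]
  lin_bilin1[OF bilin_lact] lin_bilin2[OF bilin_lact] lin_tau lin_act

lemmas lin_all = lin_rules' lin_A_rules trilinI

subsection \<open>Convolution with values in the algebra\<close>

context
  fixes C :: "('k, 'c::ab_group_add, 'z) coalg_scheme"
  assumes C: "coalgebra C"
begin

lemma lin_cv_m: "lin C A F \<Longrightarrow> lin C A G \<Longrightarrow> lin C A (cv C m F G)"
  by (rule lin_cv[OF C vspace_A _ _ bilin_m])

lemma lin_cv_tens: "lin C A F \<Longrightarrow> lin C H p \<Longrightarrow> lin C AH (cv C (tens A H) F p)"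
  by (rule lin_cv[OF C is_vspace_tensor _ _ bilin_tens])

lemma lin_cv_scr: "lin C A F \<Longrightarrow> lin C k_space f \<Longrightarrow> lin C A (cv C scr F f)"
  by (rule lin_cv[OF C vspace_A _ _ bilin_scl_right[OF vspace_A]])

lemma cv_m_assoc:
  assumes "x \<in> carr C" "lin C A F" "lin C A G" "lin C A K"
  shows "cv C m (cv C m F G) K x = cv C m F (cv C m G K) x"
  by (rule cv_assoc[OF C assms(1) vspace_A vspace_A vspace_A assms(2-4) bilin_m bilin_m bilin_m bilin_m])
    (rule m_assoc)

text \<open>
  Acting by \<open>F(x\<^sub>1)\<close> from the left changes only the coefficient in \<open>A\<close>, which becomes a convolution
  product.
\<close>

lemma cv_lact_tens:
  assumes "x \<in> carr C" "lin C A F" "lin C A G" "lin C H p"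
  shows "cv C lact F (cv C (tens A H) G p) x = cv C (tens A H) (cv C m F G) p x"
  by (rule cv_assoc[OF C assms(1) is_vspace_tensor vspace_A is_vspace_tensor assms(2-4)
        bilin_m bilin_tens bilin_tens bilin_lact, symmetric]) simp

lemma cv_scr_assoc:
  assumes "x \<in> carr C" "lin C A F" "lin C A G" "lin C k_space f"
  shows "cv C scr (cv C m F G) f x = cv C m F (cv C scr G f) x"
proof (rule cv_assoc[OF C assms(1) vspace_A vspace_A vspace_A assms(2-4) bilin_m
        bilin_scl_right[OF vspace_A] bilin_scl_right[OF vspace_A] bilin_m])
  fix u v and w :: 'k assume "u \<in> carr A" "v \<in> carr A"
  then show "scr (m u v) w = m u (scr v w)"
    using bilin_lin2[OF bilin_m] by (simp add: lin_def)
qed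

lemma cv_scr_scr:
  assumes "x \<in> carr C" "lin C A F" "lin C k_space f" "lin C k_space g"
  shows "cv C scr (cv C scr F f) g x = cv C scr F (cv C (*) f g) x"
  by (rule cv_assoc[OF C assms(1) vspace_A vspace_A is_vspace_k_space assms(2-4)
        bilin_scl_right[OF vspace_A] bilin_scl_right[OF vspace_A] bilin_times_k bilin_scl_right[OF vspace_A]])
    (simp add: vspace_scale mult.commute)

lemma cv_unit:
  assumes "x \<in> carr C" "lin C A F"
  shows "cv C m (\<lambda>c. scl A (counit C c) e) F x = F x"
proof -
  have "cv C m (\<lambda>c. scl A (counit C c) e) F x = cv C (scl A) (counit C) F x"
    unfolding cv_def
  proof (intro ssum_cong refl)
    fix x1 x2 assume "x1 \<in> carr C" "x2 \<in> carr C"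
    then show "m (scl A (counit C x1) e) (F x2) = scl A (counit C x1) (F x2)"
      using bilin_lin1[OF bilin_m, of "F x2"] lin_mem[OF assms(2)] by (simp add: lin_def)
  qed
  then show ?thesis using cv_counit(1)[OF C assms(1) vspace_A assms(2)] by simp
qed

text \<open>
  Applying \<open>\<epsilon>\<close> to the \<open>H\<close>-component of \<open>F(x\<^sub>1) \<otimes> p(x\<^sub>2)\<close> recovers \<open>F\<close>, since \<open>\<epsilon> \<circ> p = \<epsilon>\<close>.  This
  cancellation is how an identity in \<open>A\<close> is read off from a wreath axiom.
\<close>

lemma cv_tens_eq_iff:
  assumes p: "coalgebra_hom C H p" and F: "lin C A F" and G: "lin C A G"
  shows "(\<forall>x\<in>carr C. cv C (tens A H) F p x = cv C (tens A H) G p x) \<longleftrightarrow> (\<forall>x\<in>carr C. F x = G x)"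
proof -
  have lp: "lin C H p" and ep: "\<And>x. x \<in> carr C \<Longrightarrow> \<epsilon> (p x) = counit C x"
    using p by (auto simp: coalgebra_hom_def)
  let ?E = "tlift A H (\<lambda>a h. scl A (\<epsilon> h) a)"
  have b: "bilin A H A (\<lambda>a h. scl A (\<epsilon> h) a)"
    by (auto intro!: lin_all)
  note E = tensor_universal[OF vspace_A vspace_A b]
  have "?E (cv C (tens A H) F p x) = F x" if "lin C A F" "x \<in> carr C" for F x
  proof -
    have "?E (cv C (tens A H) F p x) = cv C (\<lambda>a h. ?E (tens A H a h)) F p x"
      by (rule cv_lin[OF E(1) is_vspace_tensor that(1) lp bilin_tens])
    also have "\<dots> = cv C scr F (counit C) x"
      unfolding cv_def using lin_mem[OF lp] lin_mem[OF that(1)]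
      by (intro ssum_cong refl) (simp add: E(2) ep)
    also have "\<dots> = F x"
      by (rule cv_counit(2)[OF C that(2) vspace_A that(1)])
    finally show ?thesis .
  qed
  with F G have "F x = G x" if "\<forall>x\<in>carr C. cv C (tens A H) F p x = cv C (tens A H) G p x" "x \<in> carr C" for x
    using that by metis
  moreover have "cv C (tens A H) F p x = cv C (tens A H) G p x" if "\<forall>x\<in>carr C. F x = G x" for x
    using that by (intro cv_cong) auto
  ultimately show ?thesis by blast
qed

lemma cv_unit_tens:
  assumes p: "lin C H p" and x: "x \<in> carr C"
  shows "cv C (tens A H) (\<lambda>c. scl A (counit C c) e) p x = tens A H e (p x)"
proof -
  have "cv C (tens A H) (\<lambda>c. scl A (counit C c) e) p x =
      ssum C x (\<lambda>x1 x2. scl AH (counit C x1) (tens A H e (p x2)))"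
    unfolding cv_def using lin_mem[OF p] by (intro ssum_cong refl) (simp add: scl_tens)
  also have "\<dots> = tens A H e (p x)"
    by (rule ssum_counit(1)[OF C x is_vspace_tensor]) (auto intro!: lin_all p)
  finally show ?thesis .
qed

end

end

subsection \<open>Coalgebra maps between tensor powers\<close>

lemma coalgebra_hom_id: "coalgebra C \<Longrightarrow> coalgebra_hom C C (\<lambda>x. x)"
proof (rule coalgebra_homI)
  assume C: "coalgebra C"
  show "comul C x = ssum C x (\<lambda>x1 x2. tens C C x1 x2)" if "x \<in> carr C" for x
    unfolding ssum_def
    by (rule tsum_of_tens[OF coalgebraD(1)[OF C] lin_mem[OF coalgebraD(2)[OF C] that], symmetric])
qed (simp_all add: lin_ident)

lemma coalgebra_hom_comp:
  assumes "coalgebra_hom C D r" "coalgebra_hom D E s" "coalgebra C" "coalgebra D"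
  shows "coalgebra_hom C E (\<lambda>x. s (r x))"
proof (rule coalgebra_homI[OF assms(3)])
  have r: "lin C D r" and s: "lin D E s" using assms(1,2) by (auto simp: coalgebra_hom_def)
  show "lin C E (\<lambda>x. s (r x))" by (rule lin_comp[OF s r])
  fix x assume x: "x \<in> carr C"
  have rx: "r x \<in> carr D" by (rule lin_mem[OF r x])
  have "comul E (s (r x)) = ssum D (r x) (\<lambda>y1 y2. tens E E (s y1) (s y2))"
    using assms(2) rx sw_ssum[OF coalgebraD(1,2)[OF assms(4)] rx is_vspace_tensor bilin_tmap[OF s s]]
    by (simp add: coalgebra_hom_def)
  also have "\<dots> = ssum C x (\<lambda>x1 x2. tens E E (s (r x1)) (s (r x2)))"
    by (rule ssum_coalgebra_hom[OF assms(1,4) is_vspace_tensor assms(3) x bilin_tmap[OF s s]])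
  finally show "comul E (s (r x)) = ssum C x (\<lambda>x1 x2. tens E E (s (r x1)) (s (r x2)))" .
  show "counit E (s (r x)) = counit C x"
    using assms(1,2) x rx by (simp add: coalgebra_hom_def)
qed

lemma coalgebra_hom_drop:
  assumes C: "coalgebra C" and D: "coalgebra D"
  shows "coalgebra_hom (tensor_coalg C D) C (tlift C D (\<lambda>c d. scl C (counit D d) c))"
    (is "coalgebra_hom ?T C ?r")
proof (rule coalgebra_homI[OF coalgebra_tensor[OF C D]])
  note vC = coalgebraD(1)[OF C] and vD = coalgebraD(1)[OF D] and eD = coalgebraD(3)[OF D]
  have b: "bilin C D C (\<lambda>c d. scl C (counit D d) c)"
    by (auto intro!: bilinI lin_bilin1[OF bilin_scl] lin_bilin2[OF bilin_scl] vC eD lin_ident)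
  note l = tensor_universal(1)[OF vC vC b] and t = tensor_universal(2)[OF vC vC b]
  show "lin ?T C ?r" using l by simp
  have "\<forall>x\<in>carr (tensor C D). comul C (?r x) = cv ?T (tens C C) ?r ?r x"
  proof (subst tensor_eq_iff[where Z = "tensor C C"])
    show "lin (tensor C D) (tensor C C) (\<lambda>x. comul C (?r x))"
      by (rule lin_comp[OF coalgebraD(2)[OF C] l])
    show "lin (tensor C D) (tensor C C) (cv ?T (tens C C) ?r ?r)"
      using lin_cv[OF coalgebra_tensor[OF C D] is_vspace_tensor _ _ bilin_tens, of C ?r C ?r] l by simp
    show "\<forall>c\<in>carr C. \<forall>d\<in>carr D. comul C (?r (tens C D c d)) = cv ?T (tens C C) ?r ?r (tens C D c d)"
    proof (intro ballI)
      fix c d assume m: "c \<in> carr C" "d \<in> carr D"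
      have "cv ?T (tens C C) ?r ?r (tens C D c d) = ssum C c (\<lambda>c1 c2. ssum D d (\<lambda>d1 d2.
          tens C C (scl C (counit D d1) c1) (scl C (counit D d2) c2)))"
        unfolding cv_def
        by (subst ssum_tensor[OF C D is_vspace_tensor m bilin_cv_body[OF l l bilin_tens]]) (simp add: t)
      also have "\<dots> = ssum C c (\<lambda>c1 c2. ssum D d (\<lambda>d1 d2.
          scl (tensor C C) (counit D d1) (tens C C c1 (scl C (counit D d2) c2))))"
        by (simp add: scl_tens is_vspace_closed[OF vC])
      also have "\<dots> = ssum C c (\<lambda>c1 c2. tens C C c1 (scl C (counit D d) c2))"
        by (intro ssum_cong refl ssum_counit(1)[OF D m(2) is_vspace_tensor])
          (auto intro!: lin_bilin2[OF bilin_tens] lin_bilin1[OF bilin_scl] eD vC)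
      also have "\<dots> = ssum C c (\<lambda>c1 c2. scl (tensor C C) (counit D d) (tens C C c1 c2))"
        using bilin_lin2[OF bilin_tens[of C C]] by (intro ssum_cong refl) (simp add: lin_def)
      also have "\<dots> = scl (tensor C C) (counit D d) (ssum C c (tens C C))"
        by (simp add: scl_ssum)
      also have "\<dots> = scl (tensor C C) (counit D d) (comul C c)"
        unfolding ssum_def using lin_mem[OF coalgebraD(2)[OF C] m(1)]
        by (simp add: tsum_of_tens[OF vC])
      also have "\<dots> = comul C (?r (tens C D c d))"
        using coalgebraD(2)[OF C] m by (simp add: t lin_def)
      finally show "comul C (?r (tens C D c d)) = cv ?T (tens C C) ?r ?r (tens C D c d)" by simp
    qed
  qed (rule vC)
  then show "comul C (?r x) = ssum ?T x (\<lambda>x1 x2. tens C C (?r x1) (?r x2))" if "x \<in> carr ?T" for x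
    using that by (simp add: cv_def)
  have "\<forall>x\<in>carr (tensor C D). counit C (?r x) = counit ?T x"
    using lin_scl[OF coalgebraD(3)[OF C]]
    by (subst tensor_eq_iff[where Z = k_space])
      (auto intro!: lin_comp[OF coalgebraD(3)[OF C]] l vC simp: t counit_tensor[OF C D]
        lin_counit_tensor[OF C D] mult.commute)
  then show "counit C (?r x) = counit ?T x" if "x \<in> carr ?T" for x
    using that by simp
qed

context dual_quasi_bialg
begin

definition lift3 :: "('h \<Rightarrow> 'h \<Rightarrow> 'h \<Rightarrow> 'u::ab_group_add) \<Rightarrow> (('h, 'h, 'k) tensor, 'h, 'k) tensor \<Rightarrow> 'u" where
  "lift3 f = tlift H2 H (\<lambda>x l. tlift H H (\<lambda>h g. f h g l) x)"

lemma lin_lift3: "trilin H H H Z f \<Longrightarrow> is_vspace Z \<Longrightarrow> lin H3 Z (lift3 f)"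
  unfolding lift3_def by (rule lin_tlift_left) simp_all

lemma lift3_tens:
  assumes "trilin H H H Z f" "is_vspace Z" "h \<in> carr H" "g \<in> carr H" "l \<in> carr H"
  shows "lift3 f (t3 h g l) = f h g l"
  unfolding lift3_def by (rule tlift_left_tens) (use assms in simp_all)

lemma cv_HH_tens:
  assumes "lin H2 U f" "lin H2 V g" "bilin U V Z op" "is_vspace Z"
    "a \<in> carr H" "b \<in> carr H"
  shows "cv HH op f g (t2 a b) =
    ssum H a (\<lambda>a1 a2. ssum H b (\<lambda>b1 b2. op (f (t2 a1 b1)) (g (t2 a2 b2))))"
  unfolding cv_def
  by (rule ssum_HH[OF assms(4) _ assms(5,6)]) (use assms in \<open>auto intro: bilin_cv_body\<close>)

lemma cv_HHH_tens:
  assumes "lin H3 U f" "lin H3 V g" "bilin U V Z op"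
    "is_vspace Z" "a \<in> carr H" "b \<in> carr H" "c \<in> carr H"
  shows "cv HHH op f g (t3 a b c) =
    ssum H a (\<lambda>a1 a2. ssum H b (\<lambda>b1 b2. ssum H c (\<lambda>c1 c2.
      op (f (t3 a1 b1 c1)) (g (t3 a2 b2 c2)))))"
  unfolding cv_def
  by (rule ssum_HHH[OF assms(4) _ assms(5-7)]) (use assms in \<open>auto intro: bilin_cv_body\<close>)

text \<open>
  A trilinear map is a map on \<open>(H \<otimes> H) \<otimes> H\<close>, whose comultiplication splits the three arguments
  independently.
\<close>

lemma coalgebra_hom_lift3:
  assumes D: "coalgebra D" and f: "trilin H H H D f"
    and comul: "\<And>h g l. h \<in> carr H \<Longrightarrow> g \<in> carr H \<Longrightarrow> l \<in> carr H \<Longrightarrow> comul D (f h g l) =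
      ssum H h (\<lambda>h1 h2. ssum H g (\<lambda>g1 g2. ssum H l (\<lambda>l1 l2. tens D D (f h1 g1 l1) (f h2 g2 l2))))"
    and counit: "\<And>h g l. h \<in> carr H \<Longrightarrow> g \<in> carr H \<Longrightarrow> l \<in> carr H \<Longrightarrow>
      counit D (f h g l) = \<epsilon> h * \<epsilon> g * \<epsilon> l"
  shows "coalgebra_hom HHH D (lift3 f)"
proof (rule coalgebra_homI)
  note vD = coalgebraD(1)[OF D] and cD = coalgebraD(2)[OF D] and eD = coalgebraD(3)[OF D]
  note l = lin_lift3[OF f vD] and t = lift3_tens[OF f vD]
  show "lin HHH D (lift3 f)" using l by simp
  have "\<forall>x\<in>carr H3. comul D (lift3 f x) =
      cv HHH (tens D D) (lift3 f) (lift3 f) x"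
    by (subst tensor_left_eq_iff[where Z = "tensor D D"])
      (auto intro!: lin_comp[OF cD] l lin_cv[OF coalg_HHH is_vspace_tensor _ _ bilin_tens, simplified]
        simp: cv_HHH_tens[OF l l bilin_tens is_vspace_tensor] t comul)
  then show "comul D (lift3 f x) = ssum HHH x (\<lambda>x1 x2. tens D D (lift3 f x1) (lift3 f x2))"
    if "x \<in> carr HHH" for x
    using that by (simp add: cv_def)
  have "\<forall>x\<in>carr H3. counit D (lift3 f x) = counit HHH x"
    by (subst tensor_left_eq_iff[where Z = k_space])
      (auto intro!: lin_comp[OF eD] l simp: t counit counit_HHH
        lin_counit_tensor[OF coalg_HH coalg_H, simplified])
  then show "counit D (lift3 f x) = counit HHH x" if "x \<in> carr HHH" for x
    using that by simp
qed simp

text \<open>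
  The maps that produce the arguments of \<open>\<tau>\<close> and of the action; \<open>drop3\<close> and \<open>drop2\<close> discard the last
  factor by \<open>\<epsilon>\<close>.  The first three are used as coalgebra maps: convolution products can be pulled back
  along them.
\<close>

definition "mul_left = lift3 (\<lambda>h g l. t2 (mul H h g) l)"
definition "mul_right = lift3 (\<lambda>h g l. t2 h (mul H g l))"
definition "drop3 = tlift H2 H (\<lambda>x l. scl H2 (\<epsilon> l) x)"
definition "drop2 = tlift H H (\<lambda>h g. scl H (\<epsilon> g) h)"

lemma trilin_homs:
  "trilin H H H H2 (\<lambda>h g l. t2 (mul H h g) l)"
  "trilin H H H H2 (\<lambda>h g l. t2 h (mul H g l))"
  by (auto intro!: trilinI lin_rules)

lemma lin_homs:
  "lin H3 H2 mul_left"
  "lin H3 H2 mul_right"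
  unfolding mul_left_def mul_right_def by (intro lin_lift3 trilin_homs is_vspace_tensor)+

lemma homs_tens [simp]:
  assumes "h \<in> carr H" "g \<in> carr H" "l \<in> carr H"
  shows "mul_left (t3 h g l) = t2 (mul H h g) l"
    "mul_right (t3 h g l) = t2 h (mul H g l)"
  unfolding mul_left_def mul_right_def
  by (simp_all add: lift3_tens[OF trilin_homs(1)] lift3_tens[OF trilin_homs(2)] assms)

lemma coalgebra_hom_mul_left: "coalgebra_hom HHH HH mul_left"
  unfolding mul_left_def
proof (rule coalgebra_hom_lift3[OF coalg_HH])
  fix h g l assume "h \<in> carr H" "g \<in> carr H" "l \<in> carr H"
  then show "comul HH (t2 (mul H h g) l) = ssum H h (\<lambda>h1 h2. ssum H g (\<lambda>g1 g2. ssum H l (\<lambda>l1 l2.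
      tens HH HH (t2 (mul H h1 g1) l1) (t2 (mul H h2 g2) l2))))"
    by (simp add: comul_tensor, subst ssum_mul[OF is_vspace_tensor])
      (auto intro!: lin_rules)
qed (use trilin_homs in \<open>auto simp: trilin_def counit_HH counit_mul\<close>)

lemma coalgebra_hom_mul_right: "coalgebra_hom HHH HH mul_right"
  unfolding mul_right_def
proof (rule coalgebra_hom_lift3[OF coalg_HH])
  fix h g l assume m: "h \<in> carr H" "g \<in> carr H" "l \<in> carr H"
  have "comul HH (t2 h (mul H g l)) = ssum H h (\<lambda>h1 h2. ssum H (mul H g l) (\<lambda>y1 y2.
      tens H2 H2 (t2 h1 y1) (t2 h2 y2)))"
    using m by (simp add: comul_tensor)
  also have "\<dots> = ssum H h (\<lambda>h1 h2. ssum H g (\<lambda>g1 g2. ssum H l (\<lambda>l1 l2.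
      tens H2 H2 (t2 h1 (mul H g1 l1)) (t2 h2 (mul H g2 l2)))))"
    using m by (intro ssum_cong refl ssum_mul[OF is_vspace_tensor]) (auto intro!: lin_rules)
  finally show "comul HH (t2 h (mul H g l)) = ssum H h (\<lambda>h1 h2. ssum H g (\<lambda>g1 g2. ssum H l (\<lambda>l1 l2.
      tens HH HH (t2 h1 (mul H g1 l1)) (t2 h2 (mul H g2 l2)))))"
    by simp
qed (use trilin_homs in \<open>auto simp: trilin_def counit_HH counit_mul\<close>)

lemma bilin_drop2: "bilin H H H (\<lambda>h g. scl H (\<epsilon> g) h)"
  by (auto intro!: lin_rules)

lemma lin_drop2: "lin H2 H drop2"
  unfolding drop2_def by (rule tensor_universal(1)[OF vspace_H vspace_H bilin_drop2])

lemma drop2_tens [simp]: "h \<in> carr H \<Longrightarrow> g \<in> carr H \<Longrightarrow> drop2 (t2 h g) = scl H (\<epsilon> g) h"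
  unfolding drop2_def by (rule tensor_universal(2)[OF vspace_H vspace_H bilin_drop2])

lemma bilin_drop3: "bilin H2 H H2 (\<lambda>x l. scl H2 (\<epsilon> l) x)"
  by (auto intro!: lin_rules)

lemma lin_drop3: "lin H3 H2 drop3"
  unfolding drop3_def by (rule tensor_universal(1)[OF is_vspace_tensor is_vspace_tensor bilin_drop3])

lemma drop3_tens [simp]: "x \<in> carr H2 \<Longrightarrow> l \<in> carr H \<Longrightarrow>
    drop3 (tens H2 H x l) = scl H2 (\<epsilon> l) x"
  unfolding drop3_def by (rule tensor_universal(2)[OF is_vspace_tensor is_vspace_tensor bilin_drop3])

lemma coalgebra_hom_drop3: "coalgebra_hom HHH HH drop3"
  unfolding drop3_def using coalgebra_hom_drop[OF coalg_HH coalg_H] by simp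

text \<open>The counit in \<open>drop3\<close> absorbs the Sweedler sum over the third factor.\<close>

lemma cv_drop3_tens:
  assumes F: "lin H2 U F" and G: "lin H3 V G"
    and op: "bilin U V Z op" and U: "is_vspace U" and Z: "is_vspace Z"
    and m: "h \<in> carr H" "g \<in> carr H" "l \<in> carr H"
  shows "cv HHH op (\<lambda>x. F (drop3 x)) G (t3 h g l) =
    ssum H h (\<lambda>h1 h2. ssum H g (\<lambda>g1 g2. op (F (t2 h1 g1)) (G (t3 h2 g2 l))))"
proof -
  have memG: "G (t3 h g l) \<in> carr V" if "h \<in> carr H" "g \<in> carr H" "l \<in> carr H" for h g l
    using that by (intro lin_mem[OF G] tens_in_tensor)
  have memF: "F (t2 h g) \<in> carr U" if "h \<in> carr H" "g \<in> carr H" for h g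
    using that by (intro lin_mem[OF F] tens_in_tensor)
  have "cv HHH op (\<lambda>x. F (drop3 x)) G (t3 h g l) =
      ssum H h (\<lambda>h1 h2. ssum H g (\<lambda>g1 g2. ssum H l (\<lambda>l1 l2.
      op (F (scl H2 (\<epsilon> l1) (t2 h1 g1))) (G (t3 h2 g2 l2)))))"
    using m by (subst cv_HHH_tens[OF lin_comp[OF F lin_drop3] G op Z]) (simp_all add: tens_in_tensor)
  also have "\<dots> = ssum H h (\<lambda>h1 h2. ssum H g (\<lambda>g1 g2. ssum H l (\<lambda>l1 l2.
      scl Z (\<epsilon> l1) (op (F (t2 h1 g1)) (G (t3 h2 g2 l2))))))"
    by (intro ssum_cong refl) (simp add: lin_scl[OF F] memF memG tens_in_tensor lin_scl[OF bilin_lin1[OF op]])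
  also have "\<dots> = ssum H h (\<lambda>h1 h2. ssum H g (\<lambda>g1 g2.
      op (F (t2 h1 g1)) (G (t3 h2 g2 l))))"
    using m by (intro ssum_cong[OF refl refl] ssum_counit_H(1)[OF Z])
      (auto intro!: lin_bilin2[OF op] lin_comp[OF G] lin_bilin2[OF bilin_tens] lin_ident memF tens_in_tensor)
  finally show ?thesis .
qed

end

context crossed_data
begin

text \<open>
  The factors of the twisted module and cocycle conditions, as linear maps on tensor powers of \<open>H\<close>.
\<close>

definition dot2 :: "'a \<Rightarrow> ('h, 'h, 'k) tensor \<Rightarrow> 'a" where
  "dot2 a = tlift H H (\<lambda>h g. dot h (dot g a))"

definition dot_tau :: "(('h, 'h, 'k) tensor, 'h, 'k) tensor \<Rightarrow> 'a" where
  "dot_tau = lift3 (\<lambda>h g l. dot h (ta g l))"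

text \<open>
  The two sides \<open>(h\<^sub>1 \<cdot> \<tau>(g\<^sub>1, l\<^sub>1)) \<tau>(h\<^sub>2, g\<^sub>2l\<^sub>2)\<close> and \<open>\<tau>(h\<^sub>1, g\<^sub>1) \<tau>(h\<^sub>2g\<^sub>2, l)\<close> of the cocycle
  condition, with \<open>\<phi>\<close> left out.
\<close>

definition "cocycle_l = cv HHH m dot_tau (\<lambda>x. \<tau> (mul_right x))"
definition "cocycle_r = cv HHH m (\<lambda>x. \<tau> (drop3 x)) (\<lambda>x. \<tau> (mul_left x))"

lemma lin_dot: "a \<in> carr A \<Longrightarrow> lin H A (\<lambda>h. dot h a)"
  by (auto intro!: lin_all)

lemma bilin_dot2: "a \<in> carr A \<Longrightarrow> bilin H H A (\<lambda>h g. dot h (dot g a))"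
  by (auto intro!: lin_all)

lemma lin_dot2: "a \<in> carr A \<Longrightarrow> lin H2 A (dot2 a)"
  unfolding dot2_def by (rule tensor_universal(1)[OF vspace_H vspace_A bilin_dot2])

lemma dot2_tens [simp]:
  "a \<in> carr A \<Longrightarrow> h \<in> carr H \<Longrightarrow> g \<in> carr H \<Longrightarrow> dot2 a (t2 h g) = dot h (dot g a)"
  unfolding dot2_def by (rule tensor_universal(2)[OF vspace_H vspace_A bilin_dot2])

lemma trilin_dot_tau: "trilin H H H A (\<lambda>h g l. dot h (ta g l))"
  by (auto intro!: lin_all)

lemma lin_dot_tau: "lin H3 A dot_tau"
  unfolding dot_tau_def by (rule lin_lift3[OF trilin_dot_tau vspace_A])

lemma dot_tau_tens [simp]:
  "h \<in> carr H \<Longrightarrow> g \<in> carr H \<Longrightarrow> l \<in> carr H \<Longrightarrow> dot_tau (t3 h g l) = dot h (ta g l)"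
  unfolding dot_tau_def by (rule lift3_tens[OF trilin_dot_tau vspace_A])

lemma lin_tau3:
  "lin H3 A (\<lambda>x. \<tau> (mul_right x))"
  "lin H3 A (\<lambda>x. \<tau> (mul_left x))"
  "lin H3 A (\<lambda>x. \<tau> (drop3 x))"
  by (intro lin_comp[OF lin_tau] lin_homs lin_drop3)+

lemma lin_dot_mult: "a \<in> carr A \<Longrightarrow> lin H2 A (\<lambda>x. dot (mult H x) a)"
  by (rule lin_comp[OF lin_dot lin_mult])

lemma lin_cocycle:
  "lin H3 A cocycle_l" "lin H3 A cocycle_r"
  unfolding cocycle_l_def cocycle_r_def
  using lin_cv_m[OF coalg_HHH] lin_dot_tau lin_tau3 by simp_all

lemmas sw_HA = sw_eqI[OF coalg_H vspace_A]

lemma crossed_act_mult_iff: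
  assumes "h \<in> carr H" "a \<in> carr A" "b \<in> carr A"
  shows "dot h (m a b) = sw H h (\<lambda>h1 h2. m (dot h1 a) (dot h2 b)) \<longleftrightarrow>
    dot h (m a b) = cv H m (\<lambda>h. dot h a) (\<lambda>h. dot h b) h"
proof -
  have "sw H h (\<lambda>h1 h2. m (dot h1 a) (dot h2 b)) = cv H m (\<lambda>h. dot h a) (\<lambda>h. dot h b) h"
    unfolding cv_def using assms by (intro sw_HA refl) (auto intro!: lin_all)
  then show ?thesis by simp
qed

lemma crossed_act_act_eq:
  assumes "h \<in> carr H" "g \<in> carr H" "a \<in> carr A"
  shows "sw H h (\<lambda>h1 h2. sw H g (\<lambda>g1 g2. m (dot h1 (dot g1 a)) (ta h2 g2))) =
      cv HH m (dot2 a) \<tau> (t2 h g)" (is "?L = ?L'")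
    and "sw H h (\<lambda>h1 h2. sw H g (\<lambda>g1 g2. m (ta h1 g1) (dot (mul H h2 g2) a))) =
      cv HH m \<tau> (\<lambda>x. dot (mult H x) a) (t2 h g)" (is "?R = ?R'")
proof -
  have "?L = ssum H h (\<lambda>h1 h2. ssum H g (\<lambda>g1 g2. m (dot h1 (dot g1 a)) (ta h2 g2)))"
    using assms by (intro sw_HA refl) (auto intro!: lin_all)
  also have "\<dots> = ?L'"
    using assms by (simp add: cv_HH_tens[OF lin_dot2 lin_tau bilin_m vspace_A])
  finally show "?L = ?L'" .
  have "?R = ssum H h (\<lambda>h1 h2. ssum H g (\<lambda>g1 g2. m (ta h1 g1) (dot (mul H h2 g2) a)))"
    using assms by (intro sw_HA refl) (auto intro!: lin_all)
  also have "\<dots> = ?R'"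
    using assms by (simp add: cv_HH_tens[OF lin_tau lin_dot_mult bilin_m vspace_A] mul_def)
  finally show "?R = ?R'" .
qed

lemma cocycle_l_tens:
  assumes "h \<in> carr H" "g \<in> carr H" "l \<in> carr H"
  shows "cocycle_l (t3 h g l) = ssum H h (\<lambda>h1 h2. ssum H g (\<lambda>g1 g2. ssum H l (\<lambda>l1 l2.
    m (dot h1 (ta g1 l1)) (ta h2 (mul H g2 l2)))))"
  unfolding cocycle_l_def using assms
  by (simp add: cv_HHH_tens[OF lin_dot_tau lin_tau3(1) bilin_m vspace_A])

lemma m_ssum:
  "a \<in> carr A \<Longrightarrow> (\<And>x1 x2. x1 \<in> carr C \<Longrightarrow> x2 \<in> carr C \<Longrightarrow> f x1 x2 \<in> carr A) \<Longrightarrow>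
    m a (ssum C x f) = ssum C x (\<lambda>x1 x2. m a (f x1 x2))"
  by (rule lin_ssum[OF bilin_lin2[OF bilin_m] vspace_A])

lemma m_scl: "a \<in> carr A \<Longrightarrow> b \<in> carr A \<Longrightarrow> m a (scl A c b) = scl A c (m a b)"
  by (rule lin_scl[OF bilin_lin2[OF bilin_m]])

text \<open>
  The second equation re-associates \<open>(\<tau>(h\<^sub>1, g\<^sub>1) \<tau>(h\<^sub>2g\<^sub>2, l\<^sub>1)) \<phi>\<^sup>-\<^sup>1\<close> to the right, so that the first
  factor does not involve \<open>l\<close> and its counit can be absorbed.
\<close>

lemma crossed_cocycle_eq:
  assumes "h \<in> carr H" "g \<in> carr H" "l \<in> carr H"
  shows "sw H h (\<lambda>h1 h2. sw H g (\<lambda>g1 g2. sw H l (\<lambda>l1 l2.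
      m (dot h1 (ta g1 l1)) (ta h2 (mul H g2 l2))))) = cocycle_l (t3 h g l)" (is "?L = _")
    and "sw3 H h (\<lambda>h1 h2 h3. sw3 H g (\<lambda>g1 g2 g3. sw H l (\<lambda>l1 l2.
      scl A (phi_inv H h3 g3 l2) (m (ta h1 g1) (ta (mul H h2 g2) l1))))) =
      cv HHH scr cocycle_r \<phi>inv (t3 h g l)" (is "?R = _")
proof -
  have "?L = ssum H h (\<lambda>h1 h2. ssum H g (\<lambda>g1 g2. ssum H l (\<lambda>l1 l2.
      m (dot h1 (ta g1 l1)) (ta h2 (mul H g2 l2)))))"
    using assms by (intro sw_HA refl) (auto intro!: lin_all)
  then show "?L = cocycle_l (t3 h g l)" using assms by (simp add: cocycle_l_tens)
  note lT = lin_cv_scr[OF coalg_HHH, simplified, OF lin_tau3(2) lin_phi_inv]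
  have T: "cv HHH scr (\<lambda>x. \<tau> (mul_left x)) \<phi>inv (t3 h g l) = ssum H h (\<lambda>h1 h2. ssum H g (\<lambda>g1 g2. ssum H l (\<lambda>l1 l2.
      scl A (phi_inv H h2 g2 l2) (ta (mul H h1 g1) l1))))"
    if "h \<in> carr H" "g \<in> carr H" "l \<in> carr H" for h g l
    using that
    by (simp add: cv_HHH_tens[OF lin_tau3(2) lin_phi_inv bilin_scl_right[OF vspace_A] vspace_A] phi_inv_eq)
  have "cv HHH scr cocycle_r \<phi>inv (t3 h g l) =
      cv HHH m (\<lambda>x. \<tau> (drop3 x)) (cv HHH scr (\<lambda>x. \<tau> (mul_left x)) \<phi>inv) (t3 h g l)"
    unfolding cocycle_r_def using assms lin_tau3 lin_phi_inv
    by (intro cv_scr_assoc[OF coalg_HHH]) simp_all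
  also have "\<dots> = ssum H h (\<lambda>h1 h'. ssum H g (\<lambda>g1 g'. m (ta h1 g1)
      (ssum H h' (\<lambda>h2 h3. ssum H g' (\<lambda>g2 g3. ssum H l (\<lambda>l1 l2.
        scl A (phi_inv H h3 g3 l2) (ta (mul H h2 g2) l1)))))))"
    using assms by (simp add: cv_drop3_tens[OF lin_tau lT bilin_m vspace_A vspace_A] T)
  also have "\<dots> = ssum H h (\<lambda>h1 h'. ssum H g (\<lambda>g1 g'.
      ssum H h' (\<lambda>h2 h3. ssum H g' (\<lambda>g2 g3. ssum H l (\<lambda>l1 l2.
        scl A (phi_inv H h3 g3 l2) (m (ta h1 g1) (ta (mul H h2 g2) l1)))))))"
    by (intro ssum_cong refl) (simp add: m_ssum m_scl ssum_mem)
  also have "\<dots> = ssum H h (\<lambda>h1 h'. ssum H h' (\<lambda>h2 h3. ssum H g (\<lambda>g1 g'.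
      ssum H g' (\<lambda>g2 g3. ssum H l (\<lambda>l1 l2.
        scl A (phi_inv H h3 g3 l2) (m (ta h1 g1) (ta (mul H h2 g2) l1)))))))"
    by (rule ssum_cong[OF refl refl]) (rule ssum_swap)
  also have "\<dots> = ?R"
    unfolding sw3_def using assms by (intro sym[OF sw_HA] sw_HA refl) (auto intro!: lin_all)
  finally show "?R = cv HHH scr cocycle_r \<phi>inv (t3 h g l)" by simp
qed

text \<open>
  Convolve with \<open>\<phi>\<close>, respectively \<open>\<phi>\<^sup>-\<^sup>1\<close>, on the right.
\<close>

lemma cocycle_iff:
  "(\<forall>x\<in>carr HHH. cocycle_l x = cv HHH scr cocycle_r \<phi>inv x) \<longleftrightarrow>
   (\<forall>x\<in>carr HHH. cv HHH scr cocycle_l (reass H) x = cocycle_r x)"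
proof -
  have inv: "cv HHH scr (cv HHH scr F f) g x = F x"
    if "lin H3 A F" "lin H3 k_space f"
      "lin H3 k_space g"
      and fg: "\<And>x. x \<in> carr HHH \<Longrightarrow> cv HHH (*) f g x = counit HHH x" and x: "x \<in> carr HHH" for F f g x
  proof -
    have "cv HHH scr (cv HHH scr F f) g x = cv HHH scr F (cv HHH (*) f g) x"
      using that by (intro cv_scr_scr[OF coalg_HHH]) simp_all
    also have "\<dots> = cv HHH scr F (counit HHH) x"
      by (rule cv_cong) (simp_all add: fg[simplified])
    also have "\<dots> = F x"
      using that by (intro cv_counit(2)[OF coalg_HHH x vspace_A]) simp
    finally show ?thesis .
  qed
  show ?thesis
  proof (intro iffI ballI)
    fix x assume *: "\<forall>x\<in>carr HHH. cocycle_l x = cv HHH scr cocycle_r \<phi>inv x" and x: "x \<in> carr HHH"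
    have "cv HHH scr cocycle_l (reass H) x = cv HHH scr (cv HHH scr cocycle_r \<phi>inv) (reass H) x"
      using * by (intro cv_cong) auto
    then show "cv HHH scr cocycle_l (reass H) x = cocycle_r x"
      using inv[OF lin_cocycle(2) lin_phi_inv lin_reass conv_phi(2) x] by simp
  next
    fix x assume *: "\<forall>x\<in>carr HHH. cv HHH scr cocycle_l (reass H) x = cocycle_r x" and x: "x \<in> carr HHH"
    have "cv HHH scr cocycle_r \<phi>inv x = cv HHH scr (cv HHH scr cocycle_l (reass H)) \<phi>inv x"
      using * by (intro cv_cong) auto
    then show "cocycle_l x = cv HHH scr cocycle_r \<phi>inv x"
      using inv[OF lin_cocycle(1) lin_reass lin_phi_inv conv_phi(1) x] by simp
  qed
qed

text \<open>
  Each Sweedler identity is the value on a pure tensor of an identity of linear maps on \<open>H\<close>,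
  \<open>H \<otimes> H\<close> or \<open>(H \<otimes> H) \<otimes> H\<close>.
\<close>

theorem crossed_system_iff:
  "crossed_system H A act \<tau> \<longleftrightarrow>
    (\<forall>a\<in>carr A. \<forall>b\<in>carr A. \<forall>h\<in>carr H. dot h (m a b) = cv H m (\<lambda>h. dot h a) (\<lambda>h. dot h b) h) \<and>
    (\<forall>h\<in>carr H. dot h e = scl A (\<epsilon> h) e) \<and>
    (\<forall>a\<in>carr A. dot (one H) a = a) \<and>
    (\<forall>a\<in>carr A. \<forall>x\<in>carr HH. cv HH m (dot2 a) \<tau> x = cv HH m \<tau> (\<lambda>x. dot (mult H x) a) x) \<and>
    (\<forall>x\<in>carr HHH. cv HHH scr cocycle_l (reass H) x = cocycle_r x) \<and>
    (\<forall>h\<in>carr H. ta (one H) h = scl A (\<epsilon> h) e \<and> ta h (one H) = scl A (\<epsilon> h) e)"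
proof -
  have 4: "(\<forall>x\<in>carr HH. cv HH m (dot2 a) \<tau> x = cv HH m \<tau> (\<lambda>x. dot (mult H x) a) x) \<longleftrightarrow>
      (\<forall>h\<in>carr H. \<forall>g\<in>carr H.
          sw H h (\<lambda>h1 h2. sw H g (\<lambda>g1 g2. m (dot h1 (dot g1 a)) (ta h2 g2))) =
          sw H h (\<lambda>h1 h2. sw H g (\<lambda>g1 g2. m (ta h1 g1) (dot (mul H h2 g2) a))))"
    if a: "a \<in> carr A" for a
  proof -
    have "(\<forall>x\<in>carr HH. cv HH m (dot2 a) \<tau> x = cv HH m \<tau> (\<lambda>x. dot (mult H x) a) x) \<longleftrightarrow>
        (\<forall>h\<in>carr H. \<forall>g\<in>carr H. cv HH m (dot2 a) \<tau> (t2 h g) =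
          cv HH m \<tau> (\<lambda>x. dot (mult H x) a) (t2 h g))"
      using lin_cv_m[OF coalg_HH] lin_dot2[OF a] lin_tau lin_dot_mult[OF a]
      by (subst same_tensor_coalg(1), intro tensor_eq_iff[where Z = A]) simp_all
    then show ?thesis using a by (simp add: crossed_act_act_eq)
  qed
  have 5: "(\<forall>x\<in>carr HHH. cocycle_l x = cv HHH scr cocycle_r \<phi>inv x) \<longleftrightarrow>
    (\<forall>h\<in>carr H. \<forall>g\<in>carr H. \<forall>l\<in>carr H.
          sw H h (\<lambda>h1 h2. sw H g (\<lambda>g1 g2. sw H l (\<lambda>l1 l2.
            m (dot h1 (ta g1 l1)) (ta h2 (mul H g2 l2))))) =
          sw3 H h (\<lambda>h1 h2 h3. sw3 H g (\<lambda>g1 g2 g3. sw H l (\<lambda>l1 l2.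
            scl A (phi_inv H h3 g3 l2) (m (ta h1 g1) (ta (mul H h2 g2) l1))))))"
  proof -
    have "(\<forall>x\<in>carr HHH. cocycle_l x = cv HHH scr cocycle_r \<phi>inv x) \<longleftrightarrow>
        (\<forall>h\<in>carr H. \<forall>g\<in>carr H. \<forall>l\<in>carr H. cocycle_l (t3 h g l) = cv HHH scr cocycle_r \<phi>inv (t3 h g l))"
      using tensor_left_eq_iff[OF lin_cocycle(1)
        lin_cv_scr[OF coalg_HHH, simplified, OF lin_cocycle(2) lin_phi_inv] vspace_H] by simp
    then show ?thesis by (simp add: crossed_cocycle_eq)
  qed
  show ?thesis
    unfolding cocycle_iff[symmetric] 5 crossed_system_def Let_def
    using crossed_act_mult_iff 4 by (auto 0 0)
qed

end

section \<open>The comodules and the maps of the wreath\<close>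

context crossed_data
begin

abbreviation "Ac \<equiv> trivial_comod_alg H A"
abbreviation "Hc \<equiv> regular_comod H"
abbreviation "AX \<equiv> tensor_comod H Ac Hc"
abbreviation "psi \<equiv> psi_map H A act"
abbreviation "zeta \<equiv> zeta_map H A \<tau>"
abbreviation "sigma \<equiv> sigma_map H A"

lemma coact_Ac [simp]: "coact Ac a = tens A H a (one H)"
  by (simp add: trivial_comod_alg_def)

lemma amult_Ac [simp]: "amult Ac = tlift A A m"
  and aunit_Ac [simp]: "aunit Ac = (\<lambda>c. scl A c e)"
  by (simp_all add: trivial_comod_alg_def)

lemma coact_Hc [simp]: "coact Hc = comul H"
  by (simp add: regular_comod_def)

lemma csum_Hc [simp]: "tsum H H (comul H h) f = ssum H h f"
  by (simp add: ssum_def)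

lemma csum_Ac:
  "is_vspace Z \<Longrightarrow> bilin A H Z f \<Longrightarrow> a \<in> carr A \<Longrightarrow> tsum A H (tens A H a (one H)) f = f a (one H)"
  by (rule tsum_tens) simp_all

lemma csw_Ac:
  "is_vspace Z \<Longrightarrow> bilin A H Z f \<Longrightarrow> a \<in> carr A \<Longrightarrow> csw H Ac a f = f a (one H)"
  unfolding csw_def by (simp add: tensor_universal(2))

lemma csw_Hc: "csw H Hc h f = sw H h f"
  by (simp add: csw_def sw_def)

lemma comodule_Hc: "comodule H Hc"
  using coalg_H by (simp add: comodule_def coalgebra_def csw_Hc)

lemma comodule_Ac: "comodule H Ac"
proof -
  have 1: "csw H Ac a (\<lambda>x h2. csw H Ac x (\<lambda>v0 h1. tens Ac H2 v0 (t2 h1 h2))) =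
      csw H Ac a (\<lambda>v0 y. sw H y (\<lambda>h1 h2. tens Ac H2 v0 (t2 h1 h2)))"
    if a: "a \<in> carr A" for a
  proof -
    have "csw H Ac a (\<lambda>x h2. csw H Ac x (\<lambda>v0 h1. tens Ac H2 v0 (t2 h1 h2))) =
        csw H Ac a (\<lambda>x h2. tens A H2 x (t2 (one H) h2))"
      unfolding csw_def[of H Ac a]
      by (intro fun_cong[OF tlift_cong]; simp; subst csw_Ac[OF is_vspace_tensor]; auto intro!: lin_all)
    also have "\<dots> = tens A H2 a (t2 (one H) (one H))"
      using a by (subst csw_Ac[OF is_vspace_tensor]) (auto intro!: lin_all)
    also have "\<dots> = ssum H (one H) (\<lambda>h1 h2. tens A H2 a (t2 h1 h2))"
      using a by (subst ssum_one[OF is_vspace_tensor]) (auto intro!: lin_all)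
    also have "\<dots> = csw H Ac a (\<lambda>v0 y. ssum H y (\<lambda>h1 h2. tens A H2 v0 (t2 h1 h2)))"
      using a by (subst csw_Ac[OF is_vspace_tensor]) (auto intro!: lin_all)
    also have "\<dots> = csw H Ac a (\<lambda>v0 y. sw H y (\<lambda>h1 h2. tens Ac H2 v0 (t2 h1 h2)))"
      unfolding csw_def
      by (intro fun_cong[OF tlift_cong] sw_eqI[OF coalg_H is_vspace_tensor, symmetric]; simp)
        (auto intro!: lin_all)
    finally show ?thesis .
  qed
  have "csw H Ac a (\<lambda>v0 v1. scl Ac (\<epsilon> v1) v0) = a" if "a \<in> carr A" for a
    using that by (subst csw_Ac[OF vspace_A]) (auto intro!: lin_all simp: vspace_scale)
  moreover have "lin A (tensor A H) (coact Ac)"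
    by (subst lin_cong[where g = "\<lambda>a. tens A H a (one H)"]) (auto intro!: lin_all)
  ultimately show ?thesis using 1 by (simp add: comodule_def)
qed

lemma counital_Hc [simp]: "counital Hc" and counital_Ac [simp]: "counital Ac"
  by (intro comodule_counital comodule_Hc comodule_Ac)+

lemma trivial_Ac [simp]: "trivial_coact Ac"
  by (simp add: trivial_coact_def)

lemma bilin_psi: "bilin H A AH (\<lambda>h a. cv H (tens A H) (\<lambda>h. dot h a) (\<lambda>h. h) h)"
  unfolding cv_def by (auto intro!: lin_all)

lemma psi_eq: "psi = tlift H A (\<lambda>h a. cv H (tens A H) (\<lambda>h. dot h a) (\<lambda>h. h) h)"
  unfolding psi_map_def cv_def
  by (intro tlift_cong sw_eqI[OF coalg_H is_vspace_tensor] refl) (auto intro!: lin_all)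

lemma lin_psi: "lin (tensor H A) AH psi"
  unfolding psi_eq by (rule tensor_universal(1)[OF vspace_H is_vspace_tensor bilin_psi])

lemma psi_tens:
  "h \<in> carr H \<Longrightarrow> a \<in> carr A \<Longrightarrow> psi (tens H A h a) = cv H (tens A H) (\<lambda>h. dot h a) (\<lambda>h. h) h"
  unfolding psi_eq by (rule tensor_universal(2)[OF vspace_H is_vspace_tensor bilin_psi])

lemma lin_cv_zeta: "lin H2 AH (cv HH (tens A H) \<tau> (mult H))"
  using lin_cv_tens[OF coalg_HH] lin_tau lin_mult by simp

lemma zeta_eq: "zeta = tlift H H (\<lambda>h g. ssum H h (\<lambda>h1 h2. ssum H g (\<lambda>g1 g2. tens A H (ta h1 g1) (mul H h2 g2))))"
  unfolding zeta_map_def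
  by (intro tlift_cong sw_eqI[OF coalg_H is_vspace_tensor] refl) (auto intro!: lin_all)

lemma bilin_zeta: "bilin H H AH (\<lambda>h g. ssum H h (\<lambda>h1 h2. ssum H g (\<lambda>g1 g2. tens A H (ta h1 g1) (mul H h2 g2))))"
  by (auto intro!: lin_all)

lemma lin_zeta: "lin H2 AH zeta"
  unfolding zeta_eq by (rule tensor_universal(1)[OF vspace_H is_vspace_tensor bilin_zeta])

lemma zeta_tens:
  "h \<in> carr H \<Longrightarrow> g \<in> carr H \<Longrightarrow>
    zeta (t2 h g) = ssum H h (\<lambda>h1 h2. ssum H g (\<lambda>g1 g2. tens A H (ta h1 g1) (mul H h2 g2)))"
  unfolding zeta_eq by (rule tensor_universal(2)[OF vspace_H is_vspace_tensor bilin_zeta])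

lemma zeta_cv:
  assumes "x \<in> carr H2"
  shows "zeta x = cv HH (tens A H) \<tau> (mult H) x"
  by (rule tensor_ext[OF lin_zeta lin_cv_zeta vspace_H _ assms])
    (simp add: zeta_tens cv_HH_tens[OF lin_tau lin_mult bilin_tens is_vspace_tensor] mul_def)

lemma sigma_eq: "sigma c = scl AH c (tens A H e (one H))"
  by (simp add: sigma_map_def)

lemma lin_sigma: "lin k_space AH sigma"
  unfolding sigma_map_def
  using lin_bilin1[OF bilin_scl[OF is_vspace_tensor] lin_ident tens_in_tensor[OF e_carr one_carr]] .

lemma coact_AX:
  assumes "a \<in> carr A" "h \<in> carr H"
  shows "coact AX (tens A H a h) = ssum H h (\<lambda>h1 h2. tens AH H (tens A H a h1) h2)"
  using coact_tensor[OF counital_Ac counital_Hc, of a h] assms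
  by (simp, subst csum_Ac[OF is_vspace_tensor]) (auto intro!: lin_all)

lemma lin_coact_AX: "lin AH (tensor AH H) (coact AX)"
  using lin_coact_tensor[OF counital_Ac counital_Hc] by simp

text \<open>
  The coaction of \<open>A \<otimes> H\<close> on \<open>F(x\<^sub>1) \<otimes> p(x\<^sub>2)\<close> only splits \<open>p(x\<^sub>2)\<close>.  With \<open>p\<close> the identity or the
  multiplication, this makes \<open>\<psi>\<close>, \<open>\<zeta>\<close> and the crossed multiplication colinear.
\<close>

lemma coact_cv_tens:
  assumes C: "coalgebra C" and p: "coalgebra_hom C H p" and F: "lin C A F" and x: "x \<in> carr C"
  shows "coact AX (cv C (tens A H) F p x) = cv C (tens AH H) (cv C (tens A H) F p) p x"
proof -
  have lp: "lin C H p" using p by (simp add: coalgebra_hom_def)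
  note mem = lin_mem[OF lp] lin_mem[OF F]
  have "coact AX (cv C (tens A H) F p x) = ssum C x (\<lambda>x1 x2. coact AX (tens A H (F x1) (p x2)))"
    unfolding cv_def by (rule lin_ssum[OF lin_coact_AX is_vspace_tensor]) (auto simp: mem)
  also have "\<dots> = ssum C x (\<lambda>x1 x2. ssum H (p x2) (\<lambda>y1 y2. tens AH H (tens A H (F x1) y1) y2))"
    by (intro ssum_cong refl coact_AX) (auto simp: mem)
  also have "\<dots> = ssum C x (\<lambda>x1 x'. ssum C x' (\<lambda>x2 x3. tens AH H (tens A H (F x1) (p x2)) (p x3)))"
    by (intro ssum_cong[OF refl refl] ssum_coalgebra_hom[OF p coalg_H is_vspace_tensor C])
      (auto intro!: lin_all simp: mem)
  also have "\<dots> = ssum C x (\<lambda>x' x3. ssum C x' (\<lambda>x1 x2. tens AH H (tens A H (F x1) (p x2)) (p x3)))"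
    by (rule ssum_coassoc[OF C x is_vspace_tensor, symmetric])
      (auto intro!: trilinI lin_bilin1[OF bilin_tens] lin_bilin2[OF bilin_tens] lp F simp: mem)
  also have "\<dots> = cv C (tens AH H) (cv C (tens A H) F p) p x"
    unfolding cv_def
    by (intro ssum_cong[OF refl refl] tens_ssum(1)[OF is_vspace_tensor vspace_H, symmetric]) (auto simp: mem)
  finally show ?thesis .
qed

lemma comod_homI:
  assumes V: "counital V" and W: "counital W" and f: "lin V W f"
    and eq: "\<And>v. v \<in> carr V \<Longrightarrow> coact W (f v) = csum V v (\<lambda>v0 v1. tens W H (f v0) v1)"
  shows "comod_hom H V W f"
proof -
  have "csw H V v (\<lambda>v0 v1. tens W H (f v0) v1) = csum V v (\<lambda>v0 v1. tens W H (f v0) v1)"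
    if "v \<in> carr V" for v
    by (rule csw_csum[OF counitalD[OF V] is_vspace_tensor that refl])
      (auto intro!: lin_all f simp: lin_mem[OF f])
  then show ?thesis using f eq by (simp add: comod_hom_def)
qed

text \<open>
  Both sides of the colinearity equation are linear on \<open>V \<otimes> W\<close>, so pure tensors suffice.
\<close>

lemma comod_hom_tensorI:
  assumes V: "counital V" and W: "counital W" and U: "counital U" and f: "lin (tensor V W) U f"
    and eq: "\<And>v w. v \<in> carr V \<Longrightarrow> w \<in> carr W \<Longrightarrow> coact U (f (tens V W v w)) =
      csum V v (\<lambda>v0 v1. csum W w (\<lambda>w0 w1. tens U H (f (tens V W v0 w0)) (mul H v1 w1)))"
  shows "comod_hom H (tensor_comod H V W) U f"
proof (rule comod_homI[OF counital_tensor[OF V W] U])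
  let ?T = "tensor_comod H V W"
  show "lin ?T U f" using f by simp
  have b: "bilin (tensor V W) H (tensor U H) (\<lambda>v0 v1. tens U H (f v0) v1)"
    by (auto intro!: lin_all f simp: lin_mem[OF f])
  fix t assume "t \<in> carr ?T"
  then have t: "t \<in> carr (tensor V W)" by simp
  have "coact U (f t) = tsum (tensor V W) H (coact ?T t) (\<lambda>v0 v1. tens U H (f v0) v1)"
    by (rule tensor_ext[OF lin_comp[OF counitalD(2)[OF U] f]
          lin_tsum_arg[OF b is_vspace_tensor is_vspace_tensor lin_coact_tensor[OF V W]]
          counitalD(1)[OF V] _ t])
      (simp add: eq csum_tensor[OF V W is_vspace_tensor b])
  then show "coact U (f t) = csum ?T t (\<lambda>v0 v1. tens U H (f v0) v1)" by simp
qed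

lemma counital_AX [simp]: "counital AX"
  by (rule counital_tensor) simp_all

lemma comod_hom_psi: "comod_hom H (tensor_comod H Hc Ac) AX psi"
proof (rule comod_hom_tensorI)
  fix h a assume "h \<in> carr Hc" "a \<in> carr Ac"
  then have m: "h \<in> carr H" "a \<in> carr A" by simp_all
  have "ssum H h (\<lambda>v0 v1. tsum A H (tens A H a (one H)) (\<lambda>w0 w1. tens AH H (psi (tens H A v0 w0)) (mul H v1 w1))) =
      ssum H h (\<lambda>v0 v1. tens AH H (psi (tens H A v0 a)) (mul H v1 (one H)))"
    using m by (intro ssum_cong[OF refl refl] csum_Ac[OF is_vspace_tensor])
      (auto intro!: lin_all lin_comp[OF lin_psi] simp: lin_mem[OF lin_psi])
  also have "\<dots> = cv H (tens AH H) (cv H (tens A H) (\<lambda>h. dot h a) (\<lambda>h. h)) (\<lambda>h. h) h"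
    using m unfolding cv_def[of _ "tens AH H"] by (intro ssum_cong[OF refl refl]) (simp add: psi_tens)
  also have "\<dots> = coact AX (psi (tens H A h a))"
    using m by (simp add: psi_tens coact_cv_tens[OF coalg_H coalgebra_hom_id[OF coalg_H] lin_dot])
  finally show "coact AX (psi (tens Hc Ac h a)) =
      csum Hc h (\<lambda>v0 v1. csum Ac a (\<lambda>w0 w1. tens AX H (psi (tens Hc Ac v0 w0)) (mul H v1 w1)))"
    by simp
qed (simp_all add: lin_psi)

lemma comod_hom_zeta: "comod_hom H (tensor_comod H Hc Hc) AX zeta"
proof (rule comod_hom_tensorI)
  fix h g assume "h \<in> carr Hc" "g \<in> carr Hc"
  then have m: "h \<in> carr H" "g \<in> carr H" by simp_all
  have "ssum H h (\<lambda>v0 v1. ssum H g (\<lambda>w0 w1. tens AH H (zeta (t2 v0 w0)) (mul H v1 w1))) =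
      cv HH (tens AH H) zeta (mult H) (t2 h g)"
    using m by (simp add: cv_HH_tens[OF lin_zeta lin_mult bilin_tens is_vspace_tensor] mul_def)
  also have "\<dots> = cv HH (tens AH H) (cv HH (tens A H) \<tau> (mult H)) (mult H) (t2 h g)"
    by (rule cv_cong) (simp_all add: zeta_cv)
  also have "\<dots> = coact AX (zeta (t2 h g))"
    using m lin_tau by (simp add: zeta_cv coact_cv_tens[OF coalg_HH hom_mult])
  finally show "coact AX (zeta (tens Hc Hc h g)) =
      csum Hc h (\<lambda>v0 v1. csum Hc g (\<lambda>w0 w1. tens AX H (zeta (tens Hc Hc v0 w0)) (mul H v1 w1)))"
    by simp
qed (simp_all add: lin_zeta)

lemma coact_unit [simp]: "coact (unit_comod H) c = tens k_space H c (one H)"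
  by (simp add: unit_comod_def)

lemma csw_unit:
  "is_vspace Z \<Longrightarrow> bilin k_space H Z f \<Longrightarrow> csw H (unit_comod H) c f = f c (one H)"
  unfolding csw_def by (simp add: tensor_universal(2))

lemma comod_hom_sigma: "comod_hom H (unit_comod H) AX sigma"
  unfolding comod_hom_def
proof (intro conjI ballI)
  show "lin (unit_comod H) AX sigma" using lin_sigma by simp
  fix c :: 'k
  have "csw H (unit_comod H) c (\<lambda>v0 v1. tens AH H (sigma v0) v1) = tens AH H (sigma c) (one H)"
    by (rule csw_unit[OF is_vspace_tensor])
      (auto intro!: lin_all lin_comp[OF lin_sigma] lin_sigma simp: lin_mem[OF lin_sigma])
  moreover have "coact AX (sigma c) = scl (tensor AH H) c (coact AX (tens A H e (one H)))"
    unfolding sigma_eq by (rule lin_scl[OF lin_coact_AX]) simp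
  moreover have "coact AX (tens A H e (one H)) = tens AH H (tens A H e (one H)) (one H)"
    by (simp add: coact_AX, rule ssum_one[OF is_vspace_tensor]) (auto intro!: lin_all)
  ultimately show "coact AX (sigma c) = csw H (unit_comod H) c (\<lambda>v0 v1. tens AX H (sigma v0) v1)"
    by (simp add: sigma_eq scl_tens)
qed

lemma lin_tlift_m: "lin (tensor A A) A (tlift A A m)"
  by (rule tensor_universal(1)[OF vspace_A vspace_A bilin_m])

lemma tlift_m [simp]: "a \<in> carr A \<Longrightarrow> b \<in> carr A \<Longrightarrow> tlift A A m (tens A A a b) = m a b"
  by (rule tensor_universal(2)[OF vspace_A vspace_A bilin_m])

lemma lin_unit_A: "lin k_space A (\<lambda>c. scl A c e)"
  by (rule lin_bilin1[OF bilin_scl[OF vspace_A] lin_ident e_carr])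

lemma lin_id: "lin V V id"
  by (simp add: lin_def)

lemma comod_algebra_Ac: "comod_algebra H Ac"
proof -
  have 1: "comod_hom H (tensor_comod H Ac Ac) Ac (tlift A A m)"
  proof (rule comod_hom_tensorI)
    fix a b assume "a \<in> carr Ac" "b \<in> carr Ac"
    then have m: "a \<in> carr A" "b \<in> carr A" by simp_all
    have "tsum A H (tens A H a (one H)) (\<lambda>v0 v1. tsum A H (tens A H b (one H))
        (\<lambda>w0 w1. tens A H (m v0 w0) (mul H v1 w1))) =
      tsum A H (tens A H a (one H)) (\<lambda>v0 v1. tens A H (m v0 b) (mul H v1 (one H)))"
      using m by (intro tsum_cong[OF refl refl refl] csum_Ac[OF is_vspace_tensor]) (auto intro!: lin_all)
    also have "\<dots> = tens A H (m a b) (one H)"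
      using m by (subst csum_Ac[OF is_vspace_tensor]) (auto intro!: lin_all)
    finally show "coact Ac (tlift A A m (tens Ac Ac a b)) =
      csum Ac a (\<lambda>v0 v1. csum Ac b (\<lambda>w0 w1. tens Ac H (tlift A A m (tens Ac Ac v0 w0)) (mul H v1 w1)))"
      using m by (simp only: same_trivial coact_Ac tlift_m cong: tsum_cong) simp
  qed (simp_all add: lin_tlift_m)
  have 2: "comod_hom H (unit_comod H) Ac (\<lambda>c. scl A c e)"
    unfolding comod_hom_def
  proof (intro conjI ballI)
    show "lin (unit_comod H) Ac (\<lambda>c. scl A c e)" using lin_unit_A by simp
    fix c :: 'k
    have "csw H (unit_comod H) c (\<lambda>v0 v1. tens A H (scl A v0 e) v1) = tens A H (scl A c e) (one H)"
      by (rule csw_unit[OF is_vspace_tensor]) (auto intro!: lin_all)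
    then show "coact Ac (scl A c e) = csw H (unit_comod H) c (\<lambda>v0 v1. tens Ac H (scl A v0 e) v1)"
      by simp
  qed
  have L: "lin (tensor (tensor A A) A) A (tlift A A m \<circ> tmap (tensor A A) A A A (tlift A A m) id)"
    by (intro lin_comp_o[of _ "tensor A A"] lin_tmap lin_tlift_m lin_id is_vspace_tensor)
  have R: "lin (tensor (tensor A A) A) A (tlift A A m \<circ> tmap A (tensor A A) A A id (tlift A A m) \<circ> assoc H Ac Ac Ac)"
    using lin_assoc[of Ac Ac Ac]
    by (intro lin_comp_o[of _ "tensor A (tensor A A)"] lin_comp_o[of _ "tensor A A"] lin_tmap lin_tlift_m lin_id vspace_A) simp
  have 3: "\<forall>t\<in>carr (tensor (tensor A A) A). (tlift A A m \<circ> tmap (tensor A A) A A A (tlift A A m) id) t =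
      (tlift A A m \<circ> tmap A (tensor A A) A A id (tlift A A m) \<circ> assoc H Ac Ac Ac) t"
    unfolding tensor_left_eq_iff[OF L R vspace_A]
    using assoc_trivial[of Ac Ac Ac]
    by (simp add: tmap_tens[OF lin_tlift_m lin_id is_vspace_tensor] tmap_tens[OF lin_id lin_tlift_m vspace_A] m_assoc)
  have 4: "tlift A A m (tmap k_space A A A (\<lambda>c. scl A c e) id (lunit_inv Ac a)) = a"
    "tlift A A m (tmap A k_space A A id (\<lambda>c. scl A c e) (runit_inv Ac a)) = a" if "a \<in> carr A" for a
    using that by (simp_all add: lunit_inv_def runit_inv_def vspace_scale
        tmap_tens[OF lin_unit_A lin_id is_vspace_k_space] tmap_tens[OF lin_id lin_unit_A vspace_A])
  show ?thesis
    unfolding comod_algebra_def using comodule_Ac 1 2 3 4 by (simp add: eq_arr_def)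
qed

end

section \<open>The wreath equations\<close>

context crossed_data
begin

text \<open>
  The composites \<open>m_X\<close>, \<open>A_psi\<close>, \<dots> in the definition of a wreath, for \<open>X = H\<close>.
\<close>

definition "mX = tmap (tensor A A) H A H (tlift A A m) id \<circ> assoc_inv H Ac Ac Hc"
definition "Apsi = tmap A (tensor H A) A AH id psi"
definition "Azeta = tmap A H2 A AH id zeta"
definition "psiA = assoc H Ac Hc Ac \<circ> tmap (tensor H A) A AH A psi id"
definition "psiX = assoc H Ac Hc Hc \<circ> tmap (tensor H A) H AH H psi id"
definition "zetaA = assoc H Ac Hc Ac \<circ> tmap H2 A AH A zeta id"
definition "zetaX = assoc H Ac Hc Hc \<circ> tmap H2 H AH H zeta id"

text \<open>
  The constraint of three copies of \<open>H\<close> is the only one in the wreath axioms without a factor \<open>A\<close>.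
\<close>

lemmas lin_assocs =
  lin_assoc[of Ac Hc Ac, simplified] lin_assoc[of Ac Hc Hc, simplified] lin_assoc[of Hc Hc Ac, simplified]
  lin_assoc[of Hc Hc Hc, simplified]
  lin_assoc_inv[of Ac Ac Hc, simplified] lin_assoc_inv[of Hc Ac Ac, simplified]
  lin_assoc_inv[of Hc Ac Hc, simplified]

lemmas assoc_simps [simp] =
  assoc_trivial[of Ac Hc Ac, simplified] assoc_trivial[of Ac Hc Hc, simplified]
  assoc_trivial[of Hc Hc Ac, simplified]
  assoc_inv_trivial[of Ac Ac Hc, simplified] assoc_inv_trivial[of Hc Ac Ac, simplified]
  assoc_inv_trivial[of Hc Ac Hc, simplified]

lemma lin_wreath_maps:
  "lin (tensor A AH) AH mX" "lin (tensor A (tensor H A)) (tensor A AH) Apsi"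
  "lin (tensor A H2) (tensor A AH) Azeta"
  "lin (tensor (tensor H A) A) (tensor A (tensor H A)) psiA"
  "lin (tensor (tensor H A) H) (tensor A H2) psiX"
  "lin (tensor H2 A) (tensor A (tensor H A)) zetaA"
  "lin H3 (tensor A H2) zetaX"
  unfolding mX_def Apsi_def Azeta_def psiA_def psiX_def zetaA_def zetaX_def
  by (rule lin_comp_o lin_tmap lin_assocs lin_id lin_tlift_m lin_psi lin_zeta is_vspace_tensor vspace_A)+

lemma psi_carr [simp]: "h \<in> carr H \<Longrightarrow> a \<in> carr A \<Longrightarrow> psi (tens H A h a) \<in> carr AH"
  by (simp add: lin_mem[OF lin_psi])

lemma zeta_carr [simp]: "h \<in> carr H \<Longrightarrow> g \<in> carr H \<Longrightarrow> zeta (t2 h g) \<in> carr AH"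
  by (simp add: lin_mem[OF lin_zeta])

lemma mX_tens [simp]:
  assumes "a \<in> carr A" "y \<in> carr AH"
  shows "mX (tens A AH a y) = lact a y"
proof (rule tensor_ext[OF lin_comp[OF lin_wreath_maps(1)] _ vspace_A _ assms(2)])
  show "lin AH (tensor A AH) (tens A AH a)" "lin AH AH (lact a)"
    using assms by (auto intro!: bilin_lin2[OF bilin_tens] bilin_lin2[OF bilin_lact])
qed (use assms in \<open>simp add: mX_def tmap_tens[OF lin_tlift_m lin_id is_vspace_tensor]\<close>)

lemma Apsi_tens [simp]:
  "a \<in> carr A \<Longrightarrow> x \<in> carr (tensor H A) \<Longrightarrow> Apsi (tens A (tensor H A) a x) = tens A AH a (psi x)"
  unfolding Apsi_def by (simp add: tmap_tens[OF lin_id lin_psi vspace_A])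

lemma Azeta_tens [simp]:
  "a \<in> carr A \<Longrightarrow> x \<in> carr H2 \<Longrightarrow> Azeta (tens A H2 a x) = tens A AH a (zeta x)"
  unfolding Azeta_def by (simp add: tmap_tens[OF lin_id lin_zeta vspace_A])

lemma psi_ssum:
  "h \<in> carr H \<Longrightarrow> a \<in> carr A \<Longrightarrow> psi (tens H A h a) = ssum H h (\<lambda>h1 h2. tens A H (dot h1 a) h2)"
  by (simp add: psi_tens cv_def)

lemma psiA_tens [simp]:
  assumes "h \<in> carr H" "a \<in> carr A" "b \<in> carr A"
  shows "psiA (tens (tensor H A) A (tens H A h a) b) =
    ssum H h (\<lambda>h1 h2. tens A (tensor H A) (dot h1 a) (tens H A h2 b))"
  unfolding psiA_def using assms
  by (simp add: tmap_tens[OF lin_psi lin_id is_vspace_tensor], simp add: psi_ssum tens_ssum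
      lin_ssum[OF lin_assocs(1) is_vspace_tensor])

lemma psiX_tens [simp]:
  assumes "h \<in> carr H" "a \<in> carr A" "g \<in> carr H"
  shows "psiX (tens (tensor H A) H (tens H A h a) g) =
    ssum H h (\<lambda>h1 h2. tens A H2 (dot h1 a) (t2 h2 g))"
  unfolding psiX_def using assms
  by (simp add: tmap_tens[OF lin_psi lin_id is_vspace_tensor], simp add: psi_ssum tens_ssum
      lin_ssum[OF lin_assocs(2) is_vspace_tensor])

lemma zetaA_tens [simp]:
  assumes "h \<in> carr H" "g \<in> carr H" "a \<in> carr A"
  shows "zetaA (tens H2 A (t2 h g) a) =
    ssum H h (\<lambda>h1 h2. ssum H g (\<lambda>g1 g2. tens A (tensor H A) (ta h1 g1) (tens H A (mul H h2 g2) a)))"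
  unfolding zetaA_def using assms
  by (simp add: tmap_tens[OF lin_zeta lin_id is_vspace_tensor], simp add: zeta_tens tens_ssum ssum_mem
      lin_ssum[OF lin_assocs(1) is_vspace_tensor])

lemma zetaX_tens [simp]:
  assumes "h \<in> carr H" "g \<in> carr H" "l \<in> carr H"
  shows "zetaX (t3 h g l) =
    ssum H h (\<lambda>h1 h2. ssum H g (\<lambda>g1 g2. tens A H2 (ta h1 g1) (t2 (mul H h2 g2) l)))"
  unfolding zetaX_def using assms
  by (simp add: tmap_tens[OF lin_zeta lin_id is_vspace_tensor], simp add: zeta_tens tens_ssum ssum_mem
      lin_ssum[OF lin_assocs(2) is_vspace_tensor])

lemmas push = lin_ssum[OF lin_wreath_maps(1) is_vspace_tensor] lin_ssum[OF lin_wreath_maps(2) is_vspace_tensor]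
  lin_ssum[OF lin_wreath_maps(3) is_vspace_tensor] lin_ssum[OF lin_wreath_maps(4) is_vspace_tensor]
  lin_ssum[OF lin_wreath_maps(5) is_vspace_tensor] lin_ssum[OF lin_wreath_maps(6) is_vspace_tensor]
  lin_ssum[OF lin_wreath_maps(7) is_vspace_tensor] lin_ssum[OF lin_assocs(1) is_vspace_tensor]
  lin_ssum[OF lin_assocs(2) is_vspace_tensor] lin_ssum[OF lin_assocs(3) is_vspace_tensor]
  lin_ssum[OF lin_assocs(4) is_vspace_tensor] lin_ssum[OF lin_assocs(5) is_vspace_tensor]
  lin_ssum[OF lin_assocs(6) is_vspace_tensor] lin_ssum[OF lin_assocs(7) is_vspace_tensor]
  tens_ssum lact_ssum ssum_mem

lemma lact_psi:
  assumes "a \<in> carr A" "b \<in> carr A" "h \<in> carr H"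
  shows "cv H lact (\<lambda>h. dot h a) (\<lambda>h. psi (tens H A h b)) h =
    cv H (tens A H) (cv H m (\<lambda>h. dot h a) (\<lambda>h. dot h b)) (\<lambda>h. h) h"
proof -
  have "cv H lact (\<lambda>h. dot h a) (\<lambda>h. psi (tens H A h b)) h =
      cv H lact (\<lambda>h. dot h a) (cv H (tens A H) (\<lambda>h. dot h b) (\<lambda>h. h)) h"
    using assms by (intro cv_cong refl) (simp add: psi_tens)
  also have "\<dots> = cv H (tens A H) (cv H m (\<lambda>h. dot h a) (\<lambda>h. dot h b)) (\<lambda>h. h) h"
    using assms by (intro cv_lact_tens[OF coalg_H] lin_dot lin_ident)
  finally show ?thesis .
qed

text \<open>
  Both sides have the form \<open>F(h\<^sub>1) \<otimes> h\<^sub>2\<close>, with \<open>F(h) = h \<cdot> (ab)\<close> and \<open>F(h) = (h\<^sub>1 \<cdot> a) (h\<^sub>2 \<cdot> b)\<close>.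
\<close>

lemma wreath_psi_mult_iff:
  "(\<forall>t\<in>carr (tensor H (tensor A A)). (psi \<circ> tmap H (tensor A A) H A id (tlift A A m)) t =
      (mX \<circ> Apsi \<circ> psiA \<circ> assoc_inv H Hc Ac Ac) t) \<longleftrightarrow>
    (\<forall>a\<in>carr A. \<forall>b\<in>carr A. \<forall>h\<in>carr H. dot h (m a b) = cv H m (\<lambda>h. dot h a) (\<lambda>h. dot h b) h)"
    (is "?L \<longleftrightarrow> ?R")
proof -
  have L1: "lin (tensor H (tensor A A)) AH (psi \<circ> tmap H (tensor A A) H A id (tlift A A m))"
    by (rule lin_comp_o[OF lin_tmap[OF lin_id lin_tlift_m vspace_H] lin_psi])
  have L2: "lin (tensor H (tensor A A)) AH (mX \<circ> Apsi \<circ> psiA \<circ> assoc_inv H Hc Ac Ac)"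
    by (rule lin_comp_o lin_assocs lin_wreath_maps)+
  have e1: "(psi \<circ> tmap H (tensor A A) H A id (tlift A A m)) (tens H (tensor A A) h (tens A A a b)) =
      cv H (tens A H) (\<lambda>h. dot h (m a b)) (\<lambda>h. h) h"
    if "h \<in> carr H" "a \<in> carr A" "b \<in> carr A" for h a b
    using that by (simp add: tmap_tens[OF lin_id lin_tlift_m vspace_H] psi_tens)
  have e2: "(mX \<circ> Apsi \<circ> psiA \<circ> assoc_inv H Hc Ac Ac) (tens H (tensor A A) h (tens A A a b)) =
      cv H (tens A H) (cv H m (\<lambda>h. dot h a) (\<lambda>h. dot h b)) (\<lambda>h. h) h"
    if "h \<in> carr H" "a \<in> carr A" "b \<in> carr A" for h a b
    using that lact_psi[of a b h] by (simp add: push cv_def)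
  have "(\<forall>h\<in>carr H. cv H (tens A H) (\<lambda>h. dot h (m a b)) (\<lambda>h. h) h =
        cv H (tens A H) (cv H m (\<lambda>h. dot h a) (\<lambda>h. dot h b)) (\<lambda>h. h) h) \<longleftrightarrow>
      (\<forall>h\<in>carr H. dot h (m a b) = cv H m (\<lambda>h. dot h a) (\<lambda>h. dot h b) h)"
    if "a \<in> carr A" "b \<in> carr A" for a b
    using that by (intro cv_tens_eq_iff[OF coalg_H coalgebra_hom_id[OF coalg_H]] lin_dot lin_cv_m[OF coalg_H] m_carr)
  then show ?thesis
    unfolding tensor_right_eq_iff[OF L1 L2 vspace_H vspace_A] by (simp add: e1 e2 del: o_apply) blast
qed

lemma lin_counit_A: "coalgebra C \<Longrightarrow> lin C A (\<lambda>c. scl A (counit C c) e)"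
  by (intro lin_bilin1[OF bilin_scl[OF vspace_A]] coalgebraD(3) e_carr)

lemma eta_X:
  assumes "h \<in> carr H"
  shows "(tmap k_space H A H (\<lambda>c. scl A c e) id \<circ> lunit_inv Hc) h = tens A H e h"
  using assms by (simp add: lunit_inv_def tmap_tens[OF lin_unit_A lin_id is_vspace_k_space] vspace_scale)

lemma tens_e_iff:
  assumes F: "lin H A F"
  shows "(\<forall>h\<in>carr H. cv H (tens A H) F (\<lambda>h. h) h = tens A H e h) \<longleftrightarrow> (\<forall>h\<in>carr H. F h = scl A (\<epsilon> h) e)"
  using cv_tens_eq_iff[OF coalg_H coalgebra_hom_id[OF coalg_H] F lin_counit_A[OF coalg_H]]
    cv_unit_tens[OF coalg_H lin_ident] by simp

lemma wreath_psi_unit_iff: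
  "(\<forall>h\<in>carr H. (psi \<circ> tmap H k_space H A id (\<lambda>c. scl A c e) \<circ> runit_inv Hc) h =
      (tmap k_space H A H (\<lambda>c. scl A c e) id \<circ> lunit_inv Hc) h) \<longleftrightarrow>
    (\<forall>h\<in>carr H. dot h e = scl A (\<epsilon> h) e)"
proof -
  have "(psi \<circ> tmap H k_space H A id (\<lambda>c. scl A c e) \<circ> runit_inv Hc) h =
      cv H (tens A H) (\<lambda>h. dot h e) (\<lambda>h. h) h" if "h \<in> carr H" for h
    using that
    by (simp add: runit_inv_def tmap_tens[OF lin_id lin_unit_A vspace_H] vspace_scale psi_tens)
  then show ?thesis
    by (simp add: eta_X tens_e_iff[OF lin_dot] del: o_apply)
qed

lemma psi_mult:
  assumes "a \<in> carr A" "x \<in> carr H2"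
  shows "psi (tens H A (mult H x) a) = cv HH (tens A H) (\<lambda>x. dot (mult H x) a) (mult H) x"
  using assms lin_mem[OF lin_mult]
    cv_coalgebra_hom[OF hom_mult coalg_HH coalg_H is_vspace_tensor _ lin_dot lin_ident bilin_tens]
  by (simp add: psi_tens)

text \<open>
  Both sides have the form \<open>F(h\<^sub>1, g\<^sub>1) \<otimes> h\<^sub>2g\<^sub>2\<close>, because the multiplication is a coalgebra map.
\<close>

lemma wreath_psi_zeta_iff:
  "(\<forall>t\<in>carr (tensor H2 A). (mX \<circ> Apsi \<circ> zetaA) t =
      (mX \<circ> Azeta \<circ> psiX \<circ> assoc_inv H Hc Ac Hc \<circ> tmap H (tensor H A) H AH id psi \<circ> assoc H Hc Hc Ac) t) \<longleftrightarrow>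
    (\<forall>a\<in>carr A. \<forall>x\<in>carr HH. cv HH m (dot2 a) \<tau> x = cv HH m \<tau> (\<lambda>x. dot (mult H x) a) x)"
proof -
  let ?L = "mX \<circ> Apsi \<circ> zetaA"
  let ?R = "mX \<circ> Azeta \<circ> psiX \<circ> assoc_inv H Hc Ac Hc \<circ> tmap H (tensor H A) H AH id psi \<circ> assoc H Hc Hc Ac"
  have L1: "lin (tensor H2 A) AH ?L"
    by (rule lin_comp_o lin_assocs lin_wreath_maps)+
  have L2: "lin (tensor H2 A) AH ?R"
    by (rule lin_comp_o lin_assocs lin_wreath_maps lin_tmap lin_id lin_psi vspace_H)+
  note lt = lin_cv_tens[OF coalg_HH, simplified] and lm = lin_cv_m[OF coalg_HH, simplified]
  have e1: "?L (tens H2 A x a) =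
      cv HH (tens A H) (cv HH m \<tau> (\<lambda>x. dot (mult H x) a)) (mult H) x"
    if x: "x \<in> carr H2" and a: "a \<in> carr A" for x a
  proof (rule tensor_ext[OF lin_comp[OF L1] _ vspace_H _ x])
    show "lin H2 (tensor H2 A) (\<lambda>x. tens H2 A x a)"
      by (rule bilin_lin1[OF bilin_tens a])
    show "lin H2 AH (cv HH (tens A H) (cv HH m \<tau> (\<lambda>x. dot (mult H x) a)) (mult H))"
      by (intro lt lm lin_tau lin_dot_mult lin_mult a)
    fix h g assume m: "h \<in> carr H" "g \<in> carr H"
    have "?L (tens H2 A (t2 h g) a) =
        ssum H h (\<lambda>h1 h2. ssum H g (\<lambda>g1 g2. lact (ta h1 g1) (psi (tens H A (mul H h2 g2) a))))"
      using m a by (simp add: push)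
    also have "\<dots> = cv HH lact \<tau> (cv HH (tens A H) (\<lambda>x. dot (mult H x) a) (mult H)) (t2 h g)"
      using m a
      by (simp add: cv_HH_tens[OF lin_tau lt[OF lin_dot_mult[OF a] lin_mult] bilin_lact is_vspace_tensor]
          psi_mult[symmetric] mul_def)
    also have "\<dots> = cv HH (tens A H) (cv HH m \<tau> (\<lambda>x. dot (mult H x) a)) (mult H) (t2 h g)"
      using m a lin_tau lin_dot_mult[OF a] lin_mult by (intro cv_lact_tens[OF coalg_HH]) simp_all
    finally show "?L (tens H2 A (t2 h g) a) = \<dots>" .
  qed
  have e2: "?R (tens H2 A x a) = cv HH (tens A H) (cv HH m (dot2 a) \<tau>) (mult H) x"
    if x: "x \<in> carr H2" and a: "a \<in> carr A" for x a
  proof (rule tensor_ext[OF lin_comp[OF L2] _ vspace_H _ x])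
    show "lin H2 (tensor H2 A) (\<lambda>x. tens H2 A x a)"
      by (rule bilin_lin1[OF bilin_tens a])
    show "lin H2 AH (cv HH (tens A H) (cv HH m (dot2 a) \<tau>) (mult H))"
      by (intro lt lm lin_tau lin_dot2 lin_mult a)
    fix h g assume m: "h \<in> carr H" "g \<in> carr H"
    have "?R (tens H2 A (t2 h g) a) =
        (mX \<circ> Azeta \<circ> psiX \<circ> assoc_inv H Hc Ac Hc) (tens H AH h (psi (tens H A g a)))"
      using m a by (simp add: tmap_tens[OF lin_id lin_psi vspace_H])
    also have "\<dots> = ssum H g (\<lambda>g1 g2. ssum H h (\<lambda>h1 h2. lact (dot h1 (dot g1 a)) (zeta (t2 h2 g2))))"
      using m a by (simp add: psi_ssum push)
    also have "\<dots> = ssum H h (\<lambda>h1 h2. ssum H g (\<lambda>g1 g2. lact (dot h1 (dot g1 a)) (zeta (t2 h2 g2))))"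
      by (rule ssum_swap)
    also have "\<dots> = cv HH lact (dot2 a) (cv HH (tens A H) \<tau> (mult H)) (t2 h g)"
      using m a
      by (simp add: cv_HH_tens[OF lin_dot2[OF a] lin_cv_zeta bilin_lact is_vspace_tensor] zeta_cv)
    also have "\<dots> = cv HH (tens A H) (cv HH m (dot2 a) \<tau>) (mult H) (t2 h g)"
      using m a lin_tau lin_dot2[OF a] lin_mult by (intro cv_lact_tens[OF coalg_HH]) simp_all
    finally show "?R (tens H2 A (t2 h g) a) = \<dots>" .
  qed
  have "(\<forall>x\<in>carr HH. cv HH (tens A H) (cv HH m \<tau> (\<lambda>x. dot (mult H x) a)) (mult H) x =
        cv HH (tens A H) (cv HH m (dot2 a) \<tau>) (mult H) x) \<longleftrightarrow>
      (\<forall>x\<in>carr HH. cv HH m \<tau> (\<lambda>x. dot (mult H x) a) x = cv HH m (dot2 a) \<tau> x)"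
    if "a \<in> carr A" for a
    using that lm lin_tau lin_dot_mult lin_dot2
    by (intro cv_tens_eq_iff[OF coalg_HH hom_mult]) simp_all
  then show ?thesis
    unfolding tensor_eq_iff[OF L1 L2 is_vspace_tensor] by (simp add: e1 e2 del: o_apply) metis
qed

text \<open>
  The two sides at \<open>a\<close> are \<open>a \<otimes> 1\<close> and \<open>(1 \<cdot> a) \<otimes> 1\<close>.
\<close>

lemma wreath_sigma_iff:
  "(\<forall>a\<in>carr A. (mX \<circ> (tmap A k_space A AH id sigma \<circ> runit_inv Ac)) a =
      (mX \<circ> Apsi \<circ> (assoc H Ac Hc Ac \<circ> tmap k_space A AH A sigma id \<circ> lunit_inv Ac)) a) \<longleftrightarrow>
    (\<forall>a\<in>carr A. dot (one H) a = a)"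
proof -
  have s: "sigma 1 = tens A H e (one H)" by (simp add: sigma_eq vspace_scale)
  have e1: "(mX \<circ> (tmap A k_space A AH id sigma \<circ> runit_inv Ac)) a = tens A H a (one H)"
    if "a \<in> carr A" for a
    using that by (simp add: runit_inv_def tmap_tens[OF lin_id lin_sigma vspace_A] s)
  have p: "psi (tens H A (one H) a) = tens A H (dot (one H) a) (one H)" if "a \<in> carr A" for a
    using that by (simp add: psi_ssum, subst ssum_one[OF is_vspace_tensor]) (auto intro!: lin_all)
  have e2: "(mX \<circ> Apsi \<circ> (assoc H Ac Hc Ac \<circ> tmap k_space A AH A sigma id \<circ> lunit_inv Ac)) a =
      tens A H (dot (one H) a) (one H)" if "a \<in> carr A" for a
    using that by (simp add: lunit_inv_def tmap_tens[OF lin_sigma lin_id is_vspace_k_space] s p)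
  have "tens A H a (one H) = tens A H b (one H) \<longleftrightarrow> a = b" if m: "a \<in> carr A" "b \<in> carr A" for a b
  proof
    have bl: "bilin A H A (\<lambda>a h. scl A (\<epsilon> h) a)" by (auto intro!: lin_all)
    assume "tens A H a (one H) = tens A H b (one H)"
    then have "tlift A H (\<lambda>a h. scl A (\<epsilon> h) a) (tens A H a (one H)) =
        tlift A H (\<lambda>a h. scl A (\<epsilon> h) a) (tens A H b (one H))" by simp
    then show "a = b"
      using m by (simp add: tensor_universal(2)[OF vspace_A vspace_A bl] vspace_scale)
  qed simp
  then show ?thesis by (auto simp: e1 e2 simp del: o_apply)
qed

lemma zeta_one:
  assumes "h \<in> carr H"
  shows "zeta (t2 h (one H)) = cv H (tens A H) (\<lambda>h. ta h (one H)) (\<lambda>h. h) h"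
    and "zeta (t2 (one H) h) = cv H (tens A H) (\<lambda>h. ta (one H) h) (\<lambda>h. h) h"
proof -
  have "zeta (t2 h (one H)) = ssum H h (\<lambda>h1 h2. tens A H (ta h1 (one H)) (mul H h2 (one H)))"
    unfolding zeta_tens[OF assms one_carr]
    by (intro ssum_cong[OF refl refl] ssum_one[OF is_vspace_tensor]) (auto intro!: lin_all)
  then show "zeta (t2 h (one H)) = cv H (tens A H) (\<lambda>h. ta h (one H)) (\<lambda>h. h) h"
    by (simp add: cv_def)
  have "zeta (t2 (one H) h) = ssum H h (\<lambda>h1 h2. tens A H (ta (one H) h1) (mul H (one H) h2))"
    unfolding zeta_tens[OF one_carr assms]
    by (rule ssum_one[OF is_vspace_tensor]) (auto intro!: lin_all)
  then show "zeta (t2 (one H) h) = cv H (tens A H) (\<lambda>h. ta (one H) h) (\<lambda>h. h) h"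
    by (simp add: cv_def)
qed

lemma lin_ta:
  "lin H A (\<lambda>h. ta h (one H))" "lin H A (\<lambda>h. ta (one H) h)"
  by (auto intro!: lin_all)

text \<open>
  The left side at \<open>h\<close> is \<open>(h\<^sub>1 \<cdot> 1) \<tau>(h\<^sub>2, 1) \<otimes> h\<^sub>3\<close>; the hypothesis turns \<open>h\<^sub>1 \<cdot> 1\<close> into a counit.
\<close>

lemma wreath_zeta_sigma_left_iff:
  assumes unit: "\<forall>h\<in>carr H. dot h e = scl A (\<epsilon> h) e"
  shows "(\<forall>h\<in>carr H. (mX \<circ> Azeta \<circ> psiX \<circ> assoc_inv H Hc Ac Hc \<circ>
        (tmap H k_space H AH id sigma \<circ> runit_inv Hc)) h =
      (tmap k_space H A H (\<lambda>c. scl A c e) id \<circ> lunit_inv Hc) h) \<longleftrightarrow>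
    (\<forall>h\<in>carr H. ta h (one H) = scl A (\<epsilon> h) e)"
proof -
  have s: "sigma 1 = tens A H e (one H)" by (simp add: sigma_eq vspace_scale)
  have "(mX \<circ> Azeta \<circ> psiX \<circ> assoc_inv H Hc Ac Hc \<circ> (tmap H k_space H AH id sigma \<circ> runit_inv Hc)) h =
      cv H (tens A H) (\<lambda>h. ta h (one H)) (\<lambda>h. h) h" if h: "h \<in> carr H" for h
  proof -
    have "(mX \<circ> Azeta \<circ> psiX \<circ> assoc_inv H Hc Ac Hc \<circ> (tmap H k_space H AH id sigma \<circ> runit_inv Hc)) h =
        ssum H h (\<lambda>h1 h2. lact (dot h1 e) (zeta (t2 h2 (one H))))"
      using h by (simp add: runit_inv_def tmap_tens[OF lin_id lin_sigma vspace_H] s push)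
    also have "\<dots> = cv H lact (\<lambda>h. scl A (\<epsilon> h) e) (cv H (tens A H) (\<lambda>h. ta h (one H)) (\<lambda>h. h)) h"
      unfolding cv_def[of H lact] using unit by (intro ssum_cong[OF refl refl]) (simp add: zeta_one)
    also have "\<dots> = cv H (tens A H) (cv H m (\<lambda>h. scl A (\<epsilon> h) e) (\<lambda>h. ta h (one H))) (\<lambda>h. h) h"
      by (rule cv_lact_tens[OF coalg_H h lin_counit_A[OF coalg_H] lin_ta(1) lin_ident])
    also have "\<dots> = cv H (tens A H) (\<lambda>h. ta h (one H)) (\<lambda>h. h) h"
      using cv_unit[OF coalg_H _ lin_ta(1)] by (intro cv_cong) simp_all
    finally show ?thesis .
  qed
  then show ?thesis
    by (simp add: eta_X tens_e_iff[OF lin_ta(1)] del: o_apply)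
qed

lemma wreath_zeta_sigma_right_iff:
  "(\<forall>h\<in>carr H. (mX \<circ> Azeta \<circ> (assoc H Ac Hc Hc \<circ> tmap k_space H AH H sigma id \<circ> lunit_inv Hc)) h =
      (tmap k_space H A H (\<lambda>c. scl A c e) id \<circ> lunit_inv Hc) h) \<longleftrightarrow>
    (\<forall>h\<in>carr H. ta (one H) h = scl A (\<epsilon> h) e)"
proof -
  have s: "sigma 1 = tens A H e (one H)" by (simp add: sigma_eq vspace_scale)
  have "(mX \<circ> Azeta \<circ> (assoc H Ac Hc Hc \<circ> tmap k_space H AH H sigma id \<circ> lunit_inv Hc)) h =
      cv H (tens A H) (\<lambda>h. ta (one H) h) (\<lambda>h. h) h" if h: "h \<in> carr H" for h
    using h by (simp add: lunit_inv_def tmap_tens[OF lin_sigma lin_id is_vspace_k_space] s lact_one zeta_one(2)[symmetric])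
  then show ?thesis
    by (simp add: eta_X tens_e_iff[OF lin_ta(2)] del: o_apply)
qed

end

context crossed_data
begin

abbreviation "mult3 \<equiv> (\<lambda>x. mult H (mul_left x))"
abbreviation "mult3' \<equiv> (\<lambda>x. mult H (mul_right x))"

lemma lin_mult3:
  "lin H3 H mult3" "lin H3 H mult3'"
  by (intro lin_comp[OF lin_mult] lin_homs)+

lemma quasi_assoc_cv:
  assumes "x \<in> carr H3"
  shows "cv HHH (\<lambda>h c. scl H c h) mult3' (reass H) x = cv HHH (scl H) (reass H) mult3 x"
proof (rule tensor_left_eq_iff[THEN iffD2, rule_format, OF _ _ vspace_H _ assms])
  show "lin H3 H (cv HHH (\<lambda>h c. scl H c h) mult3' (reass H))"
    using lin_cv[OF coalg_HHH vspace_H _ _ bilin_scl_right[OF vspace_H]] lin_mult3 lin_reass by simp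
  show "lin H3 H (cv HHH (scl H) (reass H) mult3)"
    using lin_cv[OF coalg_HHH vspace_H _ _ bilin_scl[OF vspace_H]] lin_mult3 lin_reass by simp
  fix h g l assume "h \<in> carr H" "g \<in> carr H" "l \<in> carr H"
  then show "cv HHH (\<lambda>h c. scl H c h) mult3' (reass H) (t3 h g l) = cv HHH (scl H) (reass H) mult3 (t3 h g l)"
    using quasi_assoc[of h g l]
    by (simp add: cv_HHH_tens[OF lin_mult3(2) lin_reass bilin_scl_right[OF vspace_H] vspace_H]
        cv_HHH_tens[OF lin_reass lin_mult3(1) bilin_scl[OF vspace_H] vspace_H] phi_def mul_def)
qed

text \<open>
  The constraint of three copies of \<open>H\<close> produces \<open>\<phi>\<close> next to the product \<open>h(gl)\<close>.  Quasi-associativity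
  exchanges the two and rebrackets the product, after which \<open>\<phi>\<close> stands next to the coefficient in \<open>A\<close>,
  where the cocycle condition can absorb it.
\<close>

lemma shift_phi:
  assumes F: "lin H3 A F" and x: "x \<in> carr HHH"
  shows "cv HHH (\<lambda>y c. scl AH c y) (cv HHH (tens A H) F mult3') (reass H) x =
    cv HHH (tens A H) (cv HHH scr F (reass H)) mult3 x"
proof -
  have ts: "tens A H (scl A c a) h = tens A H a (scl H c h)" "scl AH c (tens A H a h) = tens A H a (scl H c h)"
    if "a \<in> carr A" "h \<in> carr H" for a h c
    using that lin_scl[OF bilin_lin2[OF bilin_tens[of A H]]] by (simp_all add: scl_tens[symmetric])
  have "cv HHH (\<lambda>y c. scl AH c y) (cv HHH (tens A H) F mult3') (reass H) x =
      cv HHH (tens A H) F (cv HHH (\<lambda>h c. scl H c h) mult3' (reass H)) x"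
    by (rule cv_assoc[OF coalg_HHH x is_vspace_tensor is_vspace_tensor vspace_H _ _ _ bilin_tens
          bilin_scl_right[OF is_vspace_tensor] bilin_scl_right[OF vspace_H] bilin_tens])
      (simp_all add: F lin_mult3 lin_reass ts)
  also have "\<dots> = cv HHH (tens A H) F (cv HHH (scl H) (reass H) mult3) x"
    by (rule cv_cong) (simp_all add: quasi_assoc_cv)
  also have "\<dots> = cv HHH (tens A H) (cv HHH scr F (reass H)) mult3 x"
    by (rule cv_assoc[OF coalg_HHH x is_vspace_tensor vspace_A vspace_H _ _ _
          bilin_scl_right[OF vspace_A] bilin_tens bilin_scl[OF vspace_H] bilin_tens, symmetric])
      (simp_all add: F lin_mult3 lin_reass ts)
  finally show ?thesis .
qed

lemma zeta_mul:
  assumes "x \<in> carr H3"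
  shows "zeta (mul_left x) = cv HHH (tens A H) (\<lambda>x. \<tau> (mul_left x)) mult3 x"
    and "zeta (mul_right x) = cv HHH (tens A H) (\<lambda>x. \<tau> (mul_right x)) mult3' x"
  using assms
    cv_coalgebra_hom[where f = \<tau> and g = "mult H" and x = x,
      OF coalgebra_hom_mul_left coalg_HHH coalg_HH is_vspace_tensor _ _ _ bilin_tens, of A H]
    cv_coalgebra_hom[where f = \<tau> and g = "mult H" and x = x,
      OF coalgebra_hom_mul_right coalg_HHH coalg_HH is_vspace_tensor _ _ _ bilin_tens, of A H]
  by (simp_all add: zeta_cv lin_mem[OF lin_homs(1)] lin_mem[OF lin_homs(2)] lin_tau lin_mult)

lemma lin_zeta_mul:
  "lin H3 AH (\<lambda>x. zeta (mul_left x))"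
  "lin H3 AH (\<lambda>x. zeta (mul_right x))"
  by (intro lin_comp[OF lin_zeta] lin_homs)+

lemma lact_zeta_mul:
  assumes F: "lin H3 A F" and x: "x \<in> carr HHH"
  shows "cv HHH lact F (\<lambda>x. zeta (mul_left x)) x =
      cv HHH (tens A H) (cv HHH m F (\<lambda>x. \<tau> (mul_left x))) mult3 x"
    and "cv HHH lact F (\<lambda>x. zeta (mul_right x)) x =
      cv HHH (tens A H) (cv HHH m F (\<lambda>x. \<tau> (mul_right x))) mult3' x"
proof -
  have "cv HHH lact F (\<lambda>x. zeta (mul_left x)) x = cv HHH lact F (cv HHH (tens A H) (\<lambda>x. \<tau> (mul_left x)) mult3) x"
    by (rule cv_cong) (simp_all add: zeta_mul)
  then show "cv HHH lact F (\<lambda>x. zeta (mul_left x)) x =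
      cv HHH (tens A H) (cv HHH m F (\<lambda>x. \<tau> (mul_left x))) mult3 x"
    using cv_lact_tens[OF coalg_HHH x] F lin_tau3 lin_mult3 by simp
  have "cv HHH lact F (\<lambda>x. zeta (mul_right x)) x = cv HHH lact F (cv HHH (tens A H) (\<lambda>x. \<tau> (mul_right x)) mult3') x"
    by (rule cv_cong) (simp_all add: zeta_mul)
  then show "cv HHH lact F (\<lambda>x. zeta (mul_right x)) x =
      cv HHH (tens A H) (cv HHH m F (\<lambda>x. \<tau> (mul_right x))) mult3' x"
    using cv_lact_tens[OF coalg_HHH x] F lin_tau3 lin_mult3 by simp
qed

text \<open>
  The two sides are \<open>X(x\<^sub>1) \<otimes> h(gl) \<phi>(x\<^sub>3)\<close> and \<open>Y(x\<^sub>1) \<otimes> (hg)l\<close>, where \<open>x\<close> stands for \<open>h \<otimes> g \<otimes> l\<close>,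
  \<open>X\<close> and \<open>Y\<close> are the two sides of the cocycle condition, and the product is taken at \<open>x\<^sub>2\<close>.  Moving
  \<open>\<phi>\<close> to the coefficient leaves \<open>X * \<phi> = Y\<close>.
\<close>

lemma wreath_zeta_zeta_iff:
  "(\<forall>t\<in>carr H3.
      (mX \<circ> Azeta \<circ> psiX \<circ> assoc_inv H Hc Ac Hc \<circ> tmap H H2 H AH id zeta \<circ> assoc H Hc Hc Hc) t =
      (mX \<circ> Azeta \<circ> zetaX) t) \<longleftrightarrow>
    (\<forall>x\<in>carr HHH. cv HHH scr cocycle_l (reass H) x = cocycle_r x)"
proof -
  let ?P = "mX \<circ> Azeta \<circ> psiX \<circ> assoc_inv H Hc Ac Hc \<circ> tmap H H2 H AH id zeta"
  let ?L = "?P \<circ> assoc H Hc Hc Hc" and ?R = "mX \<circ> Azeta \<circ> zetaX"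
  have LP: "lin (tensor H H2) AH ?P"
    by (rule lin_comp_o lin_assocs lin_wreath_maps lin_tmap lin_id lin_zeta vspace_H)+
  have L1: "lin H3 AH ?L"
    by (rule lin_comp_o[OF lin_assocs(4) LP])
  have L2: "lin H3 AH ?R"
    by (rule lin_comp_o lin_assocs lin_wreath_maps)+
  note lt = lin_cv_tens[OF coalg_HHH, simplified] and ls = lin_cv_scr[OF coalg_HHH, simplified]
  note lsa = lin_cv[OF coalg_HHH is_vspace_tensor _ _ bilin_scl_right[OF is_vspace_tensor], simplified]
  have P: "?P (tens H H2 h (t2 g l)) =
      cv HHH (tens A H) cocycle_l mult3' (t3 h g l)" if m: "h \<in> carr H" "g \<in> carr H" "l \<in> carr H" for h g l
  proof -
    have "?P (tens H H2 h (t2 g l)) =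
        (mX \<circ> Azeta \<circ> psiX \<circ> assoc_inv H Hc Ac Hc) (tens H AH h (zeta (t2 g l)))"
      using m by (simp add: tmap_tens[OF lin_id lin_zeta vspace_H])
    also have "\<dots> = ssum H g (\<lambda>g1 g2. ssum H l (\<lambda>l1 l2. ssum H h (\<lambda>h1 h2.
        lact (dot h1 (ta g1 l1)) (zeta (t2 h2 (mul H g2 l2))))))"
      using m by (simp add: zeta_tens push)
    also have "\<dots> = ssum H g (\<lambda>g1 g2. ssum H h (\<lambda>h1 h2. ssum H l (\<lambda>l1 l2.
        lact (dot h1 (ta g1 l1)) (zeta (t2 h2 (mul H g2 l2))))))"
      by (rule ssum_cong[OF refl refl]) (rule ssum_swap)
    also have "\<dots> = ssum H h (\<lambda>h1 h2. ssum H g (\<lambda>g1 g2. ssum H l (\<lambda>l1 l2.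
        lact (dot h1 (ta g1 l1)) (zeta (t2 h2 (mul H g2 l2))))))"
      by (rule ssum_swap)
    also have "\<dots> = cv HHH lact dot_tau (\<lambda>x. zeta (mul_right x)) (t3 h g l)"
      using m by (simp add: cv_HHH_tens[OF lin_dot_tau lin_zeta_mul(2) bilin_lact is_vspace_tensor])
    also have "\<dots> = cv HHH (tens A H) cocycle_l mult3' (t3 h g l)"
      unfolding cocycle_l_def using m by (intro lact_zeta_mul(2) lin_dot_tau) simp
    finally show ?thesis .
  qed
  have e1: "?L t = cv HHH (tens A H) (cv HHH scr cocycle_l (reass H)) mult3 t"
    if t: "t \<in> carr H3" for t
  proof (rule tensor_left_eq_iff[THEN iffD2, rule_format, OF L1 _ vspace_H _ t])
    show "lin H3 AH (cv HHH (tens A H) (cv HHH scr cocycle_l (reass H)) mult3)"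
      by (intro lt ls lin_cocycle lin_reass lin_mult3)
    fix h g l assume m: "h \<in> carr H" "g \<in> carr H" "l \<in> carr H"
    have "?L (t3 h g l) = ?P (ssum H h (\<lambda>h1 h2. ssum H g (\<lambda>g1 g2. ssum H l (\<lambda>l1 l2.
        scl (tensor H H2) (phi H h2 g2 l2) (tens H H2 h1 (t2 g1 l1))))))"
      using m assoc_tens[of Hc Hc Hc h g l] by simp
    also have "\<dots> = ssum H h (\<lambda>h1 h2. ssum H g (\<lambda>g1 g2. ssum H l (\<lambda>l1 l2.
        scl AH (phi H h2 g2 l2) (?P (tens H H2 h1 (t2 g1 l1))))))"
      by (simp add: lin_ssum[OF LP is_vspace_tensor] lin_scl[OF LP] ssum_mem is_vspace_closed(3)
          del: o_apply)
    also have "\<dots> = ssum H h (\<lambda>h1 h2. ssum H g (\<lambda>g1 g2. ssum H l (\<lambda>l1 l2.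
        scl AH (phi H h2 g2 l2) (cv HHH (tens A H) cocycle_l mult3' (t3 h1 g1 l1)))))"
      by (intro ssum_cong refl) (simp only: P)
    also have "\<dots> = cv HHH (\<lambda>y c. scl AH c y) (cv HHH (tens A H) cocycle_l mult3') (reass H) (t3 h g l)"
      using m cv_HHH_tens[OF lt[OF lin_cocycle(1) lin_mult3(2)] lin_reass bilin_scl_right[OF is_vspace_tensor]
          is_vspace_tensor m] by (simp add: phi_def)
    also have "\<dots> = cv HHH (tens A H) (cv HHH scr cocycle_l (reass H)) mult3 (t3 h g l)"
      using m by (intro shift_phi lin_cocycle) simp
    finally show "?L (t3 h g l) = \<dots>" .
  qed
  have e2: "?R t = cv HHH (tens A H) cocycle_r mult3 t" if t: "t \<in> carr H3" for t
  proof (rule tensor_left_eq_iff[THEN iffD2, rule_format, OF L2 _ vspace_H _ t])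
    show "lin H3 AH (cv HHH (tens A H) cocycle_r mult3)"
      by (intro lt lin_cocycle lin_mult3)
    fix h g l assume m: "h \<in> carr H" "g \<in> carr H" "l \<in> carr H"
    have "?R (t3 h g l) = ssum H h (\<lambda>h1 h2. ssum H g (\<lambda>g1 g2.
        lact (ta h1 g1) (zeta (t2 (mul H h2 g2) l))))"
      using m by (simp add: push)
    also have "\<dots> = cv HHH lact (\<lambda>x. \<tau> (drop3 x)) (\<lambda>x. zeta (mul_left x)) (t3 h g l)"
      using m by (simp add: cv_drop3_tens[OF lin_tau lin_zeta_mul(1) bilin_lact vspace_A is_vspace_tensor])
    also have "\<dots> = cv HHH (tens A H) cocycle_r mult3 (t3 h g l)"
      unfolding cocycle_r_def using m by (intro lact_zeta_mul(1) lin_tau3) simp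
    finally show "?R (t3 h g l) = \<dots>" .
  qed
  have "(\<forall>x\<in>carr HHH. cv HHH (tens A H) (cv HHH scr cocycle_l (reass H)) mult3 x =
        cv HHH (tens A H) cocycle_r mult3 x) \<longleftrightarrow>
      (\<forall>x\<in>carr HHH. cv HHH scr cocycle_l (reass H) x = cocycle_r x)"
    using ls lin_cocycle lin_reass
    by (intro cv_tens_eq_iff[OF coalg_HHH coalgebra_hom_comp[OF coalgebra_hom_mul_left hom_mult coalg_HHH coalg_HH]])
      simp_all
  then show ?thesis by (simp add: e1 e2 del: o_apply)
qed

theorem wreath_iff_crossed_system:
  "wreath H Ac Hc psi zeta sigma \<longleftrightarrow> crossed_system H A act \<tau>"
proof -
  have "wreath H Ac Hc psi zeta sigma \<longleftrightarrow>
    (\<forall>t\<in>carr (tensor H (tensor A A)). (psi \<circ> tmap H (tensor A A) H A id (tlift A A m)) t =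
      (mX \<circ> Apsi \<circ> psiA \<circ> assoc_inv H Hc Ac Ac) t) \<and>
    (\<forall>h\<in>carr H. (psi \<circ> tmap H k_space H A id (\<lambda>c. scl A c e) \<circ> runit_inv Hc) h =
      (tmap k_space H A H (\<lambda>c. scl A c e) id \<circ> lunit_inv Hc) h) \<and>
    (\<forall>t\<in>carr (tensor H2 A). (mX \<circ> Apsi \<circ> zetaA) t =
      (mX \<circ> Azeta \<circ> psiX \<circ> assoc_inv H Hc Ac Hc \<circ> tmap H (tensor H A) H AH id psi \<circ> assoc H Hc Hc Ac) t) \<and>
    (\<forall>t\<in>carr H3.
      (mX \<circ> Azeta \<circ> psiX \<circ> assoc_inv H Hc Ac Hc \<circ> tmap H H2 H AH id zeta \<circ> assoc H Hc Hc Hc) t =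
      (mX \<circ> Azeta \<circ> zetaX) t) \<and>
    (\<forall>a\<in>carr A. (mX \<circ> (tmap A k_space A AH id sigma \<circ> runit_inv Ac)) a =
      (mX \<circ> Apsi \<circ> (assoc H Ac Hc Ac \<circ> tmap k_space A AH A sigma id \<circ> lunit_inv Ac)) a) \<and>
    (\<forall>h\<in>carr H. (mX \<circ> Azeta \<circ> psiX \<circ> assoc_inv H Hc Ac Hc \<circ>
        (tmap H k_space H AH id sigma \<circ> runit_inv Hc)) h =
      (tmap k_space H A H (\<lambda>c. scl A c e) id \<circ> lunit_inv Hc) h) \<and>
    (\<forall>h\<in>carr H. (mX \<circ> Azeta \<circ> (assoc H Ac Hc Hc \<circ> tmap k_space H AH H sigma id \<circ> lunit_inv Hc)) h =
      (tmap k_space H A H (\<lambda>c. scl A c e) id \<circ> lunit_inv Hc) h)"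
    unfolding wreath_def Let_def mX_def Apsi_def Azeta_def psiA_def psiX_def zetaA_def zetaX_def eq_arr_def
    using comod_algebra_Ac comodule_Hc comod_hom_psi comod_hom_zeta comod_hom_sigma
    by (simp del: o_apply)
  also have "\<dots> \<longleftrightarrow> crossed_system H A act \<tau>"
    unfolding crossed_system_iff wreath_psi_mult_iff wreath_psi_unit_iff wreath_psi_zeta_iff
      wreath_zeta_zeta_iff wreath_sigma_iff wreath_zeta_sigma_right_iff
    using wreath_zeta_sigma_left_iff by blast
  finally show ?thesis .
qed

end

section \<open>The crossed product\<close>

context crossed_data
begin

abbreviation "CP \<equiv> crossed_product H A act \<tau>"
abbreviation "prd x y \<equiv> amult CP (tens AH AH x y)"

text \<open>
  \<open>coef b\<close> is the coefficient of the crossed multiplication: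
  \<open>(a \<otimes> h)(b \<otimes> g) = a coef b (h\<^sub>1, g\<^sub>1) \<otimes> h\<^sub>2g\<^sub>2\<close>.
\<close>

definition "dot_drop b = (\<lambda>x. dot (drop2 x) b)"
definition "coef b = cv HH m (dot_drop b) \<tau>"

lemma lin_dot_drop: "b \<in> carr A \<Longrightarrow> lin H2 A (dot_drop b)"
  unfolding dot_drop_def by (rule lin_comp[OF lin_dot lin_drop2])

lemma lin_coef: "b \<in> carr A \<Longrightarrow> lin H2 A (coef b)"
  unfolding coef_def using lin_cv_m[OF coalg_HH] lin_dot_drop lin_tau by simp

lemma cv_dot_drop_tens:
  assumes G: "lin H2 V G" and op: "bilin A V Z op" and Z: "is_vspace Z"
    and m: "h \<in> carr H" "g \<in> carr H" "b \<in> carr A"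
  shows "cv HH op (dot_drop b) G (t2 h g) = ssum H h (\<lambda>h1 h2. op (dot h1 b) (G (t2 h2 g)))"
proof -
  have memG: "G (t2 h g) \<in> carr V" if "h \<in> carr H" "g \<in> carr H" for h g
    using that by (intro lin_mem[OF G]) simp
  have "cv HH op (dot_drop b) G (t2 h g) = ssum H h (\<lambda>h1 h2. ssum H g (\<lambda>g1 g2.
      scl Z (\<epsilon> g1) (op (dot h1 b) (G (t2 h2 g2)))))"
    unfolding cv_HH_tens[OF lin_dot_drop[OF m(3)] G op Z m(1,2)]
    by (intro ssum_cong refl)
      (simp add: dot_drop_def lin_scl[OF lin_dot] lin_scl[OF bilin_lin1[OF op]] memG m)
  also have "\<dots> = ssum H h (\<lambda>h1 h2. op (dot h1 b) (G (t2 h2 g)))"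
    using m by (intro ssum_cong[OF refl refl] ssum_counit_H(1)[OF Z])
      (auto intro!: lin_bilin2[OF op] lin_comp[OF G] lin_bilin2[OF bilin_tens] lin_ident)
  finally show ?thesis .
qed

lemma coef_tens:
  assumes "h \<in> carr H" "g \<in> carr H" "b \<in> carr A"
  shows "coef b (t2 h g) = ssum H h (\<lambda>h1 h2. m (dot h1 b) (ta h2 g))"
  unfolding coef_def by (rule cv_dot_drop_tens[OF lin_tau bilin_m vspace_A assms])

lemma lin_cv_coef: "b \<in> carr A \<Longrightarrow> lin H2 AH (cv HH (tens A H) (coef b) (mult H))"
  using lin_cv_tens[OF coalg_HH] lin_coef lin_mult by simp

lemma cv_coef_tens:
  assumes m: "h \<in> carr H" "g \<in> carr H" "b \<in> carr A"
  shows "cv HH (tens A H) (coef b) (mult H) (t2 h g) =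
    ssum H h (\<lambda>h1 h2. lact (dot h1 b) (zeta (t2 h2 g)))"
proof -
  have "cv HH (tens A H) (coef b) (mult H) (t2 h g) = cv HH lact (dot_drop b) (cv HH (tens A H) \<tau> (mult H)) (t2 h g)"
    unfolding coef_def using m lin_dot_drop lin_tau lin_mult
    by (intro cv_lact_tens[OF coalg_HH, symmetric]) simp_all
  also have "\<dots> = ssum H h (\<lambda>h1 h2. lact (dot h1 b) (zeta (t2 h2 g)))"
    using m by (simp add: cv_dot_drop_tens[OF lin_cv_zeta bilin_lact is_vspace_tensor] zeta_cv)
  finally show ?thesis .
qed

subsection \<open>Multiplication on pure tensors\<close>

text \<open>
  The product of \<open>a \<otimes> h\<close> and \<open>b \<otimes> g\<close>.  In this form it is visibly linear in \<open>a\<close>, \<open>h\<close> and \<open>g\<close>.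
\<close>

definition "prd4 a h b g = lact a (cv HH (tens A H) (coef b) (mult H) (t2 h g))"

lemma prd4_eq:
  assumes m: "a \<in> carr A" "h \<in> carr H" "b \<in> carr A" "g \<in> carr H"
  shows "prd4 a h b g = ssum H h (\<lambda>h1 h'. lact (m a (dot h1 b)) (zeta (t2 h' g)))"
    and "prd4 a h b g = sw3 H h (\<lambda>h1 h2 h3. sw H g (\<lambda>g1 g2.
      tens A H (m (m a (dot h1 b)) (ta h2 g1)) (mul H h3 g2)))"
proof -
  show 1: "prd4 a h b g = ssum H h (\<lambda>h1 h'. lact (m a (dot h1 b)) (zeta (t2 h' g)))"
    unfolding prd4_def using m by (simp add: cv_coef_tens lact_ssum lact_mult)
  also have "\<dots> = ssum H h (\<lambda>h1 h'. ssum H h' (\<lambda>h2 h3. ssum H g (\<lambda>g1 g2.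
      tens A H (m (m a (dot h1 b)) (ta h2 g1)) (mul H h3 g2))))"
    using m by (simp add: zeta_tens lact_ssum ssum_mem)
  also have "\<dots> = sw3 H h (\<lambda>h1 h2 h3. sw H g (\<lambda>g1 g2.
      tens A H (m (m a (dot h1 b)) (ta h2 g1)) (mul H h3 g2)))"
    unfolding sw3_def using m
    by (intro sym[OF sw_eqI[OF coalg_H is_vspace_tensor]] sw_eqI[OF coalg_H is_vspace_tensor] refl)
      (auto intro!: lin_all)
  finally show "prd4 a h b g = sw3 H h (\<lambda>h1 h2 h3. sw H g (\<lambda>g1 g2.
      tens A H (m (m a (dot h1 b)) (ta h2 g1)) (mul H h3 g2)))" .
qed

lemma lin_prd4:
  assumes m: "a \<in> carr A" "h \<in> carr H" "b \<in> carr A" "g \<in> carr H"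
  shows "lin A AH (\<lambda>a. prd4 a h b g)" "lin H AH (\<lambda>h. prd4 a h b g)"
    "lin A AH (\<lambda>b. prd4 a h b g)" "lin H AH (\<lambda>g. prd4 a h b g)"
proof -
  show "lin A AH (\<lambda>a. prd4 a h b g)"
    unfolding prd4_def using m by (intro bilin_lin1[OF bilin_lact] lin_mem[OF lin_cv_coef]) simp_all
  show "lin H AH (\<lambda>h. prd4 a h b g)" "lin H AH (\<lambda>g. prd4 a h b g)"
    unfolding prd4_def using m
    by (intro lin_bilin2[OF bilin_lact] lin_comp[OF lin_cv_coef] bilin_lin1[OF bilin_tens] bilin_lin2[OF bilin_tens]; simp)+
  show "lin A AH (\<lambda>b. prd4 a h b g)"
    by (subst lin_cong[where g = "\<lambda>b. ssum H h (\<lambda>h1 h'. lact (m a (dot h1 b)) (zeta (t2 h' g)))"])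
      (use m in \<open>auto intro!: lin_all simp: prd4_eq\<close>)
qed

lemma amult_eq: "amult CP = tlift AH AH (\<lambda>x y. tlift A H (\<lambda>a h. tlift A H (\<lambda>b g. prd4 a h b g) y) x)"
  unfolding crossed_product_def Let_def comod_alg.simps
  by (intro tlift_cong fun_cong[OF tlift_cong]) (simp add: prd4_eq(2))

lemma bilin_amult: "bilin AH AH AH (\<lambda>x y. tlift A H (\<lambda>a h. tlift A H (\<lambda>b g. prd4 a h b g) y) x)"
proof (rule bilin_tlift_left[OF vspace_A vspace_H is_vspace_tensor is_vspace_tensor])
  have 1: "trilin A A H AH (\<lambda>a b g. prd4 a h b g)" if "h \<in> carr H" for h
    using that by (intro trilinI lin_prd4)
  have 2: "trilin H A H AH (\<lambda>h b g. prd4 a h b g)" if "a \<in> carr A" for a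
    using that by (intro trilinI lin_prd4)
  show "trilin A H AH AH (\<lambda>a h. tlift A H (\<lambda>b g. prd4 a h b g))"
  proof (rule trilinI)
    show "lin A AH (\<lambda>a. tlift A H (prd4 a h) y)" if "h \<in> carr H" "y \<in> carr AH" for h y
      using bilin_lin1[OF bilin_tlift_right[OF vspace_A vspace_A vspace_H is_vspace_tensor 1[OF that(1)]] that(2)] .
    show "lin H AH (\<lambda>h. tlift A H (prd4 a h) y)" if "a \<in> carr A" "y \<in> carr AH" for a y
      using bilin_lin1[OF bilin_tlift_right[OF vspace_H vspace_A vspace_H is_vspace_tensor 2[OF that(1)]] that(2)] .
    show "lin AH AH (\<lambda>y. tlift A H (prd4 a h) y)" if "a \<in> carr A" "h \<in> carr H" for a h
      using that by (intro tensor_universal(1)[OF vspace_A is_vspace_tensor] bilinI lin_prd4)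
  qed
qed

lemma lin_amult: "lin (tensor AH AH) AH (amult CP)"
  unfolding amult_eq by (rule tensor_universal(1)[OF is_vspace_tensor is_vspace_tensor bilin_amult])

lemma prd_tens:
  assumes "a \<in> carr A" "h \<in> carr H" "b \<in> carr A" "g \<in> carr H"
  shows "prd (tens A H a h) (tens A H b g) = prd4 a h b g"
proof -
  have "bilin A H AH (prd4 a h)" and
    "bilin A H AH (\<lambda>a h. tlift A H (prd4 a h) (tens A H b g))"
    using assms
    by (auto intro!: bilinI lin_prd4 simp: tensor_universal(2)[OF vspace_A is_vspace_tensor bilinI[OF lin_prd4(3,4)]]
        intro: lin_cong[THEN iffD2, OF _ vspace_A] lin_cong[THEN iffD2, OF _ vspace_H])
  then show ?thesis
    unfolding amult_eq using assms
    by (simp add: tensor_universal(2)[OF is_vspace_tensor is_vspace_tensor bilin_amult]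
        tensor_universal(2)[OF vspace_A is_vspace_tensor])
qed

lemma bilin_prd: "bilin AH AH AH prd"
  by (intro bilinI lin_comp[OF lin_amult] bilin_lin1[OF bilin_tens] bilin_lin2[OF bilin_tens])

lemma prd_lact:
  assumes a: "a \<in> carr A" and x: "x \<in> carr AH" and y: "y \<in> carr AH"
  shows "prd (lact a x) y = lact a (prd x y)"
proof (rule tensor_ext[OF _ _ vspace_A _ x])
  show "lin AH AH (\<lambda>x. prd (lact a x) y)"
    by (rule lin_bilin1[OF bilin_prd bilin_lin2[OF bilin_lact a] y])
  show "lin AH AH (\<lambda>x. lact a (prd x y))"
    by (rule lin_bilin2[OF bilin_lact a bilin_lin1[OF bilin_prd y]])
  fix b h assume m: "b \<in> carr A" "h \<in> carr H"
  show "prd (lact a (tens A H b h)) y = lact a (prd (tens A H b h) y)"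
  proof (rule tensor_ext[OF _ _ vspace_A _ y])
    show "lin AH AH (\<lambda>y. prd (lact a (tens A H b h)) y)"
      using a m by (intro bilin_lin2[OF bilin_prd]) simp
    show "lin AH AH (\<lambda>y. lact a (prd (tens A H b h) y))"
      using a m by (intro lin_bilin2[OF bilin_lact a] bilin_lin2[OF bilin_prd]) simp
    fix c g assume m': "c \<in> carr A" "g \<in> carr H"
    have "cv HH (tens A H) (coef c) (mult H) (t2 h g) \<in> carr AH"
      using m m' by (intro lin_mem[OF lin_cv_coef]) simp_all
    then show "prd (lact a (tens A H b h)) (tens A H c g) = lact a (prd (tens A H b h) (tens A H c g))"
      using a m m' by (simp add: prd_tens prd4_def lact_mult)
  qed
qed

subsection \<open>The crossed product as a wreath product\<close>

lemma counital_XX [simp]: "counital (tensor_comod H Hc Hc)"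
  by (rule counital_tensor) simp_all

text \<open>
  Each constraint in the multiplication of the wreath product has a factor \<open>A\<close> in its first or middle
  slot and is therefore plain rebracketing.
\<close>

lemma wreath_product_amult:
  assumes t: "t \<in> carr (tensor AH AH)"
  shows "amult (wreath_product H Ac Hc psi zeta sigma) t = amult CP t"
proof -
  let ?XX = "tensor_comod H Hc Hc"
  let ?M = "mX \<circ> tmap (tensor A A) H2 A AH (tlift A A m) zeta \<circ> assoc_inv H Ac Ac ?XX \<circ>
    tmap A (tensor AH H) A (tensor A H2) id (assoc H Ac Hc Hc) \<circ>
    tmap A (tensor (tensor H A) H) A (tensor AH H) id (tmap (tensor H A) H AH H psi id) \<circ>
    tmap A (tensor H AH) A (tensor (tensor H A) H) id (assoc_inv H Hc Ac Hc) \<circ> assoc H Ac Hc AX"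
  have eq: "amult (wreath_product H Ac Hc psi zeta sigma) = ?M"
    unfolding wreath_product_def Let_def mX_def by (simp del: o_apply add: o_assoc)
  note la = lin_assoc[of Ac Hc AX, simplified] lin_assoc_inv[of Ac Ac ?XX, simplified]
  note ta = assoc_trivial[of Ac Hc AX, simplified] assoc_inv_trivial[of Ac Ac ?XX, simplified]
  note lp = lin_tmap[OF lin_psi lin_id[of H] is_vspace_tensor]
  have L: "lin (tensor AH AH) AH ?M"
    by (rule lin_comp_o la lin_assocs lin_wreath_maps lin_tmap lin_id lin_psi lin_zeta lin_tlift_m vspace_A is_vspace_tensor)+
  have "?M t = amult CP t"
  proof (rule tensor_tensor_ext[OF L lin_amult vspace_A vspace_A _ t])
    fix a h b g assume m: "a \<in> carr A" "h \<in> carr H" "b \<in> carr A" "g \<in> carr H"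
    have p: "assoc H Ac Hc Hc (tens AH H (psi (tens H A h b)) g) =
        ssum H h (\<lambda>h1 h2. tens A H2 (dot h1 b) (t2 h2 g))"
      using psiX_tens[of h b g] m by (simp add: psiX_def tmap_tens[OF lin_psi lin_id is_vspace_tensor])
    have "?M (tens AH AH (tens A H a h) (tens A H b g)) =
      (mX \<circ> tmap (tensor A A) H2 A AH (tlift A A m) zeta \<circ> assoc_inv H Ac Ac ?XX)
        (tens A (tensor A H2) a (ssum H h (\<lambda>h1 h2. tens A H2 (dot h1 b) (t2 h2 g))))"
      using m by (simp add: ta tmap_tens[OF lin_id lin_assocs(7) vspace_A] tmap_tens[OF lin_id lp vspace_A]
          tmap_tens[OF lin_psi lin_id is_vspace_tensor] tmap_tens[OF lin_id lin_assocs(2) vspace_A] p)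
    also have "\<dots> = ssum H h (\<lambda>h1 h2. lact (m a (dot h1 b)) (zeta (t2 h2 g)))"
      using m by (simp add: push lin_ssum[OF la(2) is_vspace_tensor]
          lin_ssum[OF lin_tmap[OF lin_tlift_m lin_zeta is_vspace_tensor] is_vspace_tensor] ta
          tmap_tens[OF lin_tlift_m lin_zeta is_vspace_tensor])
    also have "\<dots> = prd (tens A H a h) (tens A H b g)"
      using m by (simp add: prd_tens prd4_eq(1))
    finally show "?M (tens AH AH (tens A H a h) (tens A H b g)) = prd (tens A H a h) (tens A H b g)" .
  qed
  then show ?thesis by (simp add: eq)
qed

lemma coact_CP: "coact CP = coact AX"
proof -
  have "coact AX = tlift A H (\<lambda>a h. ssum H h (\<lambda>h1 h2. tens AH H (tens A H a h1) h2))"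
    unfolding coact_tensor_eq[OF counital_Ac counital_Hc] same_trivial same_regular
    by (intro tlift_cong, simp, subst csum_Ac[OF is_vspace_tensor]) (auto intro!: lin_all)
  moreover have "coact CP = tlift A H (\<lambda>a h. ssum H h (\<lambda>h1 h2. tens AH H (tens A H a h1) h2))"
    unfolding crossed_product_def Let_def comod_alg.simps comod.simps
    by (intro tlift_cong sw_eqI[OF coalg_H is_vspace_tensor] refl) (auto intro!: lin_all)
  ultimately show ?thesis by simp
qed

lemma aunit_CP: "aunit CP = sigma"
  by (simp add: crossed_product_def Let_def sigma_map_def fun_eq_iff)

theorem wreath_product_eq_crossed_product:
  "comod_alg_eq (wreath_product H Ac Hc psi zeta sigma) CP"
proof -
  let ?W = "wreath_product H Ac Hc psi zeta sigma"
  have W: "carr ?W = carr AH" "scl ?W = scl AH" "coact ?W = coact AX" "aunit ?W = sigma"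
    by (simp_all add: wreath_product_def Let_def)
  then show ?thesis
    unfolding comod_alg_eq_def eq_arr_def
    by (simp add: same_tensor[OF W(1,2)] wreath_product_amult coact_CP aunit_CP)
qed

end

context crossed_data
begin

section \<open>The crossed product is an algebra in the category\<close>

lemma csum_CP:
  assumes Z: "is_vspace Z" and f: "bilin AH H Z f" and m: "a \<in> carr A" "h \<in> carr H"
  shows "tsum AH H (coact AX (tens A H a h)) f = ssum H h (\<lambda>h1 h2. f (tens A H a h1) h2)"
proof -
  have "tsum AH H (coact AX (tens A H a h)) f =
      tsum A H (tens A H a (one H)) (\<lambda>v0 v1. ssum H h (\<lambda>w0 w1. f (tens A H v0 w0) (mul H v1 w1)))"
    using csum_tensor[OF counital_Ac counital_Hc Z, of f a h] f m by simp
  also have "\<dots> = ssum H h (\<lambda>h1 h2. f (tens A H a h1) h2)"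
    using m by (subst csum_Ac[OF Z])
      (auto intro!: lin_all Z lin_bilin1[OF f] lin_bilin2[OF f])
  finally show ?thesis .
qed

lemma comodule_CP: "comodule H CP"
proof -
  let ?E = "tensor AH H2"
  let ?F = "\<lambda>x h1 h2. tens AH H2 x (t2 h1 h2)"
  have V: "is_vspace CP" "lin CP (tensor CP H) (coact CP)"
    using lin_coact_AX by (simp_all add: coact_CP)
  note lc = lin_tsum_arg[OF _ is_vspace_tensor _ lin_comp[OF lin_coact_AX]]
  have csw: "csw H CP v f = tsum AH H (coact AX v) g"
    if "is_vspace Z" "v \<in> carr AH" "\<And>v0 v1. v0 \<in> carr AH \<Longrightarrow> v1 \<in> carr H \<Longrightarrow> f v0 v1 = g v0 v1"
      "bilin AH H Z g" for Z :: "('k, 'u::ab_group_add, 'zz) vspace_scheme" and f g v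
    using csw_csum[OF V that(1), of v f g] that by (simp add: coact_CP)
  have s: "sw H y (?F x) = ssum H y (?F x)" if "y \<in> carr H" "x \<in> carr AH" for x y
    using that by (intro sw_eqI[OF coalg_H is_vspace_tensor] refl) (auto intro!: lin_all)
  have b1: "bilin AH H ?E (\<lambda>x h2. tsum AH H (coact AX x) (\<lambda>v0 h1. ?F v0 h1 h2))"
    by (auto intro!: lin_all lc)
  have b2: "bilin AH H ?E (\<lambda>x y. ssum H y (?F x))"
    by (auto intro!: lin_all)
  have "tsum AH H (coact AX v) (\<lambda>x h2. tsum AH H (coact AX x) (\<lambda>v0 h1. ?F v0 h1 h2)) =
      tsum AH H (coact AX v) (\<lambda>x y. ssum H y (?F x))" if v: "v \<in> carr AH" for v
  proof (rule tensor_ext[where F = "\<lambda>v. tsum AH H (coact AX v) (\<lambda>x h2. tsum AH H (coact AX x) (\<lambda>v0 h1. ?F v0 h1 h2))"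
        and G = "\<lambda>v. tsum AH H (coact AX v) (\<lambda>x y. ssum H y (?F x))", OF _ _ vspace_A _ v])
    show "lin AH ?E (\<lambda>v. tsum AH H (coact AX v) (\<lambda>x h2. tsum AH H (coact AX x) (\<lambda>v0 h1. ?F v0 h1 h2)))"
      "lin AH ?E (\<lambda>v. tsum AH H (coact AX v) (\<lambda>x y. ssum H y (?F x)))"
      by (rule lc[OF b1 is_vspace_tensor lin_ident] lc[OF b2 is_vspace_tensor lin_ident])+
    fix a h assume m: "a \<in> carr A" "h \<in> carr H"
    have "tsum AH H (coact AX (tens A H a h)) (\<lambda>x h2. tsum AH H (coact AX x) (\<lambda>v0 h1. ?F v0 h1 h2)) =
        ssum H h (\<lambda>y h2. tsum AH H (coact AX (tens A H a y)) (\<lambda>v0 h1. ?F v0 h1 h2))"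
      by (rule csum_CP[OF is_vspace_tensor b1 m])
    also have "\<dots> = ssum H h (\<lambda>y h3. ssum H y (\<lambda>h1 h2. ?F (tens A H a h1) h2 h3))"
      using m by (intro ssum_cong[OF refl refl] csum_CP[OF is_vspace_tensor]) (auto intro!: lin_all)
    also have "\<dots> = ssum H h (\<lambda>h1 y. ssum H y (\<lambda>h2 h3. ?F (tens A H a h1) h2 h3))"
      using m by (intro ssum_coassoc[OF coalg_H _ is_vspace_tensor]) (auto intro!: lin_all)
    also have "\<dots> = tsum AH H (coact AX (tens A H a h)) (\<lambda>x y. ssum H y (?F x))"
      by (rule csum_CP[OF is_vspace_tensor b2 m, symmetric])
    finally show "tsum AH H (coact AX (tens A H a h)) (\<lambda>x h2. tsum AH H (coact AX x) (\<lambda>v0 h1. ?F v0 h1 h2)) =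
        tsum AH H (coact AX (tens A H a h)) (\<lambda>x y. ssum H y (?F x))" .
  qed
  moreover have "csw H CP v (\<lambda>x h2. csw H CP x (\<lambda>v0 h1. ?F v0 h1 h2)) =
      tsum AH H (coact AX v) (\<lambda>x h2. tsum AH H (coact AX x) (\<lambda>v0 h1. ?F v0 h1 h2))"
    if v: "v \<in> carr AH" for v
    using v by (intro csw[OF is_vspace_tensor] b1 refl) (auto intro!: lin_all lc)
  moreover have "csw H CP v (\<lambda>v0 y. sw H y (?F v0)) = tsum AH H (coact AX v) (\<lambda>x y. ssum H y (?F x))"
    if v: "v \<in> carr AH" for v
    by (rule csw[OF is_vspace_tensor v s b2])
  moreover have "csw H CP v (\<lambda>v0 v1. scl AH (\<epsilon> v1) v0) = v" if v: "v \<in> carr AH" for v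
  proof -
    have "csw H CP v (\<lambda>v0 v1. scl AH (\<epsilon> v1) v0) = tsum AH H (coact AX v) (\<lambda>v0 v1. scl AH (\<epsilon> v1) v0)"
      using v by (intro csw[OF is_vspace_tensor] refl) (auto intro!: lin_all)
    then show ?thesis using counital_AX v by (simp add: counital_def)
  qed
  ultimately show ?thesis using V by (simp add: comodule_def)
qed

lemma counital_CP [simp]: "counital CP"
  by (rule comodule_counital[OF comodule_CP])

lemma prd_cv:
  assumes "a \<in> carr A" "b \<in> carr A" "h \<in> carr H" "g \<in> carr H"
  shows "prd (tens A H a h) (tens A H b g) = cv HH (tens A H) (\<lambda>x. m a (coef b x)) (mult H) (t2 h g)"
  unfolding prd_tens[OF assms(1,3,2,4)] prd4_def cv_def
  using assms lin_mem[OF lin_coef] lin_mem[OF lin_mult]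
  by (subst lact_ssum) (auto intro!: ssum_cong)

lemma comod_hom_prd: "comod_hom H (tensor_comod H CP CP) CP (amult CP)"
proof (rule comod_hom_tensorI)
  let ?R = "\<lambda>v w. tsum AH H (coact AX v) (\<lambda>v0 v1. tsum AH H (coact AX w) (\<lambda>w0 w1.
      tens AH H (prd v0 w0) (mul H v1 w1)))"
  note lc = lin_tsum_arg[OF _ is_vspace_tensor _ lin_comp[OF lin_coact_AX]]
  note lp = lin_bilin1[OF bilin_prd] lin_bilin2[OF bilin_prd] bilin_mem[OF bilin_prd]
  fix v w assume "v \<in> carr CP" "w \<in> carr CP"
  then have v: "v \<in> carr AH" and w: "w \<in> carr AH" by simp_all
  have "coact AX (prd v w) = ?R v w"
  proof (rule tensor_ext[where F = "\<lambda>v. coact AX (prd v w)" and G = "\<lambda>v. ?R v w", OF _ _ vspace_A _ v])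
    show "lin AH (tensor AH H) (\<lambda>v. coact AX (prd v w))"
      by (rule lin_comp[OF lin_coact_AX bilin_lin1[OF bilin_prd w]])
    show "lin AH (tensor AH H) (\<lambda>v. ?R v w)"
      using w by (auto intro!: lin_all lc lp)
    fix a h assume m: "a \<in> carr A" "h \<in> carr H"
    show "coact AX (prd (tens A H a h) w) = ?R (tens A H a h) w"
    proof (rule tensor_ext[where F = "\<lambda>w. coact AX (prd (tens A H a h) w)" and G = "?R (tens A H a h)",
          OF _ _ vspace_A _ w])
      show "lin AH (tensor AH H) (\<lambda>w. coact AX (prd (tens A H a h) w))"
        using m by (intro lin_comp[OF lin_coact_AX bilin_lin2[OF bilin_prd]]) simp
      show "lin AH (tensor AH H) (\<lambda>w. ?R (tens A H a h) w)"
        using m by (auto intro!: lin_all lc lp)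
      fix b g assume m': "b \<in> carr A" "g \<in> carr H"
      have lF: "lin H2 A (\<lambda>x. m a (coef b x))"
        using m m' by (intro lin_bilin2[OF bilin_m] lin_coef)
      have lG: "lin H2 AH (cv HH (tens A H) (\<lambda>x. m a (coef b x)) (mult H))"
        using lin_cv_tens[OF coalg_HH] lF lin_mult by simp
      have "?R (tens A H a h) (tens A H b g) =
          ssum H h (\<lambda>h1 h2. tsum AH H (coact AX (tens A H b g)) (\<lambda>w0 w1.
            tens AH H (prd (tens A H a h1) w0) (mul H h2 w1)))"
        using m by (intro csum_CP[OF is_vspace_tensor]) (auto intro!: lin_all lc lp)
      also have "\<dots> = ssum H h (\<lambda>h1 h2. ssum H g (\<lambda>g1 g2.
            tens AH H (prd (tens A H a h1) (tens A H b g1)) (mul H h2 g2)))"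
        using m m' by (intro ssum_cong[OF refl refl] csum_CP[OF is_vspace_tensor]) (auto intro!: lin_all lp)
      also have "\<dots> = cv HH (tens AH H) (cv HH (tens A H) (\<lambda>x. m a (coef b x)) (mult H)) (mult H) (t2 h g)"
        using m m' by (simp add: cv_HH_tens[OF lG lin_mult bilin_tens is_vspace_tensor] prd_cv mul_def)
      also have "\<dots> = coact AX (prd (tens A H a h) (tens A H b g))"
        using m m' lF by (simp add: prd_cv coact_cv_tens[OF coalg_HH hom_mult])
      finally show "coact AX (prd (tens A H a h) (tens A H b g)) = ?R (tens A H a h) (tens A H b g)" by simp
    qed
  qed
  then show "coact CP (amult CP (tens CP CP v w)) =
      csum CP v (\<lambda>v0 v1. csum CP w (\<lambda>w0 w1. tens CP H (amult CP (tens CP CP v0 w0)) (mul H v1 w1)))"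
    by (simp add: coact_CP)
qed (simp_all add: lin_amult)

subsection \<open>Associativity\<close>

definition "dot_coef b c = lift3 (\<lambda>h g l. dot h (m b (coef c (t2 g l))))"

lemma trilin_dot_coef: "b \<in> carr A \<Longrightarrow> c \<in> carr A \<Longrightarrow> trilin H H H A (\<lambda>h g l. dot h (m b (coef c (t2 g l))))"
  by (auto intro!: lin_all lin_comp[OF lin_coef] simp: lin_mem[OF lin_coef])

lemma lin_dot_coef: "b \<in> carr A \<Longrightarrow> c \<in> carr A \<Longrightarrow> lin H3 A (dot_coef b c)"
  unfolding dot_coef_def by (rule lin_lift3[OF trilin_dot_coef vspace_A])

lemma dot_coef_tens [simp]:
  "b \<in> carr A \<Longrightarrow> c \<in> carr A \<Longrightarrow> h \<in> carr H \<Longrightarrow> g \<in> carr H \<Longrightarrow> l \<in> carr H \<Longrightarrow>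
    dot_coef b c (t3 h g l) = dot h (m b (coef c (t2 g l)))"
  unfolding dot_coef_def by (rule lift3_tens[OF trilin_dot_coef vspace_A])

lemma coef_carr [simp]: "c \<in> carr A \<Longrightarrow> x \<in> carr H2 \<Longrightarrow> coef c x \<in> carr A"
  by (rule lin_mem[OF lin_coef])

text \<open>
  The two bracketings of a product of three elements become comparable once both are written as
  \<open>a F(x\<^sub>1) \<otimes> p(x\<^sub>2)\<close> with \<open>x = h \<otimes> g \<otimes> l\<close> and \<open>p\<close> the corresponding triple product of \<open>H\<close>.
\<close>

lemma prd_prd_left:
  assumes m: "a \<in> carr A" "b \<in> carr A" "c \<in> carr A" "h \<in> carr H" "g \<in> carr H" "l \<in> carr H"
  shows "prd (prd (tens A H a h) (tens A H b g)) (tens A H c l) =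
    lact a (cv HHH (tens A H) (cv HHH m (\<lambda>x. coef b (drop3 x)) (\<lambda>x. coef c (mul_left x))) mult3 (t3 h g l))"
proof -
  let ?N = "\<lambda>b. cv HH (tens A H) (coef b) (mult H)"
  have N: "?N b x \<in> carr AH" if "b \<in> carr A" "x \<in> carr H2" for b x
    by (rule lin_mem[OF lin_cv_coef[OF that(1)] that(2)])
  have lN: "lin H3 AH (\<lambda>x. ?N c (mul_left x))"
    by (rule lin_comp[OF lin_cv_coef[OF m(3)] lin_homs(1)])
  have lb: "lin H3 A (\<lambda>x. coef b (drop3 x))"
    by (rule lin_comp[OF lin_coef[OF m(2)] lin_drop3])
  have lc: "lin H3 A (\<lambda>x. coef c (mul_left x))"
    by (rule lin_comp[OF lin_coef[OF m(3)] lin_homs(1)])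
  have "prd (prd (tens A H a h) (tens A H b g)) (tens A H c l) =
      lact a (prd (?N b (t2 h g)) (tens A H c l))"
    using m N by (simp add: prd_tens prd4_def prd_lact)
  also have "prd (?N b (t2 h g)) (tens A H c l) = prd (ssum H h (\<lambda>h1 h2. ssum H g (\<lambda>g1 g2.
      tens A H (coef b (t2 h1 g1)) (mul H h2 g2)))) (tens A H c l)"
    using m by (simp add: cv_HH_tens[OF lin_coef lin_mult bilin_tens is_vspace_tensor] mul_def)
  also have "\<dots> = ssum H h (\<lambda>h1 h2. ssum H g (\<lambda>g1 g2.
      lact (coef b (t2 h1 g1)) (?N c (t2 (mul H h2 g2) l))))"
    using m
    by (simp add: tens_ssum lin_ssum[OF lin_amult is_vspace_tensor] ssum_mem prd_tens prd4_def)
  also have "\<dots> = cv HHH lact (\<lambda>x. coef b (drop3 x)) (\<lambda>x. ?N c (mul_left x)) (t3 h g l)"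
    using m by (simp add: cv_drop3_tens[OF lin_coef lN bilin_lact vspace_A is_vspace_tensor])
  also have "\<dots> = cv HHH lact (\<lambda>x. coef b (drop3 x)) (cv HHH (tens A H) (\<lambda>x. coef c (mul_left x)) mult3) (t3 h g l)"
    using cv_coalgebra_hom[where f = "coef c" and g = "mult H",
        OF coalgebra_hom_mul_left coalg_HHH coalg_HH is_vspace_tensor _ _ _ bilin_tens, of _ A H]
      lin_coef[OF m(3)] lin_mult
    by (intro cv_cong) simp_all
  also have "\<dots> = cv HHH (tens A H) (cv HHH m (\<lambda>x. coef b (drop3 x)) (\<lambda>x. coef c (mul_left x))) mult3 (t3 h g l)"
    using m lb lc lin_mult3 by (intro cv_lact_tens[OF coalg_HHH]) simp_all
  finally show ?thesis .
qed

lemma prd_prd_right: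
  assumes m: "a \<in> carr A" "b \<in> carr A" "c \<in> carr A" "h \<in> carr H" "g \<in> carr H" "l \<in> carr H"
  shows "prd (tens A H a h) (prd (tens A H b g) (tens A H c l)) =
    lact a (cv HHH (tens A H) (cv HHH m (dot_coef b c) (\<lambda>x. \<tau> (mul_right x))) mult3' (t3 h g l))"
proof -
  have "prd (tens A H b g) (tens A H c l) = ssum H g (\<lambda>g1 g2. ssum H l (\<lambda>l1 l2.
      tens A H (m b (coef c (t2 g1 l1))) (mul H g2 l2)))"
    using m by (simp add: prd_cv mul_def
        cv_HH_tens[OF lin_bilin2[OF bilin_m m(2) lin_coef[OF m(3)]] lin_mult bilin_tens is_vspace_tensor])
  then have "prd (tens A H a h) (prd (tens A H b g) (tens A H c l)) =
      ssum H g (\<lambda>g1 g2. ssum H l (\<lambda>l1 l2.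
        prd (tens A H a h) (tens A H (m b (coef c (t2 g1 l1))) (mul H g2 l2))))"
    using m by (simp add: tens_ssum lin_ssum[OF lin_amult is_vspace_tensor] ssum_mem)
  also have "\<dots> = ssum H g (\<lambda>g1 g2. ssum H l (\<lambda>l1 l2. ssum H h (\<lambda>h1 h2.
      lact a (lact (dot h1 (m b (coef c (t2 g1 l1)))) (zeta (t2 h2 (mul H g2 l2)))))))"
    using m by (simp add: prd_tens prd4_def cv_coef_tens lact_ssum)
  also have "\<dots> = ssum H g (\<lambda>g1 g2. ssum H h (\<lambda>h1 h2. ssum H l (\<lambda>l1 l2.
      lact a (lact (dot h1 (m b (coef c (t2 g1 l1)))) (zeta (t2 h2 (mul H g2 l2)))))))"
    by (rule ssum_cong[OF refl refl]) (rule ssum_swap)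
  also have "\<dots> = ssum H h (\<lambda>h1 h2. ssum H g (\<lambda>g1 g2. ssum H l (\<lambda>l1 l2.
      lact a (lact (dot h1 (m b (coef c (t2 g1 l1)))) (zeta (t2 h2 (mul H g2 l2)))))))"
    by (rule ssum_swap)
  also have "\<dots> = lact a (ssum H h (\<lambda>h1 h2. ssum H g (\<lambda>g1 g2. ssum H l (\<lambda>l1 l2.
      lact (dot h1 (m b (coef c (t2 g1 l1)))) (zeta (t2 h2 (mul H g2 l2)))))))"
    using m by (simp add: lact_ssum ssum_mem)
  also have "\<dots> = lact a (cv HHH lact (dot_coef b c) (\<lambda>x. zeta (mul_right x)) (t3 h g l))"
    using m by (simp add: cv_HHH_tens[OF lin_dot_coef lin_zeta_mul(2) bilin_lact is_vspace_tensor])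
  also have "\<dots> = lact a (cv HHH (tens A H) (cv HHH m (dot_coef b c) (\<lambda>x. \<tau> (mul_right x))) mult3' (t3 h g l))"
    using m by (simp add: lact_zeta_mul(2)[OF lin_dot_coef])
  finally show ?thesis .
qed

context
  assumes crossed: "crossed_system H A act \<tau>"
begin

lemma crossed_mult: "a \<in> carr A \<Longrightarrow> b \<in> carr A \<Longrightarrow> h \<in> carr H \<Longrightarrow>
    dot h (m a b) = ssum H h (\<lambda>h1 h2. m (dot h1 a) (dot h2 b))"
  and crossed_unit: "h \<in> carr H \<Longrightarrow> dot h e = scl A (\<epsilon> h) e"
  and crossed_one: "a \<in> carr A \<Longrightarrow> dot (one H) a = a"
  and crossed_act: "a \<in> carr A \<Longrightarrow> x \<in> carr H2 \<Longrightarrow>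
    cv HH m (dot2 a) \<tau> x = cv HH m \<tau> (\<lambda>x. dot (mult H x) a) x"
  and crossed_cocycle: "y \<in> carr H3 \<Longrightarrow> cv HHH scr cocycle_l (reass H) y = cocycle_r y"
  and crossed_tau: "h \<in> carr H \<Longrightarrow> ta (one H) h = scl A (\<epsilon> h) e" "h \<in> carr H \<Longrightarrow> ta h (one H) = scl A (\<epsilon> h) e"
  using crossed unfolding crossed_system_iff by (auto simp: cv_def)

lemma lin_factors:
  assumes "b \<in> carr A" "c \<in> carr A"
  shows "lin H3 A (\<lambda>x. dot_drop b (drop3 x))"
    "lin H3 A (\<lambda>x. dot2 c (drop3 x))"
    "lin H3 A (\<lambda>x. dot (mult H (drop3 x)) c)"
  using lin_comp[OF lin_dot_drop lin_drop3] lin_comp[OF lin_dot2 lin_drop3]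
    lin_comp[OF lin_dot_mult lin_drop3] assms by auto

text \<open>
  Since \<open>coef c (g, l) = (g\<^sub>1 \<cdot> c) \<tau>(g\<^sub>2, l)\<close>, multiplicativity of the action, used twice, gives
  \<open>h \<cdot> (b coef c (g, l)) = (h\<^sub>1 \<cdot> b) (h\<^sub>2 \<cdot> (g\<^sub>1 \<cdot> c)) (h\<^sub>3 \<cdot> \<tau>(g\<^sub>2, l))\<close>.
\<close>

lemma dot_coef_eq:
  assumes bc: "b \<in> carr A" "c \<in> carr A" and x: "x \<in> carr H3"
  shows "dot_coef b c x =
    cv HHH m (\<lambda>x. dot_drop b (drop3 x)) (cv HHH m (\<lambda>x. dot2 c (drop3 x)) dot_tau) x"
proof (rule tensor_left_eq_iff[THEN iffD2, rule_format, OF lin_dot_coef[OF bc] _ vspace_H _ x])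
  note lm = lin_cv_m[OF coalg_HHH, simplified]
  have lJ: "lin H3 A (cv HHH m (\<lambda>x. dot2 c (drop3 x)) dot_tau)"
    by (intro lm lin_factors[OF bc] lin_dot_tau)
  then show "lin H3 A
      (cv HHH m (\<lambda>x. dot_drop b (drop3 x)) (cv HHH m (\<lambda>x. dot2 c (drop3 x)) dot_tau))"
    by (rule lm[OF lin_factors(1)[OF bc]])
  fix h g l assume hgl: "h \<in> carr H" "g \<in> carr H" "l \<in> carr H"
  let ?J = "cv HHH m (\<lambda>x. dot2 c (drop3 x)) dot_tau"
  have J: "?J (t3 h g l) = dot h (coef c (t2 g l))" if h: "h \<in> carr H" "g \<in> carr H" for h g
  proof -
    have "?J (t3 h g l) = ssum H h (\<lambda>h1 h2. ssum H g (\<lambda>g1 g2. m (dot h1 (dot g1 c)) (dot h2 (ta g2 l))))"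
      using h hgl bc by (simp add: cv_drop3_tens[OF lin_dot2 lin_dot_tau bilin_m vspace_A vspace_A])
    also have "\<dots> = ssum H g (\<lambda>g1 g2. ssum H h (\<lambda>h1 h2. m (dot h1 (dot g1 c)) (dot h2 (ta g2 l))))"
      by (rule ssum_swap)
    also have "\<dots> = ssum H g (\<lambda>g1 g2. dot h (m (dot g1 c) (ta g2 l)))"
      using h hgl bc by (simp add: crossed_mult)
    also have "\<dots> = dot h (coef c (t2 g l))"
      using h hgl bc
      by (simp add: coef_tens tens_ssum lin_ssum[OF lin_act is_vspace_tensor])
    finally show ?thesis .
  qed
  have "cv HHH m (\<lambda>x. dot_drop b (drop3 x)) ?J (t3 h g l) =
      ssum H h (\<lambda>h1 h2. ssum H g (\<lambda>g1 g2. m (dot_drop b (t2 h1 g1)) (?J (t3 h2 g2 l))))"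
    using hgl bc by (intro cv_drop3_tens[OF lin_dot_drop lJ bilin_m vspace_A vspace_A])
  also have "\<dots> = cv HH m (dot_drop b) (\<lambda>x. ?J (tens H2 H x l)) (t2 h g)"
    using hgl bc by (intro cv_HH_tens[OF lin_dot_drop lin_comp[OF lJ bilin_lin1[OF bilin_tens]] bilin_m vspace_A, symmetric])
  also have "\<dots> = ssum H h (\<lambda>h1 h2. m (dot h1 b) (?J (t3 h2 g l)))"
    using hgl bc by (intro cv_dot_drop_tens[OF lin_comp[OF lJ bilin_lin1[OF bilin_tens]] bilin_m vspace_A])
  also have "\<dots> = ssum H h (\<lambda>h1 h2. m (dot h1 b) (dot h2 (coef c (t2 g l))))"
    using hgl by (intro ssum_cong[OF refl refl]) (simp only: J)
  also have "\<dots> = dot_coef b c (t3 h g l)"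
    using hgl bc by (simp add: crossed_mult)
  finally show "dot_coef b c (t3 h g l) = cv HHH m (\<lambda>x. dot_drop b (drop3 x)) ?J (t3 h g l)" by simp
qed

lemma drop2_mul_left:
  assumes "x \<in> carr H3"
  shows "drop2 (mul_left x) = mult H (drop3 x)"
  by (rule tensor_left_eq_iff[THEN iffD2, rule_format,
        OF lin_comp[OF lin_drop2 lin_homs(1)] lin_comp[OF lin_mult lin_drop3] vspace_H _ assms])
    (simp add: lin_scl[OF lin_mult] mul_def[symmetric])

text \<open>
  The coefficient of \<open>(a \<otimes> h)((b \<otimes> g)(c \<otimes> l))\<close>, twisted by \<open>\<phi>\<close>, is \<open>B * C * X * \<phi>\<close> with
  \<open>B = h \<cdot> b\<close>, \<open>C = h \<cdot> (g \<cdot> c)\<close> and \<open>X\<close> the left side of the cocycle condition.  The cocycle condition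
  makes it \<open>B * C * \<tau>(h, g) * \<tau>(hg, l)\<close>, and the twisted module condition exchanges \<open>C\<close> with \<open>\<tau>(h, g)\<close>,
  turning it into \<open>(hg) \<cdot> c\<close>.  The result is the coefficient of \<open>((a \<otimes> h)(b \<otimes> g))(c \<otimes> l)\<close>.
\<close>

lemma coef_cocycle:
  assumes bc: "b \<in> carr A" "c \<in> carr A" and x: "x \<in> carr HHH"
  shows "cv HHH scr (cv HHH m (dot_coef b c) (\<lambda>x. \<tau> (mul_right x))) (reass H) x =
    cv HHH m (\<lambda>x. coef b (drop3 x)) (\<lambda>x. coef c (mul_left x)) x"
proof -
  let ?B = "\<lambda>x. dot_drop b (drop3 x)" and ?C = "\<lambda>x. dot2 c (drop3 x)"
    and ?D = "\<lambda>x. dot (mult H (drop3 x)) c" and ?R = "\<lambda>x. \<tau> (mul_right x)"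
    and ?L = "\<lambda>x. \<tau> (mul_left x)" and ?T = "\<lambda>x. \<tau> (drop3 x)"
  note lf = lin_factors[OF bc]
  note lm = lin_cv_m[OF coalg_HHH, simplified] and ls = lin_cv_scr[OF coalg_HHH, simplified]
  note l = lf lm ls lin_tau3 lin_dot_tau lin_reass lin_cocycle
  have as: "cv HHH m (cv HHH m F G) K x = cv HHH m F (cv HHH m G K) x"
    if "lin H3 A F" "lin H3 A G" "lin H3 A K"
      "x \<in> carr H3" for F G K x
    using that by (intro cv_m_assoc[OF coalg_HHH]) simp_all
  have sc: "cv HHH scr (cv HHH m F G) (reass H) x = cv HHH m F (cv HHH scr G (reass H)) x"
    if "lin H3 A F" "lin H3 A G"
      "x \<in> carr H3" for F G x
    using that lin_reass by (intro cv_scr_assoc[OF coalg_HHH]) simp_all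
  have x': "x \<in> carr H3" using x by simp
  have EJ: "cv HHH m (dot_coef b c) ?R y = cv HHH m ?B (cv HHH m ?C cocycle_l) y"
    if y: "y \<in> carr H3" for y
  proof -
    have "cv HHH m (dot_coef b c) ?R y = cv HHH m (cv HHH m ?B (cv HHH m ?C dot_tau)) ?R y"
      by (rule cv_cong) (simp_all add: dot_coef_eq[OF bc])
    also have "\<dots> = cv HHH m ?B (cv HHH m (cv HHH m ?C dot_tau) ?R) y"
      by (rule as) (intro l y)+
    also have "\<dots> = cv HHH m ?B (cv HHH m ?C cocycle_l) y"
      unfolding cocycle_l_def by (rule cv_cong) (simp_all add: as l)
    finally show ?thesis .
  qed
  have CT: "cv HHH m ?C ?T y = cv HHH m ?T ?D y" if y: "y \<in> carr H3" for y
  proof -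
    have d: "drop3 y \<in> carr H2" by (rule lin_mem[OF lin_drop3 y])
    have "cv HHH m ?C ?T y = cv HH m (dot2 c) \<tau> (drop3 y)"
      using y lin_dot2[OF bc(2)] lin_tau
      by (intro cv_coalgebra_hom[OF coalgebra_hom_drop3 coalg_HHH coalg_HH vspace_A _ _ _ bilin_m, symmetric]) simp_all
    also have "\<dots> = cv HH m \<tau> (\<lambda>x. dot (mult H x) c) (drop3 y)"
      by (rule crossed_act[OF bc(2) d])
    also have "\<dots> = cv HHH m ?T ?D y"
      using y lin_dot_mult[OF bc(2)] lin_tau
      by (intro cv_coalgebra_hom[OF coalgebra_hom_drop3 coalg_HHH coalg_HH vspace_A _ _ _ bilin_m]) simp_all
    finally show ?thesis .
  qed
  have coef_b: "coef b (drop3 y) = cv HHH m ?B ?T y" if y: "y \<in> carr H3" for y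
    unfolding coef_def using y lin_dot_drop[OF bc(1)] lin_tau
    by (intro cv_coalgebra_hom[OF coalgebra_hom_drop3 coalg_HHH coalg_HH vspace_A _ _ _ bilin_m]) simp_all
  have coef_c: "coef c (mul_left y) = cv HHH m ?D ?L y" if y: "y \<in> carr H3" for y
  proof -
    have "coef c (mul_left y) = cv HHH m (\<lambda>x. dot_drop c (mul_left x)) ?L y"
      unfolding coef_def using y lin_dot_drop[OF bc(2)] lin_tau
      by (intro cv_coalgebra_hom[OF coalgebra_hom_mul_left coalg_HHH coalg_HH vspace_A _ _ _ bilin_m]) simp_all
    also have "\<dots> = cv HHH m ?D ?L y"
      by (rule cv_cong) (simp_all add: dot_drop_def drop2_mul_left)
    finally show ?thesis .
  qed
  have "cv HHH scr (cv HHH m (dot_coef b c) ?R) (reass H) x =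
      cv HHH scr (cv HHH m ?B (cv HHH m ?C cocycle_l)) (reass H) x"
    by (rule cv_cong) (simp_all add: EJ)
  also have "\<dots> = cv HHH m ?B (cv HHH scr (cv HHH m ?C cocycle_l) (reass H)) x"
    by (rule sc) (intro l x')+
  also have "\<dots> = cv HHH m ?B (cv HHH m ?C (cv HHH scr cocycle_l (reass H))) x"
    by (rule cv_cong) (simp_all add: sc l)
  also have "\<dots> = cv HHH m ?B (cv HHH m ?C cocycle_r) x"
    by (intro cv_cong refl) (simp add: crossed_cocycle)
  also have "\<dots> = cv HHH m ?B (cv HHH m (cv HHH m ?C ?T) ?L) x"
    unfolding cocycle_r_def by (rule cv_cong) (simp_all add: as l)
  also have "\<dots> = cv HHH m ?B (cv HHH m (cv HHH m ?T ?D) ?L) x"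
    by (rule cv_cong, rule refl, rule cv_cong, rule CT) simp_all
  also have "\<dots> = cv HHH m ?B (cv HHH m ?T (cv HHH m ?D ?L)) x"
    by (rule cv_cong) (simp_all add: as l)
  also have "\<dots> = cv HHH m (cv HHH m ?B ?T) (cv HHH m ?D ?L) x"
    by (rule as[symmetric]) (intro l x')+
  also have "\<dots> = cv HHH m (\<lambda>x. coef b (drop3 x)) (\<lambda>x. coef c (mul_left x)) x"
    by (rule cv_cong) (simp_all add: coef_b coef_c)
  finally show ?thesis .
qed

lemma prd_assoc:
  assumes t: "t \<in> carr (tensor (tensor AH AH) AH)"
  shows "(amult CP \<circ> tmap (tensor AH AH) AH AH AH (amult CP) id) t =
    (amult CP \<circ> tmap AH (tensor AH AH) AH AH id (amult CP) \<circ> assoc H CP CP CP) t"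
proof -
  let ?L = "amult CP \<circ> tmap (tensor AH AH) AH AH AH (amult CP) id"
  let ?Q = "amult CP \<circ> tmap AH (tensor AH AH) AH AH id (amult CP)"
  let ?R = "?Q \<circ> assoc H CP CP CP"
  have LL: "lin (tensor (tensor AH AH) AH) AH ?L"
    by (rule lin_comp_o lin_tmap lin_amult lin_id is_vspace_tensor)+
  have LQ: "lin (tensor AH (tensor AH AH)) AH ?Q"
    by (rule lin_comp_o lin_tmap lin_amult lin_id is_vspace_tensor)+
  have LR: "lin (tensor (tensor AH AH) AH) AH ?R"
    using lin_assoc[of CP CP CP] by (intro lin_comp_o[OF _ LQ]) simp
  have Q: "?Q (tens AH (tensor AH AH) x (tens AH AH y z)) = prd x (prd y z)"
    if "x \<in> carr AH" "y \<in> carr AH" "z \<in> carr AH" for x y z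
    using that by (simp add: tmap_tens[OF lin_id lin_amult is_vspace_tensor])
  have pure: "?L (tens (tensor AH AH) AH (tens AH AH (tens A H a h) (tens A H b g)) (tens A H c l)) =
      ?R (tens (tensor AH AH) AH (tens AH AH (tens A H a h) (tens A H b g)) (tens A H c l))"
    if m: "a \<in> carr A" "h \<in> carr H" "b \<in> carr A" "g \<in> carr H" "c \<in> carr A" "l \<in> carr H" for a h b g c l
  proof -
    let ?F = "cv HHH m (dot_coef b c) (\<lambda>x. \<tau> (mul_right x))"
    note lm = lin_cv_m[OF coalg_HHH, simplified] and lt = lin_cv_tens[OF coalg_HHH, simplified]
    have lF: "lin H3 A ?F" by (intro lm lin_dot_coef lin_tau3 m)
    have lG: "lin H3 AH (cv HHH (tens A H) ?F mult3')"
      by (intro lt lF lin_mult3)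
    let ?W = "tensor AH (tensor AH AH)"
    let ?f = "\<lambda>x y z u v w. scl ?W (phi H u v w) (tens AH (tensor AH AH) x (tens AH AH y z))"
    note lc = lin_tsum_arg[OF _ is_vspace_tensor _ lin_comp[OF lin_coact_AX]]
    have "assoc H CP CP CP (tens (tensor AH AH) AH (tens AH AH (tens A H a h) (tens A H b g)) (tens A H c l)) =
        tsum AH H (coact AX (tens A H a h)) (\<lambda>x u. tsum AH H (coact AX (tens A H b g)) (\<lambda>y v.
          tsum AH H (coact AX (tens A H c l)) (\<lambda>z w. ?f x y z u v w)))"
      using assoc_tens[of CP CP CP "tens A H a h" "tens A H b g" "tens A H c l"] m by (simp add: coact_CP)
    also have "\<dots> = ssum H h (\<lambda>h1 h2. tsum AH H (coact AX (tens A H b g)) (\<lambda>y v.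
          tsum AH H (coact AX (tens A H c l)) (\<lambda>z w. ?f (tens A H a h1) y z h2 v w)))"
      using m by (intro csum_CP[OF is_vspace_tensor]) (auto intro!: lin_all lc)
    also have "\<dots> = ssum H h (\<lambda>h1 h2. ssum H g (\<lambda>g1 g2.
          tsum AH H (coact AX (tens A H c l)) (\<lambda>z w. ?f (tens A H a h1) (tens A H b g1) z h2 g2 w)))"
      using m by (intro ssum_cong[OF refl refl] csum_CP[OF is_vspace_tensor]) (auto intro!: lin_all lc)
    also have "\<dots> = ssum H h (\<lambda>h1 h2. ssum H g (\<lambda>g1 g2. ssum H l (\<lambda>l1 l2.
          ?f (tens A H a h1) (tens A H b g1) (tens A H c l1) h2 g2 l2)))"
      using m by (intro ssum_cong[OF refl refl] csum_CP[OF is_vspace_tensor]) (auto intro!: lin_all lc)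
    finally have "?R (tens (tensor AH AH) AH (tens AH AH (tens A H a h) (tens A H b g)) (tens A H c l)) =
        ?Q (ssum H h (\<lambda>h1 h2. ssum H g (\<lambda>g1 g2. ssum H l (\<lambda>l1 l2.
          ?f (tens A H a h1) (tens A H b g1) (tens A H c l1) h2 g2 l2))))"
      by simp
    also have "\<dots> = ssum H h (\<lambda>h1 h2. ssum H g (\<lambda>g1 g2. ssum H l (\<lambda>l1 l2.
        scl AH (phi H h2 g2 l2) (?Q (tens AH (tensor AH AH) (tens A H a h1) (tens AH AH (tens A H b g1) (tens A H c l1)))))))"
      using m by (simp add: lin_ssum[OF LQ is_vspace_tensor] lin_scl[OF LQ] ssum_mem is_vspace_closed(3)
          del: o_apply)
    also have "\<dots> = ssum H h (\<lambda>h1 h2. ssum H g (\<lambda>g1 g2. ssum H l (\<lambda>l1 l2.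
        scl AH (phi H h2 g2 l2) (lact a (cv HHH (tens A H) ?F mult3' (t3 h1 g1 l1))))))"
      using m by (intro ssum_cong[OF refl refl]) (simp add: Q prd_prd_right del: o_apply)
    also have "\<dots> = ssum H h (\<lambda>h1 h2. ssum H g (\<lambda>g1 g2. ssum H l (\<lambda>l1 l2.
        lact a (scl AH (phi H h2 g2 l2) (cv HHH (tens A H) ?F mult3' (t3 h1 g1 l1))))))"
      using m by (intro ssum_cong[OF refl refl]) (simp add: lin_scl[OF bilin_lin2[OF bilin_lact]] lin_mem[OF lG])
    also have "\<dots> = lact a (ssum H h (\<lambda>h1 h2. ssum H g (\<lambda>g1 g2. ssum H l (\<lambda>l1 l2.
        scl AH (phi H h2 g2 l2) (cv HHH (tens A H) ?F mult3' (t3 h1 g1 l1))))))"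
      using m by (simp add: lact_ssum ssum_mem lin_mem[OF lG] is_vspace_closed(3))
    also have "\<dots> = lact a (cv HHH (\<lambda>y c. scl AH c y) (cv HHH (tens A H) ?F mult3') (reass H) (t3 h g l))"
      using m cv_HHH_tens[OF lG lin_reass bilin_scl_right[OF is_vspace_tensor] is_vspace_tensor, of h g l]
      by (simp add: phi_def)
    also have "\<dots> = lact a (cv HHH (tens A H) (cv HHH scr ?F (reass H)) mult3 (t3 h g l))"
      using m by (simp add: shift_phi[OF lF])
    also have "\<dots> = lact a (cv HHH (tens A H)
        (cv HHH m (\<lambda>x. coef b (drop3 x)) (\<lambda>x. coef c (mul_left x))) mult3 (t3 h g l))"
      using m by (intro arg_cong[where f = "lact a"] cv_cong coef_cocycle refl)
    also have "\<dots> = ?L (tens (tensor AH AH) AH (tens AH AH (tens A H a h) (tens A H b g)) (tens A H c l))"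
      using m by (simp add: tmap_tens[OF lin_amult lin_id is_vspace_tensor] prd_prd_left)
    finally show ?thesis by simp
  qed
  have step: "lin AH AH (\<lambda>z. M (tens (tensor AH AH) AH y z))"
    if "lin (tensor (tensor AH AH) AH) AH M" "y \<in> carr (tensor AH AH)" for M y
    by (rule lin_comp[OF that(1) bilin_lin2[OF bilin_tens that(2)]])
  have step': "lin (tensor AH AH) AH (\<lambda>y. M (tens (tensor AH AH) AH y z))"
    if "lin (tensor (tensor AH AH) AH) AH M" "z \<in> carr AH" for M z
    by (rule lin_comp[OF that(1) bilin_lin1[OF bilin_tens that(2)]])
  show ?thesis
  proof (rule tensor_ext[OF LL LR is_vspace_tensor _ t])
    fix y z assume y: "y \<in> carr (tensor AH AH)" and z: "z \<in> carr AH"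
    show "?L (tens (tensor AH AH) AH y z) = ?R (tens (tensor AH AH) AH y z)"
    proof (rule tensor_ext[OF step[OF LL y] step[OF LR y] vspace_A _ z])
      fix c l assume m: "c \<in> carr A" "l \<in> carr H"
      then have z: "tens A H c l \<in> carr AH" by simp
      show "?L (tens (tensor AH AH) AH y (tens A H c l)) = ?R (tens (tensor AH AH) AH y (tens A H c l))"
        by (rule tensor_tensor_ext[OF step'[OF LL z] step'[OF LR z] vspace_A vspace_A _ y])
          (rule pure[OF _ _ _ _ m])
    qed
  qed
qed

lemma prd_unit:
  assumes x: "x \<in> carr AH"
  shows "prd (tens A H e (one H)) x = x" "prd x (tens A H e (one H)) = x"
proof -
  have z: "zeta (t2 (one H) h) = tens A H e h" "zeta (t2 h (one H)) = tens A H e h"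
    if "h \<in> carr H" for h
    using that tens_e_iff[OF lin_ta(1)] tens_e_iff[OF lin_ta(2)] crossed_tau by (simp_all add: zeta_one)
  have u: "tens A H e (one H) \<in> carr AH" by simp
  show "prd (tens A H e (one H)) x = x"
  proof (rule tensor_ext[where G = "\<lambda>x. x", OF bilin_lin2[OF bilin_prd u] lin_ident vspace_A _ x])
    fix b g assume m: "b \<in> carr A" "g \<in> carr H"
    have "prd (tens A H e (one H)) (tens A H b g) =
        ssum H (one H) (\<lambda>h1 h2. lact (dot h1 b) (zeta (t2 h2 g)))"
      using m by (simp add: prd_tens prd4_eq(1))
    also have "\<dots> = lact (dot (one H) b) (zeta (t2 (one H) g))"
      using m by (intro ssum_one[OF is_vspace_tensor]) (auto intro!: lin_all lin_comp[OF lin_zeta])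
    finally show "prd (tens A H e (one H)) (tens A H b g) = tens A H b g"
      using m by (simp add: z crossed_one)
  qed
  show "prd x (tens A H e (one H)) = x"
  proof (rule tensor_ext[where G = "\<lambda>x. x", OF bilin_lin1[OF bilin_prd u] lin_ident vspace_A _ x])
    fix a h assume m: "a \<in> carr A" "h \<in> carr H"
    have "prd (tens A H a h) (tens A H e (one H)) =
        ssum H h (\<lambda>h1 h2. lact (m a (dot h1 e)) (zeta (t2 h2 (one H))))"
      using m by (simp add: prd_tens prd4_eq(1))
    also have "\<dots> = ssum H h (\<lambda>h1 h2. scl AH (\<epsilon> h1) (tens A H a h2))"
      using m by (intro ssum_cong[OF refl refl]) (simp add: z crossed_unit m_scl scl_tens)
    also have "\<dots> = tens A H a h"
      using m by (intro ssum_counit_H(1)[OF is_vspace_tensor] bilin_lin2[OF bilin_tens])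
    finally show "prd (tens A H a h) (tens A H e (one H)) = tens A H a h" .
  qed
qed

theorem comod_algebra_crossed_product: "comod_algebra H CP"
proof -
  have s: "sigma 1 = tens A H e (one H)" by (simp add: sigma_eq vspace_scale)
  have "comod_hom H (unit_comod H) CP sigma"
    using comod_hom_sigma by (simp add: comod_hom_def coact_CP)
  moreover have "amult CP (tmap k_space AH AH AH sigma id (lunit_inv CP x)) = x"
    "amult CP (tmap AH k_space AH AH id sigma (runit_inv CP x)) = x" if "x \<in> carr AH" for x
    using that by (simp_all add: lunit_inv_def runit_inv_def tmap_tens[OF lin_sigma lin_id is_vspace_k_space]
        tmap_tens[OF lin_id lin_sigma is_vspace_tensor] s prd_unit)
  ultimately show ?thesis
    using comodule_CP comod_hom_prd prd_assoc
    by (simp add: comod_algebra_def eq_arr_def aunit_CP)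
qed

end

end

section \<open>Wreaths and crossed systems\<close>

theorem proposition5p5:
  fixes H :: "('k::field, 'h::ab_group_add) dqb"
    and A :: "('k, 'a::ab_group_add) alg"
    and act :: "('h, 'a, 'k) tensor \<Rightarrow> 'a"
    and \<tau> :: "('h, 'h, 'k) tensor \<Rightarrow> 'a"
  assumes "dual_quasi_hopf_algebra H"
    and "k_algebra A"
    and "lin (tensor H A) A act"
    and "lin (tensor H H) A \<tau>"
  shows "(wreath H (trivial_comod_alg H A) (regular_comod H)
            (psi_map H A act) (zeta_map H A \<tau>) (sigma_map H A) \<longleftrightarrow>
          crossed_system H A act \<tau>) \<and>
         (crossed_system H A act \<tau> \<longrightarrow>
            comod_alg_eq
              (wreath_product H (trivial_comod_alg H A) (regular_comod H)
                (psi_map H A act) (zeta_map H A \<tau>) (sigma_map H A))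
              (crossed_product H A act \<tau>) \<and>
            comod_algebra H (crossed_product H A act \<tau>))"
proof -
  interpret crossed_data H A act \<tau>
    using assms by unfold_locales (simp_all add: dual_quasi_hopf_algebra_def)
  show ?thesis
    using wreath_iff_crossed_system wreath_product_eq_crossed_product comod_algebra_crossed_product
    by blast
qed

end
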